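(* Let $n\ge 3$, let $\sigma\in S_n$ satisfy $\sigma(n)=n$ and $\sigma(n-1)=n-1$, and let $\overline{\sigma}\in S_{n-2}$ denote the restriction of $\sigma$ to $\{1,2,\dots,n-2\}$. Define $T_n(\sigma)=\sum_{i=1}^{n-2}\sigma\cdot(i\;\,n-1\;\,n)\in\mathbb{C}S_n$. Then for every partition $\lambda\vdash n$, \[ \chi^{\lambda}(T_n(\sigma))=\sum_{i=1}^{n-2}\chi^{\lambda}\bigl(\sigma\cdot(i\;\,n-1\;\,n)\bigr)=\sum_{\{x,y\}}c(x,y)\,\chi^{\lambda-(x,y)}(\overline{\sigma}), \] where the sum on the right runs over all sets $\{x,y\}$ of two distinct cells of the Ferrers diagram $F_\lambda$ such that $F_\lambda\setminus\{x,y\}$ is the Ferrers diagram of a partition $\lambda-(x,y)\vdash n-2$.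
   Context: For a partition $\lambda\vdash n$, $\chi^\lambda$ denotes the irreducible character of $S_n$ indexed by $\lambda$, extended linearly to the group algebra $\mathbb{C}S_n$; $(a\;b\;c)$ denotes a 3-cycle in cycle notation. The Ferrers diagram $F_\lambda$ of $\lambda=(\lambda_1\ge\dots\ge\lambda_k>0)$ is the set of cells $(i,j)$ with $1\le i\le k$, $1\le j\le\lambda_i$ (row $i$, column $j$, rows numbered top to bottom). The content of a cell $x=(i,j)$ is $c(x)=j-i$. For two removed cells $x,y$ as in the claim, the content $c(x,y)$ is defined as: (i) if $x,y$ form a horizontal domino, with $x$ the left cell and $y$ immediately to its right in the same row, then $c(x,y)=c(x)$; (ii) if $x,y$ form a vertical domino, with $x$ the upper cell and $y$ immediately below it in the same column, then $c(x,y)=-c(x)$; (iii) if $x$ and $y$ are not adjacent, then $c(x,y)=-1$. *)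

theory Defs
  imports
    Complex_Main
    "HOL-Library.Function_Algebras"
    "HOL-Combinatorics.Combinatorics"
begin

section \<open>Partitions and Ferrers diagrams\<close>

text \<open>A partition is the list of its parts, in weakly decreasing order. Cells are pairs
  (row, column), both numbered from 1.\<close>

definition partition_of :: "nat \<Rightarrow> nat list \<Rightarrow> bool" where
  "partition_of n lam \<longleftrightarrow> sorted_wrt (\<ge>) lam \<and> 0 \<notin> set lam \<and> sum_list lam = n"

definition ferrers :: "nat list \<Rightarrow> (nat \<times> nat) set" where
  "ferrers lam = {(i, j). 1 \<le> i \<and> i \<le> length lam \<and> 1 \<le> j \<and> j \<le> lam ! (i - 1)}"

definition content :: "nat \<times> nat \<Rightarrow> int" where
  "content x = int (snd x) - int (fst x)"

text \<open>The cell \<open>x\<close> is the left (respectively upper) cell of the domino \<open>D\<close>.\<close>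

definition horizontal_domino :: "nat \<times> nat \<Rightarrow> (nat \<times> nat) set \<Rightarrow> bool" where
  "horizontal_domino x D \<longleftrightarrow> D = {x, (fst x, snd x + 1)}"

definition vertical_domino :: "nat \<times> nat \<Rightarrow> (nat \<times> nat) set \<Rightarrow> bool" where
  "vertical_domino x D \<longleftrightarrow> D = {x, (fst x + 1, snd x)}"

text \<open>The content of an unordered pair of cells \<open>D = {x, y}\<close>; the cell \<open>x\<close> in the two
  descriptions below is determined by \<open>D\<close>.\<close>

definition pair_content :: "(nat \<times> nat) set \<Rightarrow> int" where
  "pair_content D =
     (if \<exists>x. horizontal_domino x D then content (THE x. horizontal_domino x D)
      else if \<exists>x. vertical_domino x D then - content (THE x. vertical_domino x D)
      else - 1)"

definition removable_pairs :: "nat list \<Rightarrow> (nat \<times> nat) set set" where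
  "removable_pairs lam =
     {D. D \<subseteq> ferrers lam \<and> card D = 2 \<and>
         (\<exists>mu. partition_of (sum_list lam - 2) mu \<and> ferrers mu = ferrers lam - D)}"

definition remove_cells :: "nat list \<Rightarrow> (nat \<times> nat) set \<Rightarrow> nat list" where
  "remove_cells lam D =
     (THE mu. partition_of (sum_list lam - card D) mu \<and> ferrers mu = ferrers lam - D)"


section \<open>The complex group algebra of the symmetric group\<close>

text \<open>Elements of the symmetric group on \<open>{1..n}\<close> are the functions \<open>p\<close> with
  \<open>p permutes {1..n}\<close>, multiplied by composition. An element of its group algebra is its
  coefficient function, which vanishes outside the group. Addition is the pointwise one of
  \<^theory>\<open>HOL-Library.Function_Algebras\<close>; the product is \<open>galg_mult\<close>, not the pointwise one.\<close>

type_synonym galg = "(nat \<Rightarrow> nat) \<Rightarrow> complex"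

definition galg_carrier :: "nat \<Rightarrow> galg set" where
  "galg_carrier n = {a. \<forall>p. \<not> p permutes {1..n} \<longrightarrow> a p = 0}"

definition galg_basis :: "(nat \<Rightarrow> nat) \<Rightarrow> galg" where
  "galg_basis p = (\<lambda>q. if q = p then 1 else 0)"

definition galg_scale :: "complex \<Rightarrow> galg \<Rightarrow> galg" where
  "galg_scale c a = (\<lambda>p. c * a p)"

definition galg_mult :: "nat \<Rightarrow> galg \<Rightarrow> galg \<Rightarrow> galg" where
  "galg_mult n a b =
     (\<Sum>p | p permutes {1..n}. \<Sum>q | q permutes {1..n}.
        galg_scale (a p * b q) (galg_basis (p \<circ> q)))"

global_interpretation galg: vector_space galg_scale
  by unfold_locales (auto simp: galg_scale_def fun_eq_iff algebra_simps)

text \<open>The trace of a linear endomorphism \<open>f\<close> of a finite-dimensional subspace \<open>V\<close>: the sum of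
  the diagonal entries of the matrix of \<open>f\<close> with respect to some basis of \<open>V\<close>.\<close>

definition trace_on :: "galg set \<Rightarrow> (galg \<Rightarrow> galg) \<Rightarrow> complex" where
  "trace_on V f =
     (let B = (SOME B. B \<subseteq> V \<and> galg.independent B \<and> galg.span B = V)
      in \<Sum>b\<in>B. galg.representation B (f b) b)"


section \<open>Irreducible characters of the symmetric group\<close>

text \<open>The canonical tableau of shape \<open>lam\<close> numbers the cells row by row, from left to right.\<close>

definition tableau :: "nat list \<Rightarrow> nat \<times> nat \<Rightarrow> nat" where
  "tableau lam x = sum_list (take (fst x - 1) lam) + snd x"

definition row_group :: "nat list \<Rightarrow> (nat \<Rightarrow> nat) set" where
  "row_group lam =
     {p. p permutes {1..sum_list lam} \<and>
         (\<forall>i. p ` (tableau lam ` {x \<in> ferrers lam. fst x = i})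
              = tableau lam ` {x \<in> ferrers lam. fst x = i})}"

definition column_group :: "nat list \<Rightarrow> (nat \<Rightarrow> nat) set" where
  "column_group lam =
     {p. p permutes {1..sum_list lam} \<and>
         (\<forall>j. p ` (tableau lam ` {x \<in> ferrers lam. snd x = j})
              = tableau lam ` {x \<in> ferrers lam. snd x = j})}"

definition young_symmetrizer :: "nat list \<Rightarrow> galg" where
  "young_symmetrizer lam =
     galg_mult (sum_list lam)
       (\<Sum>p\<in>row_group lam. galg_basis p)
       (\<Sum>q\<in>column_group lam. galg_scale (of_int (sign q)) (galg_basis q))"

text \<open>The irreducible module indexed by \<open>lam\<close> is the left ideal of the group algebra generated by
  the Young symmetrizer, on which the group acts by left multiplication. In this convention the
  one-row partition gives the trivial and the one-column partition the sign representation.\<close>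

definition specht_module :: "nat list \<Rightarrow> galg set" where
  "specht_module lam =
     (\<lambda>a. galg_mult (sum_list lam) a (young_symmetrizer lam)) ` galg_carrier (sum_list lam)"

definition character :: "nat list \<Rightarrow> (nat \<Rightarrow> nat) \<Rightarrow> complex" where
  "character lam p =
     trace_on (specht_module lam) (\<lambda>v. galg_mult (sum_list lam) (galg_basis p) v)"

definition character_lin :: "nat list \<Rightarrow> galg \<Rightarrow> complex" where
  "character_lin lam a = (\<Sum>p | p permutes {1..sum_list lam}. a p * character lam p)"


section \<open>The sum of products with 3-cycles\<close>

definition T_elem :: "nat \<Rightarrow> (nat \<Rightarrow> nat) \<Rightarrow> galg" where
  "T_elem n \<sigma> = (\<Sum>i=1..n - 2. galg_basis (\<sigma> \<circ> cycle_of_list [i, n - 1, n]))"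

end

theory Submission
  imports Defs
begin

text \<open>The character is first identified with an alternating sum of permutation characters. Write
  \<open>\<psi>\<^sup>\<alpha>\<close> for the character of the action on colourings of type \<open>\<alpha>\<close>, number the rows from 0 and put
  \<open>v\<^sub>i = \<lambda>\<^sub>i - i\<close>. Then \<open>\<chi>\<^sup>\<lambda> = \<Phi>\<^sub>v\<close> with \<open>\<Phi>\<^sub>v = \<Sum>w. sgn w \<cdot> \<psi>\<^sup>v\<^sup>+\<^sup>w\<close>. Indeed
  \<open>\<langle>\<chi>\<^sup>\<lambda>, \<chi>\<^sup>\<lambda>\<rangle> = 1\<close> because the Young symmetrizer is a multiple of a primitive idempotent;
  \<open>\<langle>\<chi>\<^sup>\<lambda>, \<Phi>\<^sub>v\<rangle> = 1\<close> because it kills every colouring type that \<open>\<lambda>\<close> does not dominate; and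
  \<open>\<langle>\<Phi>\<^sub>v, \<Phi>\<^sub>v\<rangle> = 1\<close> is a signed count of nonnegative integer matrices, in which Pieri's rule leaves
  a single term. Hence \<open>\<chi>\<^sup>\<lambda> - \<Phi>\<^sub>v\<close> has norm 0.

  A colouring is fixed by \<open>\<sigma> (i n-1 n)\<close> iff it is fixed by \<open>\<sigma>\<close> and constant on \<open>{i, n-1, n}\<close>, so the sum
  over \<open>i\<close> weights each colouring of \<open>{1..n-2}\<close> by the size of a colour class. An identity for the
  Vandermonde determinant absorbs the weights and yields
  \<open>(\<Sum>k. (v\<^sub>k - 2) \<Phi>) - (\<Sum>i<j. \<Phi>)\<close>, where \<open>\<Phi>\<close> is taken at \<open>v - 2e\<^sub>k\<close> and \<open>v - e\<^sub>i - e\<^sub>j\<close>. As \<open>\<Phi>\<close> is alternating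
  in \<open>v\<close>, a term vanishes unless it belongs to a removable pair of cells, up to sign when \<open>v - 2e\<^sub>k\<close>
  must be reordered; this last case contributes to the vertical dominoes.\<close>

text \<open>\<open>\<Phi>\<close> is the Jacobi-Trudi determinant: for a multiplicative
  \<open>N\<close>, \<open>altsum\<close> is the determinant with entry at \<open>v i + j\<close> in
  place \<open>(i, j)\<close>. It makes sense for every integer vector \<open>v\<close>, so the sum
  over the three-cycles can be computed before it is known which shifted vectors are partitions;
  alternation then disposes of the others. The obstacle is the character itself, a trace in a basis
  obtained by choice on a left ideal. The trace of \<open>x \<mapsto> g x e\<close> over the whole
  algebra avoids that basis: it expresses \<open>kappa * chi g\<close> as the sum of
  \<open>e\<close> over all conjugates of the inverse of \<open>g\<close>, so every inner product
  with \<open>chi\<close> becomes a computation with coefficients of \<open>e\<close>. The scalar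
  \<open>kappa\<close> stays implicit and cancels. Inner products are plain sums of products over
  the group: no conjugation, because all values are real, and no division by the group order, so
  \<open>fact n\<close> stands where the overview has 1.\<close>

declare One_nat_def [simp del]

section \<open>Convolution and traces in the group algebra\<close>

abbreviation symg :: "nat \<Rightarrow> (nat \<Rightarrow> nat) set" where
  "symg n \<equiv> {p. p permutes {1..n}}"

lemma sum_fun_apply: "(\<Sum>x\<in>A. f x) y = (\<Sum>x\<in>A. f x y)"
  by (induction A rule: infinite_finite_induct) auto

lemma finite_permutes [simp]: "finite A \<Longrightarrow> finite {p. p permutes A}"
  by (rule finite_permutations)

lemma symg_inv_comp [simp]:
  "p permutes A \<Longrightarrow> inv p \<circ> p = id" "p permutes A \<Longrightarrow> p \<circ> inv p = id"
  by (simp_all add: permutes_inv_o)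

lemma symg_inv_comp_left [simp]:
  "p permutes A \<Longrightarrow> inv p \<circ> (p \<circ> g) = g" "p permutes A \<Longrightarrow> p \<circ> (inv p \<circ> g) = g"
  by (simp_all flip: comp_assoc)

lemma symg_inv_inv [simp]: "p permutes A \<Longrightarrow> inv (inv p) = p"
  by (rule permutes_inv_inv)

lemma symg_inv_comp_distrib:
  "p permutes A \<Longrightarrow> q permutes A \<Longrightarrow> inv (p \<circ> q) = inv q \<circ> inv p"
  by (simp add: o_inv_distrib permutes_bij)

lemma symg_comp_eq_iff:
  "p permutes A \<Longrightarrow> p \<circ> q = g \<longleftrightarrow> q = inv p \<circ> g"
  by auto

lemma galg_mult_apply:
  assumes g: "g permutes {1..n}"
  shows "galg_mult n x y g = (\<Sum>p\<in>symg n. x p * y (inv p \<circ> g))"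
proof -
  have "galg_mult n x y g
      = (\<Sum>p\<in>symg n. \<Sum>q\<in>symg n. if q = inv p \<circ> g then x p * y q else 0)"
    unfolding galg_mult_def sum_fun_apply galg_scale_def galg_basis_def
    by (intro sum.cong refl) (auto simp: symg_comp_eq_iff)
  also have "\<dots> = (\<Sum>p\<in>symg n. x p * y (inv p \<circ> g))"
    using g by (intro sum.cong refl)
      (simp add: sum.delta permutes_compose permutes_inv)
  finally show ?thesis .
qed

lemma galg_mult_outside: "\<not> g permutes {1..n} \<Longrightarrow> galg_mult n x y g = 0"
  unfolding galg_mult_def sum_fun_apply galg_scale_def galg_basis_def
  by (intro sum.neutral ballI) (auto dest: permutes_compose)

lemma galg_mult_carrier [simp]: "galg_mult n x y \<in> galg_carrier n"
  by (simp add: galg_carrier_def galg_mult_outside)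

lemma galg_eqI:
  assumes "x \<in> galg_carrier n" "y \<in> galg_carrier n" "\<And>g. g permutes {1..n} \<Longrightarrow> x g = y g"
  shows "x = y"
  using assms by (force simp: galg_carrier_def fun_eq_iff)

lemma galg_scale_carrier: "x \<in> galg_carrier n \<Longrightarrow> galg_scale c x \<in> galg_carrier n"
  by (simp add: galg_carrier_def galg_scale_def)

lemma galg_mult_assoc: "galg_mult n (galg_mult n x y) z = galg_mult n x (galg_mult n y z)"
proof (rule galg_eqI[of _ n])
  fix g assume g: "g permutes {1..n}"
  have "galg_mult n (galg_mult n x y) z g
      = (\<Sum>p\<in>symg n. \<Sum>q\<in>symg n. x q * y (inv q \<circ> p) * z (inv p \<circ> g))"
    using g by (simp add: galg_mult_apply sum_distrib_right)
  also have "\<dots> = (\<Sum>q\<in>symg n. \<Sum>p\<in>symg n. x q * y (inv q \<circ> p) * z (inv p \<circ> g))"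
    by (rule sum.swap)
  also have "\<dots> = (\<Sum>q\<in>symg n. \<Sum>p\<in>symg n. x q * (y p * z (inv p \<circ> (inv q \<circ> g))))"
  proof (rule sum.cong[OF refl])
    fix q assume "q \<in> symg n"
    then have q: "q permutes {1..n}" by simp
    have "(\<Sum>p\<in>symg n. x q * y (inv q \<circ> p) * z (inv p \<circ> g))
        = (\<Sum>p\<in>symg n. x q * y (inv q \<circ> (q \<circ> p)) * z (inv (q \<circ> p) \<circ> g))"
      by (rule setum_permutations_compose_left[OF q])
    also have "\<dots> = (\<Sum>p\<in>symg n. x q * (y p * z (inv p \<circ> (inv q \<circ> g))))"
      using q by (intro sum.cong refl) (simp add: symg_inv_comp_distrib comp_assoc mult.assoc)
    finally show "(\<Sum>p\<in>symg n. x q * y (inv q \<circ> p) * z (inv p \<circ> g)) = \<dots>" .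
  qed
  also have "\<dots> = galg_mult n x (galg_mult n y z) g"
    using g by (simp add: galg_mult_apply permutes_compose permutes_inv sum_distrib_left)
  finally show "galg_mult n (galg_mult n x y) z g = galg_mult n x (galg_mult n y z) g" .
qed simp_all

lemma galg_basis_mult_apply:
  assumes "p permutes {1..n}" "g permutes {1..n}"
  shows "galg_mult n (galg_basis p) y g = y (inv p \<circ> g)"
  using assms by (simp add: galg_mult_apply galg_basis_def if_distrib[of "\<lambda>t. t * _"] cong: if_cong)

lemma galg_mult_basis_apply:
  assumes p: "p permutes {1..n}" and g: "g permutes {1..n}"
  shows "galg_mult n x (galg_basis p) g = x (g \<circ> inv p)"
proof -
  have "(inv q \<circ> g = p) = (q = g \<circ> inv p)" if q: "q permutes {1..n}" for q
  proof
    assume "inv q \<circ> g = p"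
    then have "q \<circ> (inv q \<circ> g) \<circ> inv p = q \<circ> p \<circ> inv p" by simp
    then show "q = g \<circ> inv p" using p q by (simp add: comp_assoc)
  next
    assume e: "q = g \<circ> inv p"
    have "inv q = p \<circ> inv g"
      unfolding e using p g by (simp add: symg_inv_comp_distrib permutes_inv)
    then show "inv q \<circ> g = p" using g by (simp add: comp_assoc)
  qed
  then have "galg_mult n x (galg_basis p) g = (\<Sum>q\<in>symg n. if q = g \<circ> inv p then x q else 0)"
    using g unfolding galg_mult_apply[OF g] galg_basis_def by (intro sum.cong refl) simp
  then show ?thesis
    using p g by (simp add: permutes_compose permutes_inv)
qed

lemma galg_mult_scale_right: "galg_mult n x (galg_scale c y) = galg_scale c (galg_mult n x y)"
  by (rule galg_eqI[of _ n])
    (simp_all add: galg_scale_carrier galg_mult_apply, simp add: galg_scale_def galg_mult_apply sum_distrib_left mult.left_commute)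

lemma galg_mult_scale_left: "galg_mult n (galg_scale c x) y = galg_scale c (galg_mult n x y)"
  by (rule galg_eqI[of _ n])
    (simp_all add: galg_scale_carrier galg_mult_apply, simp add: galg_scale_def galg_mult_apply sum_distrib_left mult.assoc)

text \<open>Linearity in the middle factor: what is known of \<open>x h z\<close> for group elements
  \<open>h\<close> extends to \<open>x y z\<close>.\<close>

lemma galg_mult_expand_middle:
  assumes "g permutes {1..n}"
  shows "galg_mult n x (galg_mult n y z) g
    = (\<Sum>h\<in>symg n. y h * galg_mult n x (galg_mult n (galg_basis h) z) g)"
proof -
  have "galg_mult n x (galg_mult n y z) g
      = (\<Sum>p\<in>symg n. \<Sum>h\<in>symg n. y h * (x p * z (inv h \<circ> (inv p \<circ> g))))"
    using assms by (simp add: galg_mult_apply permutes_compose permutes_inv sum_distrib_left mult.left_commute)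
  also have "\<dots> = (\<Sum>h\<in>symg n. \<Sum>p\<in>symg n. y h * (x p * z (inv h \<circ> (inv p \<circ> g))))"
    by (rule sum.swap)
  also have "\<dots> = (\<Sum>h\<in>symg n. y h * (\<Sum>p\<in>symg n. x p * galg_mult n (galg_basis h) z (inv p \<circ> g)))"
    using assms by (simp add: galg_basis_mult_apply permutes_compose permutes_inv sum_distrib_left)
  also have "\<dots> = (\<Sum>h\<in>symg n. y h * galg_mult n x (galg_mult n (galg_basis h) z) g)"
    using assms by (simp add: galg_mult_apply)
  finally show ?thesis .
qed

lemma galg_basis_carrier: "p permutes {1..n} \<Longrightarrow> galg_basis p \<in> galg_carrier n"
  by (auto simp: galg_basis_def galg_carrier_def)

lemma galg_carrier_expand:
  assumes "x \<in> galg_carrier n"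
  shows "x = (\<Sum>h\<in>symg n. galg_scale (x h) (galg_basis h))"
proof
  fix g
  have "(\<Sum>h\<in>symg n. galg_scale (x h) (galg_basis h)) g = (\<Sum>h\<in>symg n. if g = h then x h else 0)"
    by (simp add: sum_fun_apply galg_scale_def galg_basis_def if_distrib cong: if_cong)
  also have "\<dots> = x g"
    using assms by (auto simp: galg_carrier_def)
  finally show "x g = (\<Sum>h\<in>symg n. galg_scale (x h) (galg_basis h)) g" by simp
qed

lemma galg_mult_left_expand:
  "galg_mult n y e = (\<Sum>h\<in>symg n. galg_scale (y h) (galg_mult n (galg_basis h) e))"
proof
  fix g
  show "galg_mult n y e g = (\<Sum>h\<in>symg n. galg_scale (y h) (galg_mult n (galg_basis h) e)) g"
  proof (cases "g permutes {1..n}")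
    case True
    then show ?thesis
      by (simp add: sum_fun_apply galg_scale_def galg_mult_apply[OF True, of y] galg_basis_mult_apply)
  next
    case False
    then show ?thesis by (simp add: sum_fun_apply galg_scale_def galg_mult_outside)
  qed
qed

text \<open>\<open>trace_on\<close> sums over a basis obtained by choice; over an infinite one the
  sum would be 0 by convention.\<close>

lemma finite_independent_galg_carrier:
  assumes "galg.independent B" "B \<subseteq> galg_carrier n"
  shows "finite B"
proof -
  have "B \<subseteq> galg.span (galg_basis ` symg n)"
  proof
    fix x assume "x \<in> B"
    then have x: "x = (\<Sum>h\<in>symg n. galg_scale (x h) (galg_basis h))"
      using assms galg_carrier_expand by blast
    show "x \<in> galg.span (galg_basis ` symg n)"
      by (subst x, intro galg.span_sum galg.span_scale galg.span_base) auto
  qed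
  then show ?thesis
    using galg.independent_span_bound[of "galg_basis ` symg n" B] assms by simp
qed

text \<open>Both sides are traces on the whole group algebra of \<open>x \<mapsto> g x e\<close>: the left one in the
  basis of group elements, the right one because right multiplication by \<open>e\<close> maps onto the
  ideal and is \<open>\<kappa>\<close> there.\<close>

lemma trace_on_left_ideal:
  assumes ee: "galg_mult n e e = galg_scale \<kappa> e" and g: "g permutes {1..n}"
  shows "(\<Sum>h\<in>symg n. e (inv h \<circ> (inv g \<circ> h)))
    = \<kappa> * trace_on ((\<lambda>a. galg_mult n a e) ` galg_carrier n) (\<lambda>v. galg_mult n (galg_basis g) v)"
proof -
  define V where "V = (\<lambda>a. galg_mult n a e) ` galg_carrier n"
  define B where "B = (SOME B. B \<subseteq> V \<and> galg.independent B \<and> galg.span B = V)"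
  have VI: "galg_mult n a e \<in> V" for a
  proof -
    \<comment> \<open>\<open>galg_mult\<close> reads \<open>a\<close> only on the group, so cutting
      it off outside leaves the product unchanged and puts it into the carrier.\<close>
    define a' where "a' = (\<lambda>p. if p permutes {1..n} then a p else 0)"
    have "galg_mult n a e = galg_mult n a' e"
      by (rule galg_eqI[of _ n]) (auto simp: galg_mult_apply a'_def)
    moreover have "a' \<in> galg_carrier n" by (auto simp: a'_def galg_carrier_def)
    ultimately show ?thesis by (simp add: V_def)
  qed
  have Ve: "galg_mult n v e = galg_scale \<kappa> v" if "v \<in> V" for v
    using that by (auto simp: V_def galg_mult_assoc ee galg_mult_scale_right)
  have Vc: "V \<subseteq> galg_carrier n" by (auto simp: V_def)
  have "galg.subspace V"
  proof (rule galg.subspaceI)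
    have "galg_mult n 0 e = 0"
      by (rule galg_eqI[of _ n]) (simp_all add: galg_mult_apply, simp add: galg_carrier_def)
    then show "0 \<in> V" using VI[of 0] by simp
  next
    fix x y assume "x \<in> V" "y \<in> V"
    then obtain a b where ab: "x = galg_mult n a e" "y = galg_mult n b e" by (auto simp: V_def)
    have "x + y = galg_mult n (a + b) e"
      unfolding ab by (rule galg_eqI[of _ n])
        (simp_all add: galg_mult_apply ring_distribs sum.distrib,
         simp add: galg_carrier_def galg_mult_outside)
    then show "x + y \<in> V" by (simp add: VI)
  next
    fix c x assume "x \<in> V"
    then obtain a where ab: "x = galg_mult n a e" by (auto simp: V_def)
    then have "galg_scale c x = galg_mult n (galg_scale c a) e"
      by (simp add: galg_mult_scale_left)
    then show "galg_scale c x \<in> V" by (simp add: VI)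
  qed
  then have "\<exists>B. B \<subseteq> V \<and> galg.independent B \<and> galg.span B = V"
    using galg.basis_exists[of V] galg.span_minimal[of _ V] by (metis subset_antisym)
  from someI_ex[OF this] have B: "B \<subseteq> V" "galg.independent B" "galg.span B = V"
    unfolding B_def[symmetric] by auto
  have fB: "finite B" using B Vc finite_independent_galg_carrier by blast
  define L where "L = galg_mult n (galg_basis g)"
  have LV: "L v \<in> V" if "v \<in> V" for v
    using that VI by (auto simp: L_def V_def simp flip: galg_mult_assoc)
  have L: "L y h = y (inv g \<circ> h)" if "h \<in> symg n" for y h
    using that g by (simp add: L_def galg_basis_mult_apply)
  define r where "r h b = galg.representation B (galg_mult n (galg_basis h) e) b" for h b
  \<comment> \<open>The summand is the coefficient of \<open>h\<close> in \<open>g h e\<close>.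
    Expanding \<open>h e\<close> in \<open>B\<close> and summing over \<open>h\<close> first yields
    the coefficient of \<open>b\<close> in \<open>(g b) e\<close>, which is \<open>\<kappa>\<close>
    times that in \<open>g b\<close>.\<close>
  have "(\<Sum>h\<in>symg n. e (inv h \<circ> (inv g \<circ> h))) = (\<Sum>h\<in>symg n. \<Sum>b\<in>B. L b h * r h b)"
  proof (rule sum.cong[OF refl])
    fix h assume h: "h \<in> symg n"
    have "e (inv h \<circ> (inv g \<circ> h)) = galg_mult n (galg_basis h) e (inv g \<circ> h)"
      using h g by (simp add: galg_basis_mult_apply permutes_compose permutes_inv)
    also have "galg_mult n (galg_basis h) e = (\<Sum>b\<in>B. galg_scale (r h b) b)"
      unfolding r_def using B VI fB by (intro galg.sum_representation_eq[symmetric]) auto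
    also have "\<dots> (inv g \<circ> h) = (\<Sum>b\<in>B. L b h * r h b)"
      using h by (simp add: sum_fun_apply galg_scale_def L mult.commute)
    finally show "e (inv h \<circ> (inv g \<circ> h)) = (\<Sum>b\<in>B. L b h * r h b)" .
  qed
  also have "\<dots> = (\<Sum>b\<in>B. \<Sum>h\<in>symg n. L b h * r h b)" by (rule sum.swap)
  also have "\<dots> = (\<Sum>b\<in>B. \<kappa> * galg.representation B (L b) b)"
  proof (rule sum.cong[OF refl])
    fix b assume b: "b \<in> B"
    have "(\<Sum>h\<in>symg n. L b h * r h b)
        = (\<Sum>h\<in>symg n. galg.representation B (galg_scale (L b h) (galg_mult n (galg_basis h) e)) b)"
      unfolding r_def using B VI by (simp add: galg.representation_scale)
    also have "\<dots> = galg.representation B (galg_mult n (L b) e) b"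
      unfolding galg_mult_left_expand[of n "L b" e]
      using B VI galg.span_scale by (subst galg.representation_sum) auto
    also have "\<dots> = \<kappa> * galg.representation B (L b) b"
      using B b LV Ve by (subst Ve) (auto simp: galg.representation_scale)
    finally show "(\<Sum>h\<in>symg n. L b h * r h b) = \<kappa> * galg.representation B (L b) b" .
  qed
  also have "\<dots> = \<kappa> * trace_on V (\<lambda>v. galg_mult n (galg_basis g) v)"
    by (simp add: trace_on_def B_def Let_def L_def sum_distrib_left)
  finally show ?thesis by (simp add: V_def)
qed

section \<open>Young symmetrizers\<close>

lemma count_eq_imp_permutes:
  assumes "finite A" and eq: "\<And>y. card {x \<in> A. F x = y} = card {x \<in> A. F' x = y}"
  obtains q where "q permutes A" "\<forall>x\<in>A. F x = F' (q x)"
proof -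
  have "count (image_mset F (mset_set A)) y = card {x \<in> A. F x = y}" for F :: "'a \<Rightarrow> 'b" and y
  proof -
    have "F -` {y} \<inter> A = {x \<in> A. F x = y}" by auto
    then show ?thesis using \<open>finite A\<close> by (simp add: count_image_mset)
  qed
  then have "image_mset F (mset_set A) = image_mset F' (mset_set A)"
    by (intro multiset_eqI) (simp add: eq)
  then show thesis using image_mset_eq_implies_permutes[OF \<open>finite A\<close>] that by blast
qed

lemma card_fibres:
  assumes "finite A"
  shows "card {x \<in> A. P x} = (\<Sum>j\<in>c ` A. card {x \<in> A. c x = j \<and> P x})"
proof -
  have "(\<Sum>j\<in>c ` A. sum (\<lambda>_. 1::nat) {x \<in> {x \<in> A. P x}. c x = j}) = sum (\<lambda>_. 1) {x \<in> A. P x}"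
    using assms by (intro sum.group) auto
  moreover have "{x \<in> {x \<in> A. P x}. c x = j} = {x \<in> A. c x = j \<and> P x}" for j by auto
  ultimately show ?thesis by simp
qed

lemma card_permute_filter:
  assumes "q permutes A"
  shows "card {x \<in> A. P (q x)} = card {x \<in> A. P x}"
proof (rule bij_betw_same_card)
  show "bij_betw q {x \<in> A. P (q x)} {x \<in> A. P x}"
  proof (rule bij_betw_subset[OF permutes_imp_bij[OF assms]])
    show "q ` {x \<in> A. P (q x)} = {x \<in> A. P x}"
    proof safe
      fix y assume y: "y \<in> A" "P y"
      have "y = q (inv q y)" using assms by (simp add: permutes_inverses)
      moreover have "inv q y \<in> A" using assms y by (simp add: permutes_in_image permutes_inv)
      ultimately show "y \<in> q ` {x \<in> A. P (q x)}" using y by (metis (mono_tags, lifting) image_eqI mem_Collect_eq)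
    qed (use assms in \<open>auto simp: permutes_in_image\<close>)
  qed auto
qed

lemma sum_permutes_conj:
  assumes "h permutes A"
  shows "(\<Sum>g | g permutes A. F (inv h \<circ> (g \<circ> h))) = (\<Sum>g | g permutes A. F g)"
proof -
  have "(\<Sum>g | g permutes A. F g) = (\<Sum>g | g permutes A. F (inv h \<circ> g))"
    by (rule setum_permutations_compose_left[OF permutes_inv[OF assms]])
  also have "\<dots> = (\<Sum>g | g permutes A. F (inv h \<circ> (g \<circ> h)))"
    by (rule sum_permutations_compose_right[OF assms])
  finally show ?thesis ..
qed

text \<open>A tableau given by the row \<open>r\<close> and the column \<open>c\<close> of each
  entry. The shape enters through \<open>column_top\<close>: columns start in row 0 and have no
  gaps.\<close>

locale filling =
  fixes n :: nat and r c :: "nat \<Rightarrow> nat"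
  assumes rc_inj: "\<lbrakk>x \<in> {1..n}; y \<in> {1..n}; r x = r y; c x = c y\<rbrakk> \<Longrightarrow> x = y"
    and column_top: "\<lbrakk>x \<in> {1..n}; i \<le> r x\<rbrakk> \<Longrightarrow> \<exists>y\<in>{1..n}. r y = i \<and> c y = c x"
begin

abbreviation mul (infixl "\<star>" 70) where "x \<star> y \<equiv> galg_mult n x y"

definition R where "R = {p. p permutes {1..n} \<and> (\<forall>x\<in>{1..n}. r (p x) = r x)}"
definition C where "C = {p. p permutes {1..n} \<and> (\<forall>x\<in>{1..n}. c (p x) = c x)}"
definition a :: galg where "a = (\<lambda>p. if p \<in> R then 1 else 0)"
definition b :: galg where "b = (\<lambda>q. if q \<in> C then of_int (sign q) else 0)"
definition e :: galg where "e = a \<star> b"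

text \<open>For \<open>f = r \<circ> g\<close> this says that no two entries share a column while
  their images under \<open>g\<close> share a row; for a colouring, that no column repeats a
  colour.\<close>

definition col_inj where
  "col_inj f \<longleftrightarrow> (\<forall>x\<in>{1..n}. \<forall>y\<in>{1..n}. c x = c y \<and> f x = f y \<longrightarrow> x = y)"

lemma col_injD:
  "col_inj f \<Longrightarrow> x \<in> {1..n} \<Longrightarrow> y \<in> {1..n} \<Longrightarrow> c x = c y \<Longrightarrow> f x = f y \<Longrightarrow> x = y"
  unfolding col_inj_def by blast

text \<open>Values below \<open>t\<close> in one column are distinct, so there are at most
  \<open>t\<close> of them, and at most as many as the column has entries. By
  \<open>column_top\<close> the right side is the smaller of these two numbers.\<close>

lemma col_inj_card_le:
  assumes "col_inj f"
  shows "card {x \<in> {1..n}. c x = j \<and> f x < t} \<le> card {x \<in> {1..n}. c x = j \<and> r x < (t::nat)}"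
proof (cases "\<forall>x\<in>{1..n}. c x = j \<longrightarrow> r x < t")
  case True
  then show ?thesis by (intro card_mono) auto
next
  case False
  then obtain x where x: "x \<in> {1..n}" "c x = j" "t \<le> r x" by (metis not_le)
  have "card {x \<in> {1..n}. c x = j \<and> f x < t} \<le> card {..<t}"
    using col_injD[OF assms] by (intro card_inj_on_le[of f] inj_onI) auto
  also have "\<dots> \<le> card (r ` {x \<in> {1..n}. c x = j \<and> r x < t})"
  proof (intro card_mono subsetI)
    fix i assume i: "i \<in> {..<t}"
    then obtain y where "y \<in> {1..n}" "r y = i" "c y = c x"
      using column_top[of x i] x by auto
    then show "i \<in> r ` {x \<in> {1..n}. c x = j \<and> r x < t}"
      using i x by auto
  qed simp
  also have "\<dots> \<le> card {x \<in> {1..n}. c x = j \<and> r x < t}"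
    by (rule card_image_le) simp
  finally show ?thesis .
qed

text \<open>Dominance order: summing the bounds over the columns shows that the type of
  \<open>f\<close> is dominated by the shape.\<close>

lemma col_inj_dominance:
  assumes "col_inj f"
  shows "card {x \<in> {1..n}. f x < t} \<le> card {x \<in> {1..n}. r x < (t::nat)}"
proof -
  have "(\<Sum>j\<in>c ` {1..n}. card {x \<in> {1..n}. c x = j \<and> f x < t})
      \<le> (\<Sum>j\<in>c ` {1..n}. card {x \<in> {1..n}. c x = j \<and> r x < t})"
    by (intro sum_mono col_inj_card_le assms)
  then show ?thesis
    by (simp only: card_fibres[of "{1..n}" "\<lambda>x. f x < t" c] card_fibres[of "{1..n}" "\<lambda>x. r x < t" c]
        finite_atLeastAtMost)
qed

text \<open>Equality in a sum of termwise inequalities forces equality in each column. So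
  \<open>f\<close> and \<open>r\<close> take the same values with the same multiplicities on each
  column, and a column permutation matches them.\<close>

lemma col_inj_same_type:
  assumes f: "col_inj f"
    and eq: "\<And>t. card {x \<in> {1..n}. f x < t} = card {x \<in> {1..n}. r x < (t::nat)}"
  obtains q where "q \<in> C" "\<forall>x\<in>{1..n}. f x = r (q x)"
proof -
  have lt: "card {x \<in> {1..n}. c x = j \<and> f x < t} = card {x \<in> {1..n}. c x = j \<and> r x < t}" for j t
  proof (cases "j \<in> c ` {1..n}")
    case True
    have "(\<Sum>j\<in>c ` {1..n}. card {x \<in> {1..n}. c x = j \<and> f x < t})
        = (\<Sum>j\<in>c ` {1..n}. card {x \<in> {1..n}. c x = j \<and> r x < t})"
      using eq[of t]
      unfolding card_fibres[OF finite_atLeastAtMost, of 1 n "\<lambda>x. f x < t" c]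
        card_fibres[OF finite_atLeastAtMost, of 1 n "\<lambda>x. r x < t" c] .
    then have "(\<lambda>j. card {x \<in> {1..n}. c x = j \<and> f x < t}) j
        = (\<lambda>j. card {x \<in> {1..n}. c x = j \<and> r x < t}) j"
      by (rule sum_mono_inv) (rule col_inj_card_le[OF f] True finite_imageI finite_atLeastAtMost)+
    then show ?thesis .
  next
    case False
    then have "{x \<in> {1..n}. c x = j \<and> f x < t} = {}" "{x \<in> {1..n}. c x = j \<and> r x < t} = {}"
      by auto
    then show ?thesis by (simp only:)
  qed
  have level: "card {x \<in> {1..n}. c x = j \<and> g x = i}
      = card {x \<in> {1..n}. c x = j \<and> g x < Suc i} - card {x \<in> {1..n}. c x = j \<and> g x < i}"
    for j i and g :: "nat \<Rightarrow> nat"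
  proof -
    have *: "{x \<in> {1..n}. c x = j \<and> g x = i}
        = {x \<in> {1..n}. c x = j \<and> g x < Suc i} - {x \<in> {1..n}. c x = j \<and> g x < i}"
      unfolding set_eq_iff mem_Collect_eq Diff_iff by (intro allI, linarith)
    have "{x \<in> {1..n}. c x = j \<and> g x < i} \<subseteq> {x \<in> {1..n}. c x = j \<and> g x < Suc i}"
      by auto
    then show ?thesis
      unfolding * by (intro card_Diff_subset) auto
  qed
  have type: "card {x \<in> {1..n}. (c x, f x) = y} = card {x \<in> {1..n}. (c x, r x) = y}" for y
  proof (cases y)
    case (Pair j i)
    show ?thesis
      unfolding Pair prod.inject level[of j f i] level[of j r i] lt by (rule refl)
  qed
  obtain q where q: "q permutes {1..n}" "\<forall>x\<in>{1..n}. (c x, f x) = (c (q x), r (q x))"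
    using count_eq_imp_permutes[OF finite_atLeastAtMost type] .
  then have "q \<in> C" "\<forall>x\<in>{1..n}. f x = r (q x)"
    by (auto simp: C_def)
  then show thesis by (rule that)
qed

section \<open>The row and column groups and their sums \<open>a\<close> and
  \<open>b\<close>\<close>

lemma R_permutes: "p \<in> R \<Longrightarrow> p permutes {1..n}" and C_permutes: "q \<in> C \<Longrightarrow> q permutes {1..n}"
  by (simp_all add: R_def C_def)

lemma permutes_mem: "p permutes {1..n} \<Longrightarrow> x \<in> {1..n} \<Longrightarrow> p x \<in> {1..n}"
  by (simp only: permutes_in_image)

lemma inv_comp:
  "p permutes {1..n} \<Longrightarrow> q permutes {1..n} \<Longrightarrow> inv (p \<circ> q) = inv q \<circ> inv p"
  by (rule symg_inv_comp_distrib)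

lemma R_comp:
  assumes "p \<in> R" "q \<in> R" shows "p \<circ> q \<in> R"
proof -
  have "r ((p \<circ> q) x) = r x" if "x \<in> {1..n}" for x
    using assms that permutes_mem[OF R_permutes[OF assms(2)] that] unfolding R_def by simp
  then show ?thesis
    using assms R_permutes permutes_compose by (simp only: R_def) blast
qed

lemma R_inv:
  assumes "p \<in> R" shows "inv p \<in> R"
proof -
  note p = R_permutes[OF assms]
  have "r (inv p x) = r x" if "x \<in> {1..n}" for x
    using assms permutes_mem[OF permutes_inv[OF p] that] permutes_inverses(1)[OF p, of x]
    unfolding R_def by force
  then show ?thesis
    using permutes_inv[OF p] by (simp only: R_def) blast
qed

lemma C_comp:
  assumes "p \<in> C" "q \<in> C" shows "p \<circ> q \<in> C"
proof -
  have "c ((p \<circ> q) x) = c x" if "x \<in> {1..n}" for x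
    using assms that permutes_mem[OF C_permutes[OF assms(2)] that] unfolding C_def by simp
  then show ?thesis
    using assms C_permutes permutes_compose by (simp only: C_def) blast
qed

lemma C_inv:
  assumes "p \<in> C" shows "inv p \<in> C"
proof -
  note p = C_permutes[OF assms]
  have "c (inv p x) = c x" if "x \<in> {1..n}" for x
    using assms permutes_mem[OF permutes_inv[OF p] that] permutes_inverses(1)[OF p, of x]
    unfolding C_def by force
  then show ?thesis
    using permutes_inv[OF p] by (simp only: C_def) blast
qed

lemma R_comp_iff: "p \<in> R \<Longrightarrow> p \<circ> q \<in> R \<longleftrightarrow> q \<in> R"
  using R_comp[of p q] R_comp[OF R_inv, of p "p \<circ> q"] symg_inv_comp_left(1)[OF R_permutes, of p q]
  by auto

lemma R_comp_iff2: "p \<in> R \<Longrightarrow> q \<circ> p \<in> R \<longleftrightarrow> q \<in> R"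
  using R_comp[of q p] R_comp[OF _ R_inv, of "q \<circ> p" p] R_permutes[of p]
  by (auto simp: comp_assoc)

lemma C_comp_iff: "p \<in> C \<Longrightarrow> p \<circ> q \<in> C \<longleftrightarrow> q \<in> C"
  using C_comp[of p q] C_comp[OF C_inv, of p "p \<circ> q"] symg_inv_comp_left(1)[OF C_permutes, of p q]
  by auto

lemma id_R: "id \<in> R" and id_C: "id \<in> C"
  by (simp_all add: R_def C_def permutes_id)

lemma R_inter_C: "p \<in> R \<Longrightarrow> p \<in> C \<Longrightarrow> p = id"
proof -
  assume "p \<in> R" and "p \<in> C"
  have "p x = x" for x
  proof (cases "x \<in> {1..n}")
    case True
    then show ?thesis
      by (rule rc_inj[OF permutes_mem[OF R_permutes[OF \<open>p \<in> R\<close>]]])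
        (use True \<open>p \<in> R\<close> \<open>p \<in> C\<close> in \<open>simp_all add: R_def C_def\<close>)
  qed (rule permutes_not_in[OF R_permutes[OF \<open>p \<in> R\<close>]])
  then show "p = id" by auto
qed

lemma finite_R: "finite R" and finite_C: "finite C"
  unfolding R_def C_def by (rule finite_subset[OF _ finite_permutes[OF finite_atLeastAtMost]], blast)+

lemma sign_mult_permutes:
  "p permutes {1..n} \<Longrightarrow> q permutes {1..n} \<Longrightarrow> sign (p \<circ> q) = sign p * sign q"
  by (simp add: sign_compose permutes_imp_permutation[of "{1..n}"])

lemma sign_inv_permutes: "p permutes {1..n} \<Longrightarrow> sign (inv p) = sign p"
  by (simp add: sign_inverse permutes_imp_permutation[of "{1..n}"])

lemma a_inv: "p permutes {1..n} \<Longrightarrow> a (inv p) = a p"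
  using R_inv[of p] R_inv[of "inv p"] by (auto simp: a_def)

lemma b_inv: "p permutes {1..n} \<Longrightarrow> b (inv p) = b p"
  using C_inv[of p] C_inv[of "inv p"] by (auto simp: b_def sign_inv_permutes)

lemma a_carrier: "a \<in> galg_carrier n" and b_carrier: "b \<in> galg_carrier n"
  and e_carrier: "e \<in> galg_carrier n"
  by (auto simp: a_def b_def e_def galg_carrier_def R_def C_def galg_mult_outside)

lemma basis_mult_basis:
  assumes "p permutes {1..n}" "q permutes {1..n}"
  shows "galg_basis p \<star> galg_basis q = galg_basis (p \<circ> q)"
proof (rule galg_eqI[of _ n])
  fix g assume g: "g permutes {1..n}"
  have "inv p \<circ> g = q \<longleftrightarrow> g = p \<circ> q"
    using assms by auto
  then show "(galg_basis p \<star> galg_basis q) g = galg_basis (p \<circ> q) g"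
    using assms g by (simp add: galg_basis_mult_apply) (simp add: galg_basis_def)
qed (use assms in \<open>simp_all add: galg_basis_carrier permutes_compose\<close>)

lemma a_mult_basis: "p \<in> R \<Longrightarrow> a \<star> galg_basis p = a"
proof (rule galg_eqI[of _ n])
  fix g assume "p \<in> R" "g permutes {1..n}"
  then show "(a \<star> galg_basis p) g = a g"
    by (simp add: galg_mult_basis_apply R_permutes) (simp add: a_def R_comp_iff2 R_inv)
qed (simp_all add: a_carrier)

lemma basis_mult_b: "q \<in> C \<Longrightarrow> galg_basis q \<star> b = galg_scale (of_int (sign q)) b"
proof (rule galg_eqI[of _ n])
  fix g assume "q \<in> C" "g permutes {1..n}"
  then show "(galg_basis q \<star> b) g = galg_scale (of_int (sign q)) b g"
    by (simp add: galg_basis_mult_apply C_permutes)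
      (simp add: b_def C_comp_iff C_inv galg_scale_def sign_mult_permutes permutes_inv
        sign_inv_permutes C_permutes)
qed (simp_all add: b_carrier galg_scale_carrier)

lemma a_mult_a: "a \<star> a = galg_scale (of_nat (card R)) a"
proof (rule galg_eqI[of _ n])
  fix g assume g: "g permutes {1..n}"
  have "(a \<star> a) g = (\<Sum>p\<in>symg n. if p \<in> R then a g else 0)"
    unfolding galg_mult_apply[OF g] using g
    by (intro sum.cong refl) (auto simp: a_def R_comp_iff R_inv)
  also have "\<dots> = (\<Sum>p\<in>R. a g)"
    by (rule sum.mono_neutral_cong_right) (auto simp: R_def)
  finally show "(a \<star> a) g = galg_scale (of_nat (card R)) a g"
    by (simp add: galg_scale_def)
qed (simp_all add: a_carrier galg_scale_carrier)

text \<open>\<open>id = p \<circ> q\<close> with \<open>p\<close> in \<open>R\<close> and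
  \<open>q\<close> in \<open>C\<close> holds only for \<open>p = q = id\<close>. The coefficient 1
  lets the scalar of any multiple of \<open>e\<close> be read off at \<open>id\<close>.\<close>

lemma e_id: "e id = 1"
proof -
  have "e id = (\<Sum>p\<in>symg n. if p = id then 1 else 0)"
    unfolding e_def galg_mult_apply[OF permutes_id] using id_R id_C C_inv R_inter_C
    by (intro sum.cong refl) (auto simp: a_def b_def, metis symg_inv_inv)
  then show ?thesis by (simp add: permutes_id)
qed

text \<open>If two points of a common row of the tableau lie in a common column of its translate by
  \<open>g\<close>, then the transposition swapping them shows that \<open>a g b = - a g b\<close>; otherwise \<open>g\<close> is a
  product of a row and a column permutation.\<close>

lemma a_basis_b: "g permutes {1..n} \<Longrightarrow> \<exists>k. a \<star> (galg_basis g \<star> b) = galg_scale k e"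
proof -
  assume g: "g permutes {1..n}"
  show ?thesis
  proof (cases "col_inj (\<lambda>x. r (g x))")
    case False
    then obtain x y where xy: "x \<in> {1..n}" "y \<in> {1..n}" "c x = c y" "r (g x) = r (g y)" "x \<noteq> y"
      unfolding col_inj_def by blast
    define t where "t = transpose (g x) (g y)"
    define t' where "t' = transpose x y"
    have t: "t \<in> R"
      using xy g permutes_mem[OF g] unfolding R_def t_def
      by (auto simp: permutes_swap_id transpose_def)
    have t': "t' \<in> C"
      using xy unfolding C_def t'_def by (auto simp: permutes_swap_id transpose_def)
    have sg: "sign t' = - 1" using xy by (simp add: t'_def sign_swap_id)
    have comm: "t \<circ> g = g \<circ> t'"
      using g by (auto simp: t_def t'_def fun_eq_iff transpose_def dest: permutes_inj injD)
    have "a \<star> (galg_basis g \<star> b) = (a \<star> galg_basis t) \<star> (galg_basis g \<star> b)"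
      by (simp add: a_mult_basis t)
    also have "\<dots> = a \<star> (galg_basis (t \<circ> g) \<star> b)"
      using t g R_permutes by (simp add: galg_mult_assoc flip: basis_mult_basis)
    also have "\<dots> = a \<star> (galg_basis g \<star> (galg_basis t' \<star> b))"
      using t' g C_permutes by (simp add: comm galg_mult_assoc flip: basis_mult_basis)
    also have "\<dots> = galg_scale (- 1) (a \<star> (galg_basis g \<star> b))"
      unfolding basis_mult_b[OF t'] sg galg_mult_scale_right by simp
    finally have "(a \<star> (galg_basis g \<star> b)) h = - (a \<star> (galg_basis g \<star> b)) h" for h
      by (metis galg_scale_def mult_minus1)
    then have "a \<star> (galg_basis g \<star> b) = galg_scale 0 e"
      by (auto simp: galg_scale_def fun_eq_iff)
    then show ?thesis ..
  next
    case True
    then obtain q where q: "q \<in> C" "\<forall>x\<in>{1..n}. r (g x) = r (q x)"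
      using card_permute_filter[OF g, of "\<lambda>x. r x < _"] by (rule col_inj_same_type)
    note qp = C_permutes[OF q(1)]
    define p where "p = g \<circ> inv q"
    have "r (p x) = r x" if "x \<in> {1..n}" for x
      using q(2) permutes_mem[OF permutes_inv[OF qp] that] by (simp add: p_def permutes_inverses[OF qp])
    then have p: "p \<in> R"
      using g qp by (auto simp: R_def p_def permutes_compose permutes_inv)
    have gpq: "g = p \<circ> q" using qp by (simp add: p_def comp_assoc)
    have "a \<star> (galg_basis g \<star> b) = (a \<star> galg_basis p) \<star> (galg_basis q \<star> b)"
      using p qp R_permutes by (simp add: gpq galg_mult_assoc flip: basis_mult_basis)
    also have "\<dots> = galg_scale (of_int (sign q)) e"
      by (simp add: a_mult_basis p basis_mult_b q(1) galg_mult_scale_right e_def)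
    finally show ?thesis ..
  qed
qed

text \<open>By linearity from \<open>a_basis_b\<close>: all products
  \<open>a \<star> (x \<star> b)\<close> lie on the line through \<open>e\<close>. This is what
  makes \<open>e\<close> a multiple of a primitive idempotent.\<close>

lemma a_mult_b_eq_scale: "a \<star> (x \<star> b) = galg_scale ((a \<star> (x \<star> b)) id) e"
proof -
  obtain k where k: "\<And>h. h permutes {1..n} \<Longrightarrow> a \<star> (galg_basis h \<star> b) = galg_scale (k h) e"
    using a_basis_b by metis
  define K where "K = (\<Sum>h\<in>symg n. x h * k h)"
  have *: "(a \<star> (x \<star> b)) g = K * e g" if g: "g permutes {1..n}" for g
    unfolding galg_mult_expand_middle[OF g, of a x b] K_def sum_distrib_right
    by (intro sum.cong refl) (simp add: k galg_scale_def)
  show ?thesis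
    by (rule galg_eqI[of _ n])
      (simp_all add: e_carrier galg_scale_carrier, simp add: * galg_scale_def e_id permutes_id)
qed

section \<open>The character of the left ideal generated by \<open>e\<close>\<close>

definition kappa where "kappa = (e \<star> e) id"

lemma e_mult_e: "e \<star> e = galg_scale kappa e"
  using a_mult_b_eq_scale[of "b \<star> a"] by (simp add: kappa_def e_def galg_mult_assoc)

definition chi where
  "chi g = trace_on ((\<lambda>x. x \<star> e) ` galg_carrier n) (\<lambda>v. galg_basis g \<star> v)"

lemma kappa_chi:
  "g permutes {1..n} \<Longrightarrow> kappa * chi g = (\<Sum>h\<in>symg n. e (inv h \<circ> (inv g \<circ> h)))"
  unfolding chi_def by (rule trace_on_left_ideal[OF e_mult_e, symmetric])

text \<open>At \<open>g = id\<close> every summand in \<open>kappa_chi\<close> is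
  \<open>e id = 1\<close>, so \<open>kappa\<close> times the dimension of the ideal is
  \<open>fact n\<close>.\<close>

lemma kappa_nonzero: "kappa \<noteq> 0"
proof
  assume "kappa = 0"
  then have "(\<Sum>h\<in>symg n. e (inv h \<circ> (inv id \<circ> h))) = 0"
    using kappa_chi[OF permutes_id] by simp
  moreover have "(\<Sum>h\<in>symg n. e (inv h \<circ> (inv id \<circ> h))) = (\<Sum>h\<in>symg n. 1)"
    by (intro sum.cong refl) (simp add: e_id)
  ultimately show False by (simp add: card_permutations[OF refl])
qed

lemma e_Reals: "e g \<in> \<real>"
proof (cases "g permutes {1..n}")
  case True
  then show ?thesis
    unfolding e_def galg_mult_apply[OF True] by (intro sum_in_Reals Reals_mult) (auto simp: a_def b_def)
next
  case False
  then show ?thesis by (simp add: e_def galg_mult_outside)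
qed

text \<open>Reality turns the final sum of squares of complex numbers into a sum of real squares,
  whose vanishing is conclusive.\<close>

lemma chi_Reals: "g permutes {1..n} \<Longrightarrow> chi g \<in> \<real>"
proof -
  assume g: "g permutes {1..n}"
  have "kappa \<in> \<real>"
    unfolding kappa_def galg_mult_apply[OF permutes_id] by (intro sum_in_Reals Reals_mult e_Reals)
  moreover have "kappa * chi g \<in> \<real>"
    unfolding kappa_chi[OF g] by (intro sum_in_Reals e_Reals)
  ultimately have "kappa * chi g / kappa \<in> \<real>" by (rule Reals_divide[rotated])
  then show ?thesis using kappa_nonzero by simp
qed

lemma chi_conj:
  assumes k: "k permutes {1..n}" and g: "g permutes {1..n}"
  shows "chi (inv k \<circ> (g \<circ> k)) = chi g"
proof -
  have "kappa * chi (inv k \<circ> (g \<circ> k)) = (\<Sum>h\<in>symg n. e (inv (k \<circ> h) \<circ> (inv g \<circ> (k \<circ> h))))"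
    using k g by (subst kappa_chi)
      (auto simp: permutes_compose permutes_inv inv_comp comp_assoc intro!: sum.cong)
  also have "\<dots> = kappa * chi g"
    unfolding kappa_chi[OF g] by (rule setum_permutations_compose_left[OF k, symmetric])
  finally show ?thesis using kappa_nonzero by simp
qed

text \<open>Inverting group elements fixes \<open>a\<close> and \<open>b\<close> and turns
  \<open>a \<star> b\<close> into \<open>b \<star> a\<close>; summing over conjugates does not
  distinguish these two products.\<close>

lemma chi_inv:
  assumes g: "g permutes {1..n}"
  shows "chi (inv g) = chi g"
proof -
  have b_swap: "b (inv p \<circ> (inv h \<circ> (inv g \<circ> h))) = b (inv h \<circ> (g \<circ> (h \<circ> p)))"
    if "h permutes {1..n}" "p permutes {1..n}" for h p
  proof -
    have "inv p \<circ> (inv h \<circ> (inv g \<circ> h)) = inv (inv h \<circ> (g \<circ> (h \<circ> p)))"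
      using that g by (simp add: inv_comp permutes_inv permutes_compose comp_assoc)
    then show ?thesis
      using that g by (simp add: b_inv permutes_inv permutes_compose)
  qed
  have "kappa * chi g = (\<Sum>h\<in>symg n. \<Sum>p\<in>symg n. a p * b (inv h \<circ> (g \<circ> (h \<circ> p))))"
    unfolding kappa_chi[OF g] using g
    by (intro sum.cong refl) (simp add: e_def galg_mult_apply permutes_compose permutes_inv b_swap)
  also have "\<dots> = (\<Sum>h\<in>symg n. \<Sum>p\<in>symg n. a p * b (inv h \<circ> (g \<circ> (h \<circ> inv p))))"
  proof (rule sum.cong[OF refl])
    fix h
    have "(\<Sum>p\<in>symg n. a p * b (inv h \<circ> (g \<circ> (h \<circ> p))))
        = (\<Sum>p\<in>symg n. a (inv p) * b (inv h \<circ> (g \<circ> (h \<circ> inv p))))"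
      by (rule sum_permutations_inverse)
    then show "(\<Sum>p\<in>symg n. a p * b (inv h \<circ> (g \<circ> (h \<circ> p))))
        = (\<Sum>p\<in>symg n. a p * b (inv h \<circ> (g \<circ> (h \<circ> inv p))))"
      by (simp add: a_inv)
  qed
  also have "\<dots> = (\<Sum>p\<in>symg n. \<Sum>h\<in>symg n. a p * b (inv h \<circ> (g \<circ> (h \<circ> inv p))))"
    by (rule sum.swap)
  also have "\<dots> = (\<Sum>p\<in>symg n. \<Sum>h\<in>symg n. a p * b (inv p \<circ> (inv h \<circ> (g \<circ> h))))"
  proof (rule sum.cong[OF refl])
    fix p assume "p \<in> symg n"
    then have p: "p permutes {1..n}" by simp
    have "(\<Sum>h\<in>symg n. a p * b (inv h \<circ> (g \<circ> (h \<circ> inv p))))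
        = (\<Sum>h\<in>symg n. a p * b (inv (h \<circ> p) \<circ> (g \<circ> ((h \<circ> p) \<circ> inv p))))"
      by (rule sum_permutations_compose_right[OF p])
    also have "\<dots> = (\<Sum>h\<in>symg n. a p * b (inv p \<circ> (inv h \<circ> (g \<circ> h))))"
      using p by (intro sum.cong refl) (simp add: inv_comp comp_assoc)
    finally show "(\<Sum>h\<in>symg n. a p * b (inv h \<circ> (g \<circ> (h \<circ> inv p)))) = \<dots>" .
  qed
  also have "\<dots> = (\<Sum>h\<in>symg n. \<Sum>p\<in>symg n. a p * b (inv p \<circ> (inv h \<circ> (g \<circ> h))))"
    by (rule sum.swap)
  also have "\<dots> = kappa * chi (inv g)"
    unfolding kappa_chi[OF permutes_inv[OF g]] using g
    by (intro sum.cong refl) (simp add: e_def galg_mult_apply permutes_compose permutes_inv)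
  finally show ?thesis using kappa_nonzero by simp
qed

text \<open>\<open>kappa * chi\<close> is \<open>e\<close> summed over all conjugations, up to an
  inverse. Against a class function each of the \<open>fact n\<close> conjugates contributes the
  same.\<close>

lemma kappa_sum_chi:
  assumes f: "\<And>g h. g permutes {1..n} \<Longrightarrow> h permutes {1..n} \<Longrightarrow> f (inv h \<circ> (g \<circ> h)) = f g"
  shows "kappa * (\<Sum>g\<in>symg n. chi g * f g) = fact n * (\<Sum>g\<in>symg n. e g * f (inv g))"
proof -
  have "kappa * (\<Sum>g\<in>symg n. chi g * f g)
      = (\<Sum>g\<in>symg n. \<Sum>h\<in>symg n. e (inv h \<circ> (inv g \<circ> h)) * f g)"
    by (simp add: sum_distrib_left sum_distrib_right kappa_chi flip: mult.assoc)
  also have "\<dots> = (\<Sum>h\<in>symg n. \<Sum>g\<in>symg n. e (inv h \<circ> (inv g \<circ> h)) * f g)"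
    by (rule sum.swap)
  also have "\<dots> = (\<Sum>h\<in>symg n. \<Sum>g\<in>symg n. e g * f (inv g))"
  proof (rule sum.cong[OF refl])
    fix h assume "h \<in> symg n"
    then have h: "h permutes {1..n}" by simp
    have "(\<Sum>g\<in>symg n. e (inv h \<circ> (inv g \<circ> h)) * f g)
        = (\<Sum>g\<in>symg n. e (inv h \<circ> (inv (inv g) \<circ> h)) * f (inv g))"
      by (rule sum_permutations_inverse)
    also have "\<dots> = (\<Sum>g\<in>symg n. e (inv h \<circ> (g \<circ> h)) * f (inv (inv h \<circ> (g \<circ> h))))"
    proof (intro sum.cong refl)
      fix g assume "g \<in> symg n"
      then have g: "g permutes {1..n}" by simp
      have "inv (inv h \<circ> (g \<circ> h)) = inv h \<circ> (inv g \<circ> h)"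
        using g h by (simp add: inv_comp permutes_inv permutes_compose comp_assoc)
      then show "e (inv h \<circ> (inv (inv g) \<circ> h)) * f (inv g)
          = e (inv h \<circ> (g \<circ> h)) * f (inv (inv h \<circ> (g \<circ> h)))"
        using f[OF permutes_inv[OF g] h] g by simp
    qed
    also have "\<dots> = (\<Sum>g\<in>symg n. e g * f (inv g))"
      by (rule sum_permutes_conj[OF h])
    finally show "(\<Sum>g\<in>symg n. e (inv h \<circ> (inv g \<circ> h)) * f g) = \<dots>" .
  qed
  also have "\<dots> = fact n * (\<Sum>g\<in>symg n. e g * f (inv g))"
    by (simp add: card_permutations[OF refl])
  finally show ?thesis .
qed

text \<open>Left multiplication by \<open>x\<close> maps the ideal into the line through
  \<open>e\<close>, so its trace is its eigenvalue there; the right side is \<open>kappa\<close>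
  times this eigenvalue.\<close>

lemma rank_one_trace:
  assumes x: "\<And>y. x \<star> (y \<star> e) = galg_scale ((x \<star> (y \<star> e)) id) e"
  shows "kappa * (\<Sum>g\<in>symg n. x g * chi g) = (x \<star> (e \<star> e)) id"
proof -
  have "kappa * (\<Sum>g\<in>symg n. x g * chi g)
      = (\<Sum>g\<in>symg n. \<Sum>h\<in>symg n. x g * e (inv h \<circ> (inv g \<circ> h)))"
    unfolding sum_distrib_left
    by (intro sum.cong refl) (simp add: kappa_chi mult.left_commute[of kappa] sum_distrib_left)
  also have "\<dots> = (\<Sum>h\<in>symg n. \<Sum>g\<in>symg n. x g * e (inv h \<circ> (inv g \<circ> h)))"
    by (rule sum.swap)
  also have "\<dots> = (\<Sum>h\<in>symg n. (x \<star> (galg_basis h \<star> e)) h)"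
    by (intro sum.cong refl)
      (simp add: galg_mult_apply[of _ _ x] galg_basis_mult_apply permutes_compose permutes_inv)
  also have "\<dots> = (\<Sum>h\<in>symg n. e h * (x \<star> (galg_basis h \<star> e)) id)"
    by (intro sum.cong refl, subst x) (simp add: galg_scale_def mult.commute)
  also have "\<dots> = (x \<star> (e \<star> e)) id"
    by (rule galg_mult_expand_middle[OF permutes_id, symmetric])
  finally show ?thesis .
qed

lemma sum_e_chi: "(\<Sum>g\<in>symg n. e g * chi g) = kappa"
proof -
  have "kappa * (\<Sum>g\<in>symg n. e g * chi g) = (e \<star> (e \<star> e)) id"
  proof (rule rank_one_trace)
    show "e \<star> (y \<star> e) = galg_scale ((e \<star> (y \<star> e)) id) e" for y
      using a_mult_b_eq_scale[of "b \<star> (y \<star> a)"] by (simp add: e_def galg_mult_assoc)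
  qed
  also have "\<dots> = kappa * kappa"
    unfolding e_mult_e galg_mult_scale_right by (simp add: galg_scale_def e_id)
  finally show ?thesis using kappa_nonzero by simp
qed

text \<open>Pairing the class function \<open>chi\<close> with itself reduces to pairing it with
  \<open>e\<close>, whose trace on the ideal is \<open>kappa\<close>.\<close>

lemma sum_chi_chi: "(\<Sum>g\<in>symg n. chi g * chi g) = fact n"
proof -
  have "(\<Sum>g\<in>symg n. e g * chi (inv g)) = kappa"
    unfolding sum_e_chi[symmetric] by (intro sum.cong refl) (simp add: chi_inv)
  then show ?thesis
    using kappa_sum_chi[of chi] kappa_nonzero chi_conj by simp
qed

text \<open>In terms of multiplicities: the restriction of \<open>chi\<close> to \<open>R\<close>
  contains the trivial character exactly once.\<close>

lemma sum_a_chi: "(\<Sum>g\<in>symg n. a g * chi g) = of_nat (card R)"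
proof -
  have "kappa * (\<Sum>g\<in>symg n. a g * chi g) = (a \<star> (e \<star> e)) id"
  proof (rule rank_one_trace)
    show "a \<star> (y \<star> e) = galg_scale ((a \<star> (y \<star> e)) id) e" for y
      using a_mult_b_eq_scale[of "y \<star> a"] by (simp add: e_def galg_mult_assoc)
  qed
  also have "a \<star> e = galg_scale (of_nat (card R)) e"
    by (simp add: e_def a_mult_a galg_mult_scale_left flip: galg_mult_assoc)
  then have "(a \<star> (e \<star> e)) id = kappa * of_nat (card R)"
    unfolding e_mult_e galg_mult_scale_right by (simp add: galg_scale_def e_id)
  finally show ?thesis using kappa_nonzero by simp
qed

end

section \<open>Permutation characters on colourings\<close>

text \<open>Class sizes are integers because a vector \<open>v + w\<close> may have negative
  entries; then there are no colourings. Values outside \<open>A\<close> are fixed, so that equality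
  means equality on \<open>A\<close>.\<close>

definition colourings :: "'a set \<Rightarrow> nat \<Rightarrow> (nat \<Rightarrow> int) \<Rightarrow> ('a \<Rightarrow> nat) set" where
  "colourings A K \<alpha> =
    {f \<in> A \<rightarrow>\<^sub>E {..<K}. \<forall>i<K. int (card {x \<in> A. f x = i}) = \<alpha> i}"

definition fixes_col :: "'a set \<Rightarrow> ('a \<Rightarrow> 'a) \<Rightarrow> ('a \<Rightarrow> 'b) \<Rightarrow> bool" where
  "fixes_col A g f \<longleftrightarrow> (\<forall>x\<in>A. f (g x) = f x)"

definition psi :: "'a set \<Rightarrow> nat \<Rightarrow> (nat \<Rightarrow> int) \<Rightarrow> ('a \<Rightarrow> 'a) \<Rightarrow> int" where
  "psi A K \<alpha> g = (\<Sum>f\<in>colourings A K \<alpha>. of_bool (fixes_col A g f))"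

lemma finite_colourings [simp]: "finite A \<Longrightarrow> finite (colourings A K \<alpha>)"
  unfolding colourings_def by (rule finite_subset[of _ "A \<rightarrow>\<^sub>E {..<K}"]) (auto intro!: finite_PiE)

lemma colourings_compose:
  assumes "h permutes A" "f \<in> colourings A K \<alpha>"
  shows "f \<circ> h \<in> colourings A K \<alpha>"
proof -
  have "f \<circ> h \<in> A \<rightarrow>\<^sub>E {..<K}"
    using assms by (auto simp: colourings_def PiE_iff extensional_def permutes_in_image permutes_not_in)
  moreover have "card {x \<in> A. f (h x) = i} = card {x \<in> A. f x = i}" for i
    by (rule card_permute_filter[OF assms(1)])
  ultimately show ?thesis using assms(2) by (simp add: colourings_def)
qed

lemma bij_betw_colourings:
  assumes h: "h permutes A"
  shows "bij_betw (\<lambda>f. f \<circ> h) (colourings A K \<alpha>) (colourings A K \<alpha>)"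
  by (rule bij_betw_byWitness[of _ "\<lambda>f. f \<circ> inv h"])
    (use h in \<open>auto simp: colourings_compose permutes_inv comp_assoc\<close>)

lemma fixes_col_conj:
  assumes "h permutes A" "g permutes A"
  shows "fixes_col A (inv h \<circ> (g \<circ> h)) (f \<circ> h) \<longleftrightarrow> fixes_col A g f"
proof -
  have "(\<forall>x\<in>A. f (g (h x)) = f (h x)) \<longleftrightarrow> (\<forall>x\<in>h ` A. f (g x) = f x)" by simp
  then show ?thesis
    using assms by (simp add: fixes_col_def permutes_inverses permutes_image)
qed

lemma psi_conj:
  assumes "h permutes A" "g permutes A"
  shows "psi A K \<alpha> (inv h \<circ> (g \<circ> h)) = psi A K \<alpha> g"
proof -
  have "psi A K \<alpha> (inv h \<circ> (g \<circ> h))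
      = (\<Sum>f\<in>colourings A K \<alpha>. of_bool (fixes_col A (inv h \<circ> (g \<circ> h)) (f \<circ> h)))"
    unfolding psi_def
    by (rule sum.reindex_bij_betw[OF bij_betw_colourings[OF assms(1)], symmetric])
  then show ?thesis
    using assms by (simp add: fixes_col_conj psi_def)
qed

lemma fixes_col_inv:
  assumes g: "g permutes A"
  shows "fixes_col A (inv g) f = fixes_col A g f"
proof -
  have "fixes_col A (inv h) f" if h: "h permutes A" and f: "fixes_col A h f" for h
    unfolding fixes_col_def
  proof
    fix x assume "x \<in> A"
    then have "inv h x \<in> A" using h by (simp add: permutes_in_image permutes_inv)
    then have "f (h (inv h x)) = f (inv h x)" using f by (simp add: fixes_col_def)
    then show "f (inv h x) = f x" using h by (simp add: permutes_inverses)
  qed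
  from this[of g] this[of "inv g"] show ?thesis
    using g by (auto simp: permutes_inv)
qed

lemma psi_inv: "g permutes A \<Longrightarrow> psi A K \<alpha> (inv g) = psi A K \<alpha> g"
  by (simp add: psi_def fixes_col_inv)

text \<open>For \<open>F0\<close> with values in \<open>B\<close>, the orbit of \<open>F0\<close>
  under permutations of its arguments, with values outside \<open>A\<close> normalised.\<close>

definition same_type :: "'a set \<Rightarrow> ('a \<Rightarrow> 'b) \<Rightarrow> 'b set \<Rightarrow> ('a \<Rightarrow> 'b) set" where
  "same_type A F0 B = {F \<in> A \<rightarrow>\<^sub>E B. \<forall>y. card {x \<in> A. F x = y} = card {x \<in> A. F0 x = y}}"

text \<open>Orbit and stabiliser: the permutations carrying \<open>F0\<close> to a given
  \<open>F\<close> form a coset of the stabiliser of \<open>F0\<close>.\<close>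

lemma sum_orbit:
  fixes H :: "('a \<Rightarrow> 'b) \<Rightarrow> 'c :: comm_semiring_1"
  assumes A: "finite A" and F0: "F0 \<in> A \<rightarrow> B" and B: "finite B"
  shows "(\<Sum>h | h permutes A. H (restrict (F0 \<circ> h) A))
    = of_nat (card {h. h permutes A \<and> fixes_col A h F0}) * (\<Sum>F\<in>same_type A F0 B. H F)"
proof -
  let ?m = "\<lambda>h. restrict (F0 \<circ> h) A"
  let ?G = "{h. h permutes A}"
  have fin: "finite (same_type A F0 B)"
    unfolding same_type_def by (rule finite_subset[of _ "A \<rightarrow>\<^sub>E B"]) (use A B in \<open>auto intro!: finite_PiE\<close>)
  have sub: "?m ` ?G \<subseteq> same_type A F0 B"
  proof
    fix F assume "F \<in> ?m ` ?G"
    then obtain h where h: "h permutes A" and F: "F = ?m h" by auto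
    have "card {x \<in> A. F x = y} = card {x \<in> A. F0 x = y}" for y
      using card_permute_filter[OF h, of "\<lambda>x. F0 x = y"] by (simp add: F cong: conj_cong)
    moreover have "F \<in> A \<rightarrow>\<^sub>E B"
      using h F0 by (auto simp: F permutes_in_image)
    ultimately show "F \<in> same_type A F0 B" by (simp add: same_type_def)
  qed
  have fibre: "card {h \<in> ?G. ?m h = F} = card {h. h permutes A \<and> fixes_col A h F0}"
    if F: "F \<in> same_type A F0 B" for F
  proof -
    obtain k where k: "k permutes A" "\<forall>x\<in>A. F x = F0 (k x)"
      using count_eq_imp_permutes[OF A, of F F0] F by (auto simp: same_type_def)
    have FE: "F \<in> extensional A" using F by (auto simp: same_type_def PiE_def)
    have eqF: "?m h = F \<longleftrightarrow> (\<forall>x\<in>A. F0 (h x) = F0 (k x))" for h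
      using k FE by (auto simp: fun_eq_iff extensional_def restrict_def)
    have "bij_betw (\<lambda>h. h \<circ> k) {h. h permutes A \<and> fixes_col A h F0} {h \<in> ?G. ?m h = F}"
    proof (rule bij_betw_byWitness[of _ "\<lambda>h. h \<circ> inv k"])
      show "(\<lambda>h. h \<circ> k) ` {h. h permutes A \<and> fixes_col A h F0} \<subseteq> {h \<in> ?G. ?m h = F}"
        unfolding eqF using k(1) by (auto simp: permutes_compose fixes_col_def permutes_in_image)
      show "(\<lambda>h. h \<circ> inv k) ` {h \<in> ?G. ?m h = F} \<subseteq> {h. h permutes A \<and> fixes_col A h F0}"
      proof
        fix h' assume "h' \<in> (\<lambda>h. h \<circ> inv k) ` {h \<in> ?G. ?m h = F}"
        then obtain h where h: "h permutes A" "?m h = F" and h': "h' = h \<circ> inv k" by blast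
        then have e: "\<forall>x\<in>A. F0 (h x) = F0 (k x)" by (simp only: eqF)
        have "F0 (h (inv k x)) = F0 x" if "x \<in> A" for x
        proof -
          have "inv k x \<in> A" using that k(1) by (simp add: permutes_in_image permutes_inv)
          then have "F0 (h (inv k x)) = F0 (k (inv k x))" using e by blast
          then show ?thesis using k(1) by (simp add: permutes_inverses)
        qed
        then show "h' \<in> {h. h permutes A \<and> fixes_col A h F0}"
          using h(1) k(1) by (simp add: h' fixes_col_def permutes_compose permutes_inv)
      qed
    qed (use k(1) in \<open>auto simp: comp_assoc\<close>)
    then show ?thesis by (rule bij_betw_same_card[symmetric])
  qed
  have "(\<Sum>h\<in>?G. H (?m h)) = (\<Sum>F\<in>same_type A F0 B. \<Sum>h | h \<in> ?G \<and> ?m h = F. H (?m h))"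
    by (rule sum.group[symmetric]) (use A fin sub in auto)
  also have "\<dots> = (\<Sum>F\<in>same_type A F0 B. of_nat (card {h \<in> ?G. ?m h = F}) * H F)"
    by (intro sum.cong refl) simp
  also have "\<dots> = of_nat (card {h. h permutes A \<and> fixes_col A h F0}) * (\<Sum>F\<in>same_type A F0 B. H F)"
    unfolding sum_distrib_left by (intro sum.cong refl) (simp only: fibre)
  finally show ?thesis .
qed

lemma sum_permutes_of_bool:
  "finite A \<Longrightarrow> (\<Sum>g | g permutes A. of_bool (P g)) = (of_nat (card {g. g permutes A \<and> P g}) :: 'c :: semiring_1)"
  by (simp add: sum_of_bool_eq Collect_conj_eq)

text \<open>Burnside's lemma for one orbit: the stabilisers of its points are conjugate, hence of
  equal order, and this order times the length of the orbit is the order of the group.\<close>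

lemma burnside_same_type:
  assumes A: "finite A" and F0: "F0 \<in> A \<rightarrow> B" and B: "finite B"
  shows "(\<Sum>g | g permutes A. \<Sum>F\<in>same_type A F0 B. of_bool (fixes_col A g F)) = (fact (card A) :: int)"
proof -
  let ?S = "int (card {h. h permutes A \<and> fixes_col A h F0})"
  let ?H = "\<lambda>F. \<Sum>g | g permutes A. (of_bool (fixes_col A g F) :: int)"
  have "?S * (\<Sum>F\<in>same_type A F0 B. ?H F) = (\<Sum>h | h permutes A. ?H (restrict (F0 \<circ> h) A))"
    by (rule sum_orbit[OF assms, symmetric])
  also have "\<dots> = (\<Sum>h | h permutes A. ?S)"
  proof (rule sum.cong[OF refl])
    fix h assume "h \<in> {h. h permutes A}"
    then have h: "h permutes A" by simp
    have "?H (restrict (F0 \<circ> h) A) = (\<Sum>g | g permutes A. of_bool (fixes_col A g (F0 \<circ> h)))"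
      by (intro sum.cong refl) (auto simp: fixes_col_def permutes_in_image)
    also have "\<dots> = (\<Sum>g | g permutes A. of_bool (fixes_col A (inv h \<circ> (g \<circ> h)) (F0 \<circ> h)))"
      by (rule sum_permutes_conj[OF h, symmetric])
    also have "\<dots> = ?S"
      using h A by (simp add: fixes_col_conj sum_permutes_of_bool del: sum_of_bool_eq)
    finally show "?H (restrict (F0 \<circ> h) A) = ?S" .
  qed
  finally have "?S * (\<Sum>F\<in>same_type A F0 B. ?H F) = ?S * fact (card A)"
    using A by (simp add: card_permutations[OF refl])
  moreover have "id \<in> {h. h permutes A \<and> fixes_col A h F0}"
    by (simp add: permutes_id fixes_col_def)
  then have "?S \<noteq> 0"
    using A by (metis (no_types, lifting) card_0_eq empty_iff finite_permutes finite_subset mem_Collect_eq of_nat_eq_0_iff subsetI)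
  ultimately show ?thesis by (subst sum.swap) simp
qed

section \<open>Multiplicities of \<open>chi\<close> in the permutation characters\<close>

context filling
begin

lemma R_eq: "R = {p. p permutes {1..n} \<and> fixes_col {1..n} p r}"
  by (simp add: R_def fixes_col_def)

text \<open>Frobenius reciprocity: the colourings of this type form the orbit of \<open>r\<close>,
  whose stabiliser is \<open>R\<close>, so \<open>psi\<close> is induced from the trivial character
  of \<open>R\<close>, which \<open>chi\<close> contains once.\<close>

lemma sum_chi_psi_rows:
  assumes K: "\<And>x. x \<in> {1..n} \<Longrightarrow> r x < K"
    and \<alpha>: "\<And>i. i < K \<Longrightarrow> \<alpha> i = int (card {x \<in> {1..n}. r x = i})"
  shows "(\<Sum>g\<in>symg n. chi g * of_int (psi {1..n} K \<alpha> g)) = fact n"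
proof -
  let ?A = "{1..n}"
  have st: "same_type ?A r {..<K} = colourings ?A K \<alpha>"
  proof -
    have "card {x \<in> ?A. F x = i} = card {x \<in> ?A. r x = i}" if "F \<in> ?A \<rightarrow>\<^sub>E {..<K}" "\<not> i < K" for F i
    proof -
      have "{x \<in> ?A. F x = i} = {}" "{x \<in> ?A. r x = i} = {}" using that K by fastforce+
      then show ?thesis by (simp only:)
    qed
    then have "(\<forall>i. card {x \<in> ?A. F x = i} = card {x \<in> ?A. r x = i})
        \<longleftrightarrow> (\<forall>i<K. int (card {x \<in> ?A. F x = i}) = \<alpha> i)" if "F \<in> ?A \<rightarrow>\<^sub>E {..<K}" for F
      using that by (auto simp: \<alpha>)
    then show ?thesis
      unfolding same_type_def colourings_def by blast
  qed
  have psi: "of_nat (card R) * of_int (psi ?A K \<alpha> g) = (\<Sum>h\<in>symg n. a (h \<circ> (g \<circ> inv h)))"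
    if g: "g permutes ?A" for g
  proof -
    have "of_nat (card R) * of_int (psi ?A K \<alpha> g)
        = (\<Sum>h\<in>symg n. of_bool (fixes_col ?A g (restrict (r \<circ> h) ?A)) :: complex)"
      unfolding R_eq psi_def of_int_sum of_int_of_bool st[symmetric]
      by (rule sum_orbit[symmetric]) (use K in auto)
    also have "\<dots> = (\<Sum>h\<in>symg n. a (h \<circ> (g \<circ> inv h)))"
    proof (rule sum.cong[OF refl])
      fix h assume "h \<in> symg n"
      then have h: "h permutes ?A" by simp
      have p: "h \<circ> (g \<circ> inv h) permutes ?A"
        using g h by (intro permutes_compose permutes_inv)
      have "fixes_col ?A g (restrict (r \<circ> h) ?A) \<longleftrightarrow> fixes_col ?A g (r \<circ> h)"
        using permutes_in_image[OF g] by (auto simp: fixes_col_def)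
      also have "\<dots> \<longleftrightarrow> fixes_col ?A (inv h \<circ> ((h \<circ> (g \<circ> inv h)) \<circ> h)) (r \<circ> h)"
        using h by (simp add: comp_assoc)
      also have "\<dots> \<longleftrightarrow> h \<circ> (g \<circ> inv h) \<in> R"
        unfolding fixes_col_conj[OF h p] using p by (simp add: R_eq)
      finally show "of_bool (fixes_col ?A g (restrict (r \<circ> h) ?A)) = a (h \<circ> (g \<circ> inv h))"
        by (simp add: a_def)
    qed
    finally show ?thesis .
  qed
  have "of_nat (card R) * (\<Sum>g\<in>symg n. chi g * of_int (psi ?A K \<alpha> g))
      = (\<Sum>g\<in>symg n. \<Sum>h\<in>symg n. a (h \<circ> (g \<circ> inv h)) * chi g)"
    unfolding sum_distrib_left sum_distrib_right[symmetric]
    by (intro sum.cong refl) (simp add: psi[symmetric])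
  also have "\<dots> = (\<Sum>h\<in>symg n. \<Sum>g\<in>symg n. a (h \<circ> (g \<circ> inv h)) * chi g)"
    by (rule sum.swap)
  also have "\<dots> = (\<Sum>h\<in>symg n. \<Sum>g\<in>symg n. a g * chi g)"
  proof (rule sum.cong[OF refl])
    fix h assume "h \<in> symg n"
    then have h: "h permutes ?A" by simp
    have "(\<Sum>g\<in>symg n. a (h \<circ> (g \<circ> inv h)) * chi g)
        = (\<Sum>g\<in>symg n. a (inv (inv h) \<circ> (g \<circ> inv h)) * chi (inv (inv h) \<circ> (g \<circ> inv h)))"
      by (intro sum.cong refl) (use chi_conj[OF permutes_inv[OF h]] h in simp)
    also have "\<dots> = (\<Sum>g\<in>symg n. a g * chi g)"
      by (rule sum_permutes_conj[OF permutes_inv[OF h]])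
    finally show "(\<Sum>g\<in>symg n. a (h \<circ> (g \<circ> inv h)) * chi g) = \<dots>" .
  qed
  also have "\<dots> = of_nat (card R) * fact n"
    by (simp add: sum_a_chi card_permutations[OF refl])
  finally show ?thesis
    using id_R finite_R by auto
qed

text \<open>Composing \<open>q\<close> with the transposition of two equally coloured entries of one
  column preserves the condition on \<open>q\<close> and reverses the sign.\<close>

lemma sum_b_fixes_col:
  assumes "\<not> col_inj f"
  shows "(\<Sum>q\<in>symg n. b q * of_bool (\<forall>x\<in>{1..n}. f (q x) = f' x)) = 0"
proof -
  let ?I = "\<lambda>q. of_bool (\<forall>x\<in>{1..n}. f (q x) = f' x) :: complex"
  obtain x y where xy: "x \<in> {1..n}" "y \<in> {1..n}" "c x = c y" "f x = f y" "x \<noteq> y"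
    using assms unfolding col_inj_def by blast
  define t where "t = transpose x y"
  have t: "t \<in> C"
    using xy unfolding C_def t_def by (auto simp: permutes_swap_id transpose_def)
  have ft: "f (t z) = f z" for z using xy by (simp add: t_def transpose_def)
  have "b (t \<circ> q) = - b q" if "q permutes {1..n}" for q
    using that t xy by (simp add: b_def C_comp_iff sign_mult_permutes C_permutes)
      (simp add: t_def sign_swap_id)
  then have "(\<Sum>q\<in>symg n. b (t \<circ> q) * ?I (t \<circ> q)) = - (\<Sum>q\<in>symg n. b q * ?I q)"
    unfolding sum_negf[symmetric] by (intro sum.cong refl) (simp add: ft)
  moreover have "(\<Sum>q\<in>symg n. b q * ?I q) = (\<Sum>q\<in>symg n. b (t \<circ> q) * ?I (t \<circ> q))"
    by (rule setum_permutations_compose_left[OF C_permutes[OF t]])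
  ultimately show ?thesis by simp
qed

text \<open>More points carry colours below \<open>t\<close> than the first \<open>t\<close> rows
  have cells. So \<open>f \<circ> p\<close> repeats a colour in some column for every
  \<open>p\<close>, and the signed sum over the column group kills it.\<close>

lemma sum_chi_psi_undominated:
  assumes t: "t \<le> K" "(\<Sum>i<t. \<alpha> i) > int (card {x \<in> {1..n}. r x < t})"
  shows "(\<Sum>g\<in>symg n. chi g * of_int (psi {1..n} K \<alpha> g)) = 0"
proof -
  let ?A = "{1..n}"
  have "(\<Sum>g\<in>symg n. e g * of_int (psi ?A K \<alpha> (inv g)))
      = (\<Sum>g\<in>symg n. \<Sum>p\<in>symg n. a p * b (inv p \<circ> g) * of_int (psi ?A K \<alpha> g))"
    by (intro sum.cong refl) (simp add: e_def galg_mult_apply psi_inv sum_distrib_right)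
  also have "\<dots> = (\<Sum>p\<in>symg n. \<Sum>g\<in>symg n. a p * b (inv p \<circ> g) * of_int (psi ?A K \<alpha> g))"
    by (rule sum.swap)
  also have "\<dots> = (\<Sum>p\<in>symg n. 0)"
  proof (rule sum.cong[OF refl])
    fix p assume "p \<in> symg n"
    then have p: "p permutes ?A" by simp
    have "(\<Sum>g\<in>symg n. a p * b (inv p \<circ> g) * of_int (psi ?A K \<alpha> g))
        = (\<Sum>q\<in>symg n. a p * b (inv p \<circ> (p \<circ> q)) * of_int (psi ?A K \<alpha> (p \<circ> q)))"
      by (rule setum_permutations_compose_left[OF p])
    also have "\<dots> = a p * (\<Sum>q\<in>symg n. \<Sum>f\<in>colourings ?A K \<alpha>. b q * of_bool (\<forall>x\<in>?A. (f \<circ> p) (q x) = f x))"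
      using p unfolding psi_def fixes_col_def of_int_sum
      by (simp add: mult.assoc flip: sum_distrib_left del: sum_of_bool_eq)
    also have "\<dots> = a p * (\<Sum>f\<in>colourings ?A K \<alpha>. \<Sum>q\<in>symg n. b q * of_bool (\<forall>x\<in>?A. (f \<circ> p) (q x) = f x))"
      by (simp only: sum.swap[of _ "symg n"])
    also have "\<dots> = a p * (\<Sum>f\<in>colourings ?A K \<alpha>. 0)"
    proof (intro arg_cong2[of _ _ _ _ "(*)"] refl sum.cong sum_b_fixes_col notI)
      fix f assume f: "f \<in> colourings ?A K \<alpha>" and ci: "col_inj (f \<circ> p)"
      have "int (card {x \<in> ?A. f x < t}) = (\<Sum>i<t. \<alpha> i)"
      proof -
        have "card {x \<in> ?A. f x < t} = card (\<Union>i<t. {x \<in> ?A. f x = i})"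
          by (intro arg_cong[of _ _ card]) auto
        also have "\<dots> = (\<Sum>i<t. card {x \<in> ?A. f x = i})"
          by (rule card_UN_disjoint) auto
        finally show ?thesis using f t(1) by (simp add: colourings_def)
      qed
      moreover have "card {x \<in> ?A. f (p x) < t} \<le> card {x \<in> ?A. r x < t}"
        using col_inj_dominance[OF ci] by simp
      ultimately show False
        using t(2) card_permute_filter[OF p, of "\<lambda>x. f x < t"] by simp
    qed
    finally show "(\<Sum>g\<in>symg n. a p * b (inv p \<circ> g) * of_int (psi ?A K \<alpha> g)) = 0" by simp
  qed
  finally have "(\<Sum>g\<in>symg n. e g * of_int (psi ?A K \<alpha> (inv g))) = 0" by simp
  moreover have "kappa * (\<Sum>g\<in>symg n. chi g * of_int (psi ?A K \<alpha> g))
      = fact n * (\<Sum>g\<in>symg n. e g * of_int (psi ?A K \<alpha> (inv g)))"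
    by (rule kappa_sum_chi) (simp add: psi_conj)
  ultimately show ?thesis using kappa_nonzero by simp
qed

end

section \<open>Alternating sums over shifts by permutations\<close>

definition altsum :: "nat \<Rightarrow> ((nat \<Rightarrow> int) \<Rightarrow> int) \<Rightarrow> (nat \<Rightarrow> int) \<Rightarrow> int" where
  "altsum K N v = (\<Sum>w | w permutes {..<K}. sign w * N (\<lambda>i. v i + int (w i)))"

definition symmetric_fun :: "nat \<Rightarrow> ((nat \<Rightarrow> int) \<Rightarrow> 'c) \<Rightarrow> bool" where
  "symmetric_fun K N \<longleftrightarrow> (\<forall>u \<tau>. \<tau> permutes {..<K} \<longrightarrow> N (u \<circ> \<tau>) = N u)"

text \<open>Reindexing \<open>w\<close> as \<open>w \<circ> \<tau>\<close> permutes the whole vector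
  \<open>v i + w i\<close>, which \<open>N\<close> does not see; only the sign remains.\<close>

lemma altsum_permute:
  assumes N: "symmetric_fun K N" and \<tau>: "\<tau> permutes {..<K}"
  shows "altsum K N (v \<circ> \<tau>) = sign \<tau> * altsum K N v"
proof -
  have perm: "permutation p" if "p permutes {..<K}" for p
    using that permutes_imp_permutation by blast
  have "altsum K N (v \<circ> \<tau>)
      = (\<Sum>w | w permutes {..<K}. sign (w \<circ> \<tau>) * N (\<lambda>i. (v \<circ> \<tau>) i + int ((w \<circ> \<tau>) i)))"
    unfolding altsum_def by (rule sum_permutations_compose_right[OF \<tau>])
  also have "\<dots> = (\<Sum>w | w permutes {..<K}. sign \<tau> * (sign w * N (\<lambda>i. v i + int (w i))))"
  proof (rule sum.cong[OF refl])
    fix w assume "w \<in> {w. w permutes {..<K}}"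
    then have "sign (w \<circ> \<tau>) = sign w * sign \<tau>"
      using \<tau> perm by (simp add: sign_compose)
    moreover have "N ((\<lambda>i. v i + int (w i)) \<circ> \<tau>) = N (\<lambda>i. v i + int (w i))"
      using N \<tau> unfolding symmetric_fun_def by blast
    ultimately show "sign (w \<circ> \<tau>) * N (\<lambda>i. (v \<circ> \<tau>) i + int ((w \<circ> \<tau>) i))
        = sign \<tau> * (sign w * N (\<lambda>i. v i + int (w i)))"
      by (simp add: comp_def)
  qed
  finally show ?thesis by (simp add: altsum_def sum_distrib_left)
qed

lemma altsum_transpose:
  assumes "symmetric_fun K N" "i < K" "j < K" "i \<noteq> j"
  shows "altsum K N (v \<circ> transpose i j) = - altsum K N v"
  using assms altsum_permute[of K N "transpose i j" v]
  by (simp add: permutes_swap_id sign_swap_id)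

lemma altsum_eq_entries:
  assumes "symmetric_fun K N" "i < K" "j < K" "i \<noteq> j" "v i = v j"
  shows "altsum K N v = 0"
proof -
  have "v \<circ> transpose i j = v" using assms(5) by (auto simp: fun_eq_iff transpose_def)
  then show ?thesis using altsum_transpose[OF assms(1-4), of v] by simp
qed

text \<open>A permutation of \<open>{..<K}\<close> raises an entry by at most \<open>K - 1\<close>,
  so entry \<open>i\<close> stays negative in every term.\<close>

lemma altsum_negative_entry:
  assumes N: "\<And>u. u i < 0 \<Longrightarrow> N u = 0" and i: "i < K" "v i \<le> - int K"
  shows "altsum K N v = 0"
  unfolding altsum_def
proof (rule sum.neutral, rule ballI)
  fix w assume "w \<in> {w. w permutes {..<K}}"
  then have "w i < K" using i(1) permutes_in_image[of w "{..<K}" i] by simp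
  then show "sign w * N (\<lambda>i. v i + int (w i)) = 0" using i(2) by (simp add: N)
qed

lemma altsum_cong:
  assumes "\<And>u u'. (\<And>i. i < K \<Longrightarrow> u i = u' i) \<Longrightarrow> N u = N u'" "\<And>i. i < K \<Longrightarrow> v i = v' i"
  shows "altsum K N v = altsum K N v'"
  unfolding altsum_def by (intro sum.cong refl arg_cong2[of _ _ _ _ "(*)"] assms(1)) (simp add: assms(2))

text \<open>Take the partial sum through the first moved point, which can only move up since all
  smaller values are taken. This failure of dominance singles out the identity in both inner
  products with \<open>\<Phi>\<close>.\<close>

lemma permutes_exceeds:
  assumes u: "u permutes {..<K}" "u \<noteq> id"
  shows "\<exists>t\<le>K. (\<Sum>j<t. int j) < (\<Sum>j<t. int (u j))"
proof -
  have "\<exists>m. u m \<noteq> m" using u(2) by auto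
  define m where "m = (LEAST m. u m \<noteq> m)"
  have m: "u m \<noteq> m"
    unfolding m_def using \<open>\<exists>m. u m \<noteq> m\<close> by (rule LeastI_ex)
  have below: "u j = j" if "j < m" for j
    using not_less_Least[of j "\<lambda>m. u m \<noteq> m"] that unfolding m_def by blast
  have "\<not> u m < m"
  proof
    assume "u m < m"
    then have "u (u m) = u m" by (rule below)
    then show False using m injD[OF permutes_inj[OF u(1)]] by blast
  qed
  then have "m < u m" using m by simp
  moreover have "m < K"
  proof (rule ccontr)
    assume "\<not> m < K"
    then show False using m permutes_not_in[OF u(1), of m] by simp
  qed
  moreover have "(\<Sum>j<m. int (u j)) = (\<Sum>j<m. int j)"
    by (intro sum.cong refl) (simp add: below)
  ultimately show ?thesis by (intro exI[of _ "Suc m"]) simp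
qed

section \<open>Nonnegative matrices with prescribed margins\<close>

definition comps :: "nat \<Rightarrow> int \<Rightarrow> (nat \<Rightarrow> nat) set" where
  "comps K s = {\<kappa>. (\<forall>i\<ge>K. \<kappa> i = 0) \<and> (\<Sum>i<K. int (\<kappa> i)) = s}"

text \<open>\<open>m\<close> is separate from \<open>K\<close> so that rows can be split off one at
  a time while all \<open>K\<close> column sums stay; entries outside the range are 0, so that each
  matrix is one function.\<close>

definition mats :: "nat \<Rightarrow> nat \<Rightarrow> (nat \<Rightarrow> int) \<Rightarrow> (nat \<Rightarrow> int) \<Rightarrow> (nat \<Rightarrow> nat \<Rightarrow> nat) set" where
  "mats K m \<alpha> u = {M. (\<forall>j<m. M j \<in> comps K (\<alpha> j)) \<and> (\<forall>j\<ge>m. M j = (\<lambda>_. 0))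
     \<and> (\<forall>i<K. (\<Sum>j<m. int (M j i)) = u i)}"

lemma finite_comps [simp]: "finite (comps K s)"
proof (rule finite_subset)
  show "comps K s \<subseteq> {f. \<forall>x. (x \<in> {..<K} \<longrightarrow> f x \<in> {..nat s}) \<and> (x \<notin> {..<K} \<longrightarrow> f x = 0)}"
  proof (intro subsetI CollectI allI conjI impI)
    fix f i assume f: "f \<in> comps K s" and i: "i \<in> {..<K}"
    have "int (f i) \<le> (\<Sum>i<K. int (f i))" using i by (intro member_le_sum) auto
    then show "f i \<in> {..nat s}" using f by (simp add: comps_def)
  next
    fix f i assume "f \<in> comps K s" "i \<notin> {..<K}"
    then show "f i = 0" by (simp add: comps_def)
  qed
qed (rule finite_set_of_finite_funs; simp)

lemma finite_mats [simp]: "finite (mats K m \<alpha> u)"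
proof (rule finite_subset)
  show "mats K m \<alpha> u \<subseteq> {M. \<forall>j. (j \<in> {..<m} \<longrightarrow> M j \<in> (\<Union>j<m. comps K (\<alpha> j)))
      \<and> (j \<notin> {..<m} \<longrightarrow> M j = (\<lambda>_. 0))}"
    by (auto simp: mats_def)
qed (rule finite_set_of_finite_funs; simp)

lemma mats_0: "mats K 0 \<alpha> u = (if \<forall>i<K. u i = 0 then {\<lambda>_ _. 0} else {})"
  by (auto simp: mats_def)

lemma card_mats_Suc:
  "card (mats K (Suc m) \<alpha> u)
    = (\<Sum>\<kappa>\<in>comps K (\<alpha> m). card (mats K m \<alpha> (\<lambda>i. u i - int (\<kappa> i))))"
proof -
  have fibre: "card {M \<in> mats K (Suc m) \<alpha> u. M m = \<kappa>} = card (mats K m \<alpha> (\<lambda>i. u i - int (\<kappa> i)))"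
    if "\<kappa> \<in> comps K (\<alpha> m)" for \<kappa>
  proof (rule bij_betw_same_card)
    show "bij_betw (\<lambda>M. M(m := \<lambda>_. 0)) {M \<in> mats K (Suc m) \<alpha> u. M m = \<kappa>}
        (mats K m \<alpha> (\<lambda>i. u i - int (\<kappa> i)))"
      by (rule bij_betw_byWitness[of _ "\<lambda>M. M(m := \<kappa>)"])
        (use that in \<open>auto simp: mats_def fun_eq_iff less_Suc_eq\<close>)
  qed
  have "(\<Sum>\<kappa>\<in>comps K (\<alpha> m). sum (\<lambda>_. 1::nat) {M \<in> mats K (Suc m) \<alpha> u. M m = \<kappa>})
      = sum (\<lambda>_. 1) (mats K (Suc m) \<alpha> u)"
  proof (rule sum.group)
    show "(\<lambda>M. M m) ` mats K (Suc m) \<alpha> u \<subseteq> comps K (\<alpha> m)" by (auto simp: mats_def)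
  qed simp_all
  then show ?thesis by (simp add: fibre)
qed

lemma comps_permute:
  assumes "\<tau> permutes {..<K}" "\<kappa> \<in> comps K s"
  shows "\<kappa> \<circ> \<tau> \<in> comps K s"
proof -
  have "(\<Sum>i<K. int (\<kappa> (\<tau> i))) = (\<Sum>i<K. int (\<kappa> i))"
    by (rule sum.permute[OF assms(1), symmetric, unfolded comp_def])
  then show ?thesis
    using assms permutes_not_in[OF assms(1)] by (auto simp: comps_def)
qed

lemma mats_permute:
  assumes \<tau>: "\<tau> permutes {..<K}" and M: "M \<in> mats K m \<alpha> u"
  shows "(\<lambda>j. M j \<circ> \<tau>) \<in> mats K m \<alpha> (u \<circ> \<tau>)"
  using M comps_permute[OF \<tau>] permutes_in_image[OF \<tau>] by (auto simp: mats_def fun_eq_iff)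

lemma symmetric_card_mats: "symmetric_fun K (\<lambda>u. int (card (mats K m \<alpha> u)))"
  unfolding symmetric_fun_def
proof (intro allI impI)
  fix u \<tau> assume \<tau>: "\<tau> permutes {..<K}"
  have "bij_betw (\<lambda>M j. M j \<circ> \<tau>) (mats K m \<alpha> u) (mats K m \<alpha> (u \<circ> \<tau>))"
  proof (rule bij_betw_byWitness[of _ "\<lambda>M j. M j \<circ> inv \<tau>"])
    show "(\<lambda>M j. M j \<circ> inv \<tau>) ` mats K m \<alpha> (u \<circ> \<tau>) \<subseteq> mats K m \<alpha> u"
      using mats_permute[OF permutes_inv[OF \<tau>], of _ m \<alpha> "u \<circ> \<tau>"] \<tau> by (auto simp: comp_assoc)
  qed (use \<tau> in \<open>auto simp: comp_assoc mats_permute\<close>)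
  then show "int (card (mats K m \<alpha> (u \<circ> \<tau>))) = int (card (mats K m \<alpha> u))"
    by (simp add: bij_betw_same_card)
qed

section \<open>Pieri's rule and Kostka numbers\<close>

definition strictly_decreasing :: "nat \<Rightarrow> (nat \<Rightarrow> int) \<Rightarrow> bool" where
  "strictly_decreasing K v \<longleftrightarrow> (\<forall>i. Suc i < K \<longrightarrow> v (Suc i) < v i)"

text \<open>Pieri's rule: the terms that do not interlace with \<open>v\<close> cancel in pairs, by swapping the
  two entries of \<open>v - \<kappa>\<close> at the first place where interlacing fails.\<close>

lemma sum_comps_interlacing:
  assumes N: "symmetric_fun K N" and v: "strictly_decreasing K v"
  shows "(\<Sum>\<kappa>\<in>comps K s. altsum K N (\<lambda>i. v i - int (\<kappa> i)))
    = (\<Sum>\<kappa> | \<kappa> \<in> comps K s \<and> (\<forall>i. Suc i < K \<longrightarrow> v (Suc i) < v i - int (\<kappa> i)).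
         altsum K N (\<lambda>i. v i - int (\<kappa> i)))"
proof -
  define bad where "bad \<kappa> i \<longleftrightarrow> Suc i < K \<and> v i - int (\<kappa> i) \<le> v (Suc i)" for \<kappa> :: "nat \<Rightarrow> nat" and i
  \<comment> \<open>The new values are forced by exchanging the entries \<open>i\<close> and
    \<open>Suc i\<close> of \<open>v - \<kappa>\<close>. The first is nonnegative because
    \<open>v\<close> decreases, the second because interlacing fails at \<open>i\<close>.\<close>
  define sw where "sw \<kappa> i = \<kappa>(i := nat (v i - v (Suc i) + int (\<kappa> (Suc i))),
      Suc i := nat (v (Suc i) - v i + int (\<kappa> i)))" for \<kappa> :: "nat \<Rightarrow> nat" and i
  define \<theta> where "\<theta> \<kappa> = sw \<kappa> (LEAST i. bad \<kappa> i)" for \<kappa>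
  let ?B = "{\<kappa> \<in> comps K s. \<exists>i. bad \<kappa> i}"
  let ?G = "\<lambda>\<kappa>. altsum K N (\<lambda>i. v i - int (\<kappa> i))"
  have sw: "sw \<kappa> i \<in> comps K s" "bad (sw \<kappa> i) i" "sw (sw \<kappa> i) i = \<kappa>" "?G (sw \<kappa> i) = - ?G \<kappa>"
    "\<And>j. j < i \<Longrightarrow> bad (sw \<kappa> i) j = bad \<kappa> j"
    if \<kappa>: "\<kappa> \<in> comps K s" and b: "bad \<kappa> i" and l: "\<And>j. j < i \<Longrightarrow> \<not> bad \<kappa> j" for \<kappa> i
  proof -
    have i: "Suc i < K" "v (Suc i) < v i" "v i - int (\<kappa> i) \<le> v (Suc i)"
      using b v by (auto simp: bad_def strictly_decreasing_def)
    have vals: "int (sw \<kappa> i i) = v i - v (Suc i) + int (\<kappa> (Suc i))"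
        "int (sw \<kappa> i (Suc i)) = v (Suc i) - v i + int (\<kappa> i)"
        "\<And>j. j \<noteq> i \<Longrightarrow> j \<noteq> Suc i \<Longrightarrow> sw \<kappa> i j = \<kappa> j"
      using i by (auto simp: sw_def)
    have swap: "(\<lambda>j. v j - int (sw \<kappa> i j)) = (\<lambda>j. v j - int (\<kappa> j)) \<circ> transpose i (Suc i)"
      using vals by (auto simp: fun_eq_iff transpose_def)
    have "(\<Sum>j<K. ((\<lambda>j. v j - int (\<kappa> j)) \<circ> transpose i (Suc i)) j) = (\<Sum>j<K. v j - int (\<kappa> j))"
      using i(1) by (intro sum.permute[symmetric] permutes_swap_id) auto
    then have "(\<Sum>j<K. v j - int (sw \<kappa> i j)) = (\<Sum>j<K. v j - int (\<kappa> j))"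
      by (simp only: swap)
    then have "(\<Sum>j<K. int (sw \<kappa> i j)) = s"
      using \<kappa> by (simp add: sum_subtractf comps_def)
    then show "sw \<kappa> i \<in> comps K s"
      using \<kappa> i(1) vals(3) by (auto simp: comps_def)
    show "bad (sw \<kappa> i) i"
      using i by (simp add: bad_def vals)
    show "sw (sw \<kappa> i) i = \<kappa>"
      unfolding sw_def[of "sw \<kappa> i"] vals using vals(3) by (auto simp: fun_eq_iff)
    show "?G (sw \<kappa> i) = - ?G \<kappa>"
      unfolding swap using i(1) by (intro altsum_transpose[OF N]) auto
    show "bad (sw \<kappa> i) j = bad \<kappa> j" if "j < i" for j
      using that by (simp add: bad_def vals(3))
  qed
  have \<theta>: "\<theta> \<kappa> \<in> ?B" "\<theta> (\<theta> \<kappa>) = \<kappa>" "?G (\<theta> \<kappa>) = - ?G \<kappa>" if "\<kappa> \<in> ?B" for \<kappa>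
  proof -
    define i where "i = (LEAST i. bad \<kappa> i)"
    have b: "bad \<kappa> i" and l: "\<And>j. j < i \<Longrightarrow> \<not> bad \<kappa> j"
      unfolding i_def using that by (auto intro: LeastI_ex dest: not_less_Least)
    have \<kappa>: "\<kappa> \<in> comps K s" using that by simp
    note s = sw[OF \<kappa> b l]
    \<comment> \<open>Failure at \<open>j\<close> involves \<open>\<kappa>\<close> only at
      \<open>j\<close>: the swap preserves the failure at \<open>i\<close> and changes nothing
      before it. The same place is found again, so \<open>\<theta>\<close> is an involution.\<close>
    have "(LEAST j. bad (sw \<kappa> i) j) = i"
      by (rule Least_equality[of "bad (sw \<kappa> i)" i]) (use s(2,5) l in \<open>auto simp: not_less[symmetric]\<close>)
    then show "\<theta> \<kappa> \<in> ?B" "\<theta> (\<theta> \<kappa>) = \<kappa>" "?G (\<theta> \<kappa>) = - ?G \<kappa>"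
      using s by (auto simp: \<theta>_def simp flip: i_def)
  qed
  have "sum ?G ?B = sum (\<lambda>\<kappa>. - ?G \<kappa>) ?B"
    by (rule sum.reindex_bij_witness[of _ \<theta> \<theta>]) (use \<theta> in \<open>auto simp del: mem_Collect_eq\<close>)
  then have "sum ?G ?B = 0" by (simp add: sum_negf)
  moreover have "sum ?G (comps K s) = sum ?G ?B + sum ?G (comps K s - ?B)"
    by (subst add.commute, intro sum.subset_diff) auto
  moreover have "comps K s - ?B = {\<kappa> \<in> comps K s. \<forall>i. Suc i < K \<longrightarrow> v (Suc i) < v i - int (\<kappa> i)}"
    by (auto simp: bad_def not_le)
  ultimately show ?thesis by simp
qed

text \<open>For \<open>v i = \<lambda> i - i\<close> with a partition \<open>\<lambda>\<close> this
  is the Kostka number of shape \<open>\<lambda>\<close> and content \<open>\<alpha>\<close>, since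
  counts of matrices are the pairings of products of complete symmetric functions.\<close>

definition signed_mats :: "nat \<Rightarrow> nat \<Rightarrow> (nat \<Rightarrow> int) \<Rightarrow> (nat \<Rightarrow> int) \<Rightarrow> int" where
  "signed_mats K m \<alpha> v = altsum K (\<lambda>u. int (card (mats K m \<alpha> u))) v"

text \<open>Without rows all column sums vanish, so \<open>w i = - v i\<close> is increasing, and
  the only increasing permutation is the identity.\<close>

lemma signed_mats_0:
  assumes "strictly_decreasing K v"
  shows "signed_mats K 0 \<alpha> v = of_bool (\<forall>i<K. v i = - int i)"
proof -
  have "sign w * int (card (mats K 0 \<alpha> (\<lambda>i. v i + int (w i))))
      = (if w = id then of_bool (\<forall>i<K. v i = - int i) else 0)" if w: "w permutes {..<K}" for w
  proof (cases "\<forall>i<K. v i + int (w i) = 0")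
    case True
    have "i \<le> w i" if "i < K" for i
      using that
    proof (induction i)
      case (Suc i)
      have "v (Suc i) < v i" using assms Suc by (simp add: strictly_decreasing_def)
      moreover have "v (Suc i) + int (w (Suc i)) = 0" "v i + int (w i) = 0" using True Suc by auto
      ultimately show ?case using Suc by simp
    qed simp
    then have "w = id" using permutes_natset_ge[OF w] by simp
    then show ?thesis using True by (auto simp: mats_0)
  next
    case False
    then show ?thesis by (auto simp: mats_0)
  qed
  then have "signed_mats K 0 \<alpha> v
      = (\<Sum>w | w permutes {..<K}. if w = id then of_bool (\<forall>i<K. v i = - int i) else 0)"
    unfolding signed_mats_def altsum_def by (intro sum.cong refl) simp
  then show ?thesis by (simp add: permutes_id)
qed

text \<open>The recursion of semistandard tableaux: interlacing says that \<open>\<kappa>\<close> is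
  a horizontal strip, the cells holding the last letter.\<close>

lemma signed_mats_Suc:
  assumes "strictly_decreasing K v"
  shows "signed_mats K (Suc m) \<alpha> v
    = (\<Sum>\<kappa> | \<kappa> \<in> comps K (\<alpha> m) \<and> (\<forall>i. Suc i < K \<longrightarrow> v (Suc i) < v i - int (\<kappa> i)).
         signed_mats K m \<alpha> (\<lambda>i. v i - int (\<kappa> i)))"
proof -
  have "signed_mats K (Suc m) \<alpha> v
      = (\<Sum>\<kappa>\<in>comps K (\<alpha> m). signed_mats K m \<alpha> (\<lambda>i. v i - int (\<kappa> i)))"
    unfolding signed_mats_def altsum_def card_mats_Suc of_nat_sum sum_distrib_left
    by (subst sum.swap) (simp add: algebra_simps)
  then show ?thesis
    unfolding signed_mats_def using sum_comps_interlacing[OF symmetric_card_mats assms] by simp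
qed

lemma strictly_decreasing_interlacing:
  assumes "\<forall>i. Suc i < K \<longrightarrow> v (Suc i) < v i - int (\<kappa> i)"
  shows "strictly_decreasing K (\<lambda>i. v i - int (\<kappa> i))"
  unfolding strictly_decreasing_def
proof (intro allI impI)
  fix i assume "Suc i < K"
  then have "v (Suc i) < v i - int (\<kappa> i)" using assms by blast
  then show "v (Suc i) - int (\<kappa> (Suc i)) < v i - int (\<kappa> i)" by linarith
qed

text \<open>A semistandard tableau with \<open>m\<close> letters has at most \<open>m\<close> rows
  and a content dominated by its shape: each horizontal strip adds at most one row.\<close>

lemma signed_mats_nonzero:
  assumes "signed_mats K m \<alpha> v \<noteq> 0" "strictly_decreasing K v" "m \<le> K"
  shows "(\<forall>i. m \<le> i \<and> i < K \<longrightarrow> v i = - int i)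
    \<and> (\<forall>t\<le>m. (\<Sum>j<t. \<alpha> j) \<le> (\<Sum>i<t. v i + int i)) \<and> (\<Sum>i<K. v i + int i) = (\<Sum>j<m. \<alpha> j)"
  using assms
proof (induction m arbitrary: v)
  case 0
  then show ?case by (auto simp: signed_mats_0)
next
  case (Suc m)
  obtain \<kappa> where \<kappa>: "\<kappa> \<in> comps K (\<alpha> m)" "\<forall>i. Suc i < K \<longrightarrow> v (Suc i) < v i - int (\<kappa> i)"
    "signed_mats K m \<alpha> (\<lambda>i. v i - int (\<kappa> i)) \<noteq> 0"
    using Suc.prems(1) unfolding signed_mats_Suc[OF Suc.prems(2)]
    by (metis (mono_tags, lifting) mem_Collect_eq sum.neutral)
  note IH = Suc.IH[OF \<kappa>(3) strictly_decreasing_interlacing[OF \<kappa>(2)] Suc_leD[OF Suc.prems(3)]]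
  \<comment> \<open>Interlacing bounds \<open>v i\<close> by \<open>- i\<close> from above, and
    \<open>v i - \<kappa> i = - i\<close> bounds it from below.\<close>
  have zero: "v i = - int i" if i: "Suc m \<le> i" "i < K" for i
  proof -
    obtain j where j: "i = Suc j" using i(1) by (cases i) auto
    have "v j - int (\<kappa> j) = - int j" "v i - int (\<kappa> i) = - int i" using IH i j by auto
    moreover have "v i < v j - int (\<kappa> j)" using \<kappa>(2) i j by simp
    ultimately show ?thesis using j by simp
  qed
  have total: "(\<Sum>i<K. v i + int i) = (\<Sum>j<Suc m. \<alpha> j)"
    using IH \<kappa>(1) by (simp add: comps_def sum.distrib sum_subtractf)
  have "(\<Sum>j<t. \<alpha> j) \<le> (\<Sum>i<t. v i + int i)" if t: "t \<le> Suc m" for t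
  proof (cases "t = Suc m")
    case True
    have "(\<Sum>i<K. v i + int i) = (\<Sum>i<t. v i + int i)"
      by (rule sum.mono_neutral_right) (use Suc.prems(3) True zero in auto)
    then show ?thesis using True total by simp
  next
    case False
    then have "(\<Sum>j<t. \<alpha> j) \<le> (\<Sum>i<t. v i - int (\<kappa> i) + int i)" using IH t by simp
    also have "\<dots> \<le> (\<Sum>i<t. v i + int i)" by (intro sum_mono) simp
    finally show ?thesis .
  qed
  then show ?case using zero total by blast
qed

text \<open>There is one tableau whose content equals its shape, as the last strip must be the whole
  last row. Setting \<open>v i = - i\<close> from \<open>m\<close> on cuts the shape to its first
  \<open>m\<close> rows for the induction.\<close>

lemma signed_mats_diagonal:
  assumes v: "strictly_decreasing K v" and nn: "\<And>i. i < K \<Longrightarrow> 0 \<le> v i + int i" and m: "m \<le> K"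
  shows "signed_mats K m (\<lambda>j. v j + int j) (\<lambda>i. if i < m then v i else - int i) = 1"
  using m
proof (induction m)
  case 0
  then show ?case by (subst signed_mats_0) (auto simp: strictly_decreasing_def)
next
  case (Suc m)
  let ?\<alpha> = "\<lambda>j. v j + int j"
  let ?v = "\<lambda>m i. if i < m then v i else - int i"
  have sd: "strictly_decreasing K (?v m)" if "m \<le> K" for m
    unfolding strictly_decreasing_def
  proof (intro allI impI)
    fix i assume "Suc i < K"
    then have "v (Suc i) < v i" "0 \<le> v i + int i" using v nn by (auto simp: strictly_decreasing_def)
    then show "?v m (Suc i) < ?v m i" by auto
  qed
  define \<kappa>0 where "\<kappa>0 = (\<lambda>i. if i = m then nat (?\<alpha> m) else 0)"
  have \<alpha>m: "int (\<kappa>0 m) = ?\<alpha> m" using nn Suc.prems by (simp add: \<kappa>0_def)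
  have step: "(\<lambda>i. ?v (Suc m) i - int (\<kappa>0 i)) = ?v m"
    using \<alpha>m by (auto simp: fun_eq_iff less_Suc_eq) (auto simp: \<kappa>0_def)
  let ?I = "{\<kappa> \<in> comps K (?\<alpha> m). \<forall>i. Suc i < K \<longrightarrow> ?v (Suc m) (Suc i) < ?v (Suc m) i - int (\<kappa> i)}"
  have mem: "\<kappa>0 \<in> ?I"
  proof (intro CollectI conjI)
    have "(\<Sum>i<K. int (\<kappa>0 i)) = (\<Sum>i<K. if i = m then ?\<alpha> m else 0)"
      by (intro sum.cong refl) (use \<alpha>m in \<open>auto simp: \<kappa>0_def\<close>)
    then show "\<kappa>0 \<in> comps K (?\<alpha> m)"
      using Suc.prems by (auto simp: comps_def \<kappa>0_def)
    show "\<forall>i. Suc i < K \<longrightarrow> ?v (Suc m) (Suc i) < ?v (Suc m) i - int (\<kappa>0 i)"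
    proof (intro allI impI)
      fix i assume i: "Suc i < K"
      have "?v (Suc m) i - int (\<kappa>0 i) = ?v m i" using step by meson
      then show "?v (Suc m) (Suc i) < ?v (Suc m) i - int (\<kappa>0 i)"
        using i v unfolding strictly_decreasing_def by (cases "i < m") auto
    qed
  qed
  \<comment> \<open>A nonzero term leaves only the rows before \<open>m\<close>, so
    \<open>\<kappa>\<close> empties row \<open>m\<close>; this already uses up its total
    size.\<close>
  have uniq: "\<kappa> = \<kappa>0" if \<kappa>: "\<kappa> \<in> ?I" and nz: "signed_mats K m ?\<alpha> (\<lambda>i. ?v (Suc m) i - int (\<kappa> i)) \<noteq> 0" for \<kappa>
  proof -
    have z: "?v (Suc m) i - int (\<kappa> i) = - int i" if "m \<le> i" "i < K" for i
      using signed_mats_nonzero[OF nz strictly_decreasing_interlacing Suc_leD[OF Suc.prems]] \<kappa> that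
      by blast
    have \<kappa>m: "int (\<kappa> m) = ?\<alpha> m" using z[of m] Suc.prems by simp
    have "(\<Sum>i<K. int (\<kappa> i)) = int (\<kappa> m) + (\<Sum>i\<in>{..<K} - {m}. int (\<kappa> i))"
      using Suc.prems by (intro sum.remove) auto
    then have "(\<Sum>i\<in>{..<K} - {m}. int (\<kappa> i)) = 0" using \<kappa> \<kappa>m by (simp add: comps_def)
    then have "\<kappa> i = 0" if "i \<noteq> m" "i < K" for i
      using that by (subst (asm) sum_nonneg_eq_0_iff) auto
    moreover have "\<kappa> i = 0" if "i \<ge> K" for i using \<kappa> that by (simp add: comps_def)
    ultimately show "\<kappa> = \<kappa>0" using \<kappa>m \<alpha>m by (auto simp: fun_eq_iff \<kappa>0_def) (metis not_le)+
  qed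
  have "signed_mats K (Suc m) ?\<alpha> (?v (Suc m))
      = (\<Sum>\<kappa>\<in>?I. signed_mats K m ?\<alpha> (\<lambda>i. ?v (Suc m) i - int (\<kappa> i)))"
    by (rule signed_mats_Suc[OF sd[OF Suc.prems]])
  also have "\<dots> = (\<Sum>\<kappa>\<in>{\<kappa>0}. signed_mats K m ?\<alpha> (\<lambda>i. ?v (Suc m) i - int (\<kappa> i)))"
    by (rule sum.mono_neutral_right) (use mem uniq in auto)
  also have "\<dots> = 1" using Suc by (simp add: step)
  finally show ?case .
qed

section \<open>Characters as alternating sums of permutation characters\<close>

lemma ex_fun_with_counts:
  assumes "finite Y" "finite A" "(\<Sum>y\<in>Y. c y) = card A"
  shows "\<exists>F\<in>A \<rightarrow>\<^sub>E Y. \<forall>y\<in>Y. card {x \<in> A. F x = y} = c y"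
  using assms
proof (induction Y arbitrary: A rule: finite_induct)
  case empty
  then show ?case by auto
next
  case (insert y Y)
  then have "c y \<le> card A" by simp
  then obtain S where S: "S \<subseteq> A" "card S = c y" "finite S"
    by (rule obtain_subset_with_card_n)
  have "(\<Sum>y\<in>Y. c y) = card (A - S)"
    using insert S by (simp add: card_Diff_subset)
  then obtain F where F: "F \<in> (A - S) \<rightarrow>\<^sub>E Y" "\<forall>y\<in>Y. card {x \<in> A - S. F x = y} = c y"
    using insert.IH[of "A - S"] insert.prems by auto
  define F' where "F' = (\<lambda>x. if x \<in> S then y else F x)"
  have "F' \<in> A \<rightarrow>\<^sub>E insert y Y"
    using F(1) S(1) by (auto simp: F'_def PiE_iff extensional_def)
  moreover have "{x \<in> A. F' x = y} = S"
    using F(1) S(1) insert.hyps(2) by (auto simp: F'_def PiE_iff)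
  moreover have "{x \<in> A. F' x = z} = {x \<in> A - S. F x = z}" if "z \<in> Y" for z
    using that insert.hyps(2) by (auto simp: F'_def)
  ultimately show ?case
    using F(2) S(2) by (intro bexI[of _ F']) auto
qed

lemma card_col_eq_sum:
  assumes "finite A" "\<And>x. x \<in> A \<Longrightarrow> F x \<in> B" "finite B"
  shows "(\<Sum>y\<in>B. card {x \<in> A. P x \<and> F x = y}) = card {x \<in> A. P x}"
proof -
  have "card {x \<in> A. P x} = card (\<Union>y\<in>B. {x \<in> A. P x \<and> F x = y})"
    using assms(2) by (intro arg_cong[of _ _ card]) auto
  also have "\<dots> = (\<Sum>y\<in>B. card {x \<in> A. P x \<and> F x = y})"
    using assms by (intro card_UN_disjoint) auto
  finally show ?thesis ..
qed

text \<open>Pairs of colourings with prescribed matrix of intersection numbers form one orbit of the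
  symmetric group, so their stabilisers together have \<open>(card A)!\<close> elements.\<close>

lemma sum_psi_psi:
  assumes A: "finite A" and tot: "(\<Sum>j<K. \<alpha> j) = int (card A)"
  shows "(\<Sum>g | g permutes A. psi A K u g * psi A K \<alpha> g)
    = fact (card A) * int (card (mats K K \<alpha> u))"
proof -
  let ?D = "{..<K} \<times> {..<K}"
  define X where "X = {F \<in> A \<rightarrow>\<^sub>E ?D. (\<forall>i<K. int (card {x \<in> A. fst (F x) = i}) = u i)
    \<and> (\<forall>j<K. int (card {x \<in> A. snd (F x) = j}) = \<alpha> j)}"
  define mt where "mt F = (\<lambda>j i. if j < K \<and> i < K then card {x \<in> A. F x = (i, j)} else 0)"
    for F :: "'a \<Rightarrow> nat \<times> nat"
  have finX: "finite X"
    unfolding X_def by (rule finite_subset[of _ "A \<rightarrow>\<^sub>E ?D"]) (use A in \<open>auto intro!: finite_PiE\<close>)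
  have row: "(\<Sum>j<K. mt F j i) = card {x \<in> A. fst (F x) = i}"
    and col: "(\<Sum>j<K. mt F i j) = card {x \<in> A. snd (F x) = i}"
    if F: "F \<in> A \<rightarrow>\<^sub>E ?D" and i: "i < K" for F i
  proof -
    have "(\<Sum>j<K. mt F j i) = (\<Sum>j<K. card {x \<in> A. fst (F x) = i \<and> snd (F x) = j})"
      using i by (intro sum.cong refl) (simp add: mt_def prod_eq_iff)
    also have "\<dots> = card {x \<in> A. fst (F x) = i}"
      by (rule card_col_eq_sum[OF A]) (use F in \<open>auto simp: PiE_iff mem_Times_iff\<close>)
    finally show "(\<Sum>j<K. mt F j i) = card {x \<in> A. fst (F x) = i}" .
    have "(\<Sum>j<K. mt F i j) = (\<Sum>j<K. card {x \<in> A. snd (F x) = i \<and> fst (F x) = j})"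
      using i by (intro sum.cong refl) (simp add: mt_def prod_eq_iff conj_commute)
    also have "\<dots> = card {x \<in> A. snd (F x) = i}"
      by (rule card_col_eq_sum[OF A]) (use F in \<open>auto simp: PiE_iff mem_Times_iff\<close>)
    finally show "(\<Sum>j<K. mt F i j) = card {x \<in> A. snd (F x) = i}" .
  qed
  have XI: "F \<in> X \<longleftrightarrow> F \<in> A \<rightarrow>\<^sub>E ?D \<and> mt F \<in> mats K K \<alpha> u" for F
  proof (cases "F \<in> A \<rightarrow>\<^sub>E ?D")
    case True
    have "F \<in> X \<longleftrightarrow> (\<forall>i<K. (\<Sum>j<K. int (mt F j i)) = u i) \<and> (\<forall>j<K. (\<Sum>i<K. int (mt F j i)) = \<alpha> j)"
      using True by (simp add: X_def row col flip: of_nat_sum)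
    also have "\<dots> \<longleftrightarrow> mt F \<in> mats K K \<alpha> u"
      by (auto simp: mats_def comps_def) (auto simp: mt_def)
    finally show ?thesis using True by simp
  qed (simp add: X_def)
  have fibre: "(\<Sum>F | F \<in> X \<and> mt F = M. \<Sum>g | g permutes A. of_bool (fixes_col A g F)) = (fact (card A) :: int)"
    if M: "M \<in> mats K K \<alpha> u" for M
  proof -
    have "int (\<Sum>y\<in>?D. case y of (i, j) \<Rightarrow> M j i) = int (\<Sum>j<K. \<Sum>i<K. M j i)"
      by (subst sum.cartesian_product[symmetric], subst sum.swap) simp
    also have "\<dots> = int (card A)"
      using M tot by (simp add: mats_def comps_def)
    finally have "(\<Sum>y\<in>?D. case y of (i, j) \<Rightarrow> M j i) = card A" by (simp only: of_nat_eq_iff)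
    then obtain F0 where F0: "F0 \<in> A \<rightarrow>\<^sub>E ?D" "\<forall>y\<in>?D. card {x \<in> A. F0 x = y} = (case y of (i, j) \<Rightarrow> M j i)"
      using ex_fun_with_counts[of ?D A "\<lambda>(i, j). M j i"] A by (auto simp: case_prod_unfold)
    have "mt F = M \<longleftrightarrow> (\<forall>y. card {x \<in> A. F x = y} = card {x \<in> A. F0 x = y})" if F: "F \<in> A \<rightarrow>\<^sub>E ?D" for F
    proof -
      have out: "card {x \<in> A. G x = y} = 0" if "G \<in> A \<rightarrow>\<^sub>E ?D" "y \<notin> ?D" for G y
      proof -
        have "{x \<in> A. G x = y} = {}" using that by (auto simp: PiE_iff)
        then show ?thesis by (simp only: card.empty)
      qed
      have "mt F = M \<longleftrightarrow> (\<forall>j<K. \<forall>i<K. card {x \<in> A. F x = (i, j)} = M j i)"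
      proof
        assume inner: "\<forall>j<K. \<forall>i<K. card {x \<in> A. F x = (i, j)} = M j i"
        have outer: "M j i = 0" if "\<not> (j < K \<and> i < K)" for i j
          using M that by (cases "j < K") (auto simp: mats_def comps_def)
        show "mt F = M"
        proof (intro ext)
          fix j i
          show "mt F j i = M j i"
            using inner outer[of j i] by (cases "j < K \<and> i < K") (simp_all add: mt_def)
        qed
      qed (auto simp: mt_def)
      also have "\<dots> \<longleftrightarrow> (\<forall>y\<in>?D. card {x \<in> A. F x = y} = card {x \<in> A. F0 x = y})"
        using F0(2) by auto
      also have "\<dots> \<longleftrightarrow> (\<forall>y. card {x \<in> A. F x = y} = card {x \<in> A. F0 x = y})"
      proof
        assume inner: "\<forall>y\<in>?D. card {x \<in> A. F x = y} = card {x \<in> A. F0 x = y}"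
        show "\<forall>y. card {x \<in> A. F x = y} = card {x \<in> A. F0 x = y}"
        proof
          fix y
          show "card {x \<in> A. F x = y} = card {x \<in> A. F0 x = y}"
          proof (cases "y \<in> ?D")
            case True
            then show ?thesis using inner by blast
          next
            case False
            then show ?thesis using out[OF F] out[OF F0(1)] by simp
          qed
        qed
      qed blast
      finally show ?thesis .
    qed
    then have "{F. F \<in> X \<and> mt F = M} = same_type A F0 ?D"
      using M by (auto simp: XI same_type_def)
    then show ?thesis
      using burnside_same_type[OF A, of F0 ?D] F0(1)
      by (subst sum.swap) (simp add: PiE_iff Pi_iff del: sum_of_bool_eq)
  qed
  have pairs: "psi A K u g * psi A K \<alpha> g = (\<Sum>F\<in>X. of_bool (fixes_col A g F))" if g: "g permutes A" for g
  proof -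
    have "psi A K u g * psi A K \<alpha> g
        = (\<Sum>(f, f')\<in>colourings A K u \<times> colourings A K \<alpha>. of_bool (fixes_col A g f \<and> fixes_col A g f'))"
      unfolding psi_def sum_product sum.cartesian_product by (simp add: of_bool_conj del: sum_of_bool_eq sum_of_bool_mult_eq sum_mult_of_bool_eq)
    also have "\<dots> = (\<Sum>F\<in>X. of_bool (fixes_col A g F))"
    proof (rule sum.reindex_bij_witness[of _ "\<lambda>F. (restrict (fst \<circ> F) A, restrict (snd \<circ> F) A)"
          "\<lambda>(f, f'). restrict (\<lambda>x. (f x, f' x)) A"])
      fix p assume "p \<in> colourings A K u \<times> colourings A K \<alpha>"
      then obtain f f' where p: "p = (f, f')" and f: "f \<in> colourings A K u" and f': "f' \<in> colourings A K \<alpha>" by auto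
      then have ext: "f \<in> extensional A" "f' \<in> extensional A" by (auto simp: colourings_def PiE_def)
      show "(restrict (fst \<circ> (case p of (f, f') \<Rightarrow> restrict (\<lambda>x. (f x, f' x)) A)) A,
          restrict (snd \<circ> (case p of (f, f') \<Rightarrow> restrict (\<lambda>x. (f x, f' x)) A)) A) = p"
        using ext by (auto simp: p fun_eq_iff restrict_def extensional_def)
      show "(case p of (f, f') \<Rightarrow> restrict (\<lambda>x. (f x, f' x)) A) \<in> X"
        using f f' by (auto simp: p X_def colourings_def PiE_iff cong: conj_cong)
      show "of_bool (fixes_col A g (case p of (f, f') \<Rightarrow> restrict (\<lambda>x. (f x, f' x)) A))
          = (case p of (f, f') \<Rightarrow> of_bool (fixes_col A g f \<and> fixes_col A g f'))"
        using permutes_in_image[OF g] by (auto simp: p fixes_col_def)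
    next
      fix F assume F: "F \<in> X"
      then show "(case (restrict (fst \<circ> F) A, restrict (snd \<circ> F) A) of (f, f') \<Rightarrow> restrict (\<lambda>x. (f x, f' x)) A) = F"
        by (auto simp: X_def fun_eq_iff restrict_def PiE_iff extensional_def)
      show "(restrict (fst \<circ> F) A, restrict (snd \<circ> F) A) \<in> colourings A K u \<times> colourings A K \<alpha>"
        using F by (auto simp: X_def colourings_def PiE_iff mem_Times_iff cong: conj_cong)
    qed
    finally show ?thesis .
  qed
  have "(\<Sum>g | g permutes A. psi A K u g * psi A K \<alpha> g)
      = (\<Sum>g | g permutes A. \<Sum>F\<in>X. of_bool (fixes_col A g F))"
    by (intro sum.cong refl) (simp only: pairs mem_Collect_eq)
  also have "\<dots> = (\<Sum>F\<in>X. \<Sum>g | g permutes A. of_bool (fixes_col A g F))"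
    by (rule sum.swap)
  also have "\<dots> = (\<Sum>M\<in>mats K K \<alpha> u. \<Sum>F | F \<in> X \<and> mt F = M. \<Sum>g | g permutes A. of_bool (fixes_col A g F))"
    by (rule sum.group[symmetric]) (use finX XI in auto)
  also have "\<dots> = (\<Sum>M\<in>mats K K \<alpha> u. fact (card A))"
    by (rule sum.cong[OF refl fibre])
  finally show ?thesis by simp
qed

definition Phi :: "'a set \<Rightarrow> nat \<Rightarrow> (nat \<Rightarrow> int) \<Rightarrow> ('a \<Rightarrow> 'a) \<Rightarrow> int" where
  "Phi A K v g = altsum K (\<lambda>u. psi A K u g) v"

lemma sum_permuted_index:
  "w permutes {..<K} \<Longrightarrow> (\<Sum>i<K. v i + int (w i)) = (\<Sum>i<K. v i + int i)"
  using sum.permute[of w "{..<K}" int] by (simp add: sum.distrib comp_def)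

text \<open>For fixed \<open>u\<close>, the sum over the other permutation is a Kostka number with
  shape given by \<open>v\<close> and content \<open>v + u\<close>. Unless \<open>u = id\<close>,
  the content exceeds the shape in some partial sum.\<close>

lemma sum_Phi_Phi:
  assumes A: "finite A" and v: "strictly_decreasing K v" and nn: "\<And>i. i < K \<Longrightarrow> 0 \<le> v i + int i"
    and tot: "(\<Sum>i<K. v i + int i) = int (card A)"
  shows "(\<Sum>g | g permutes A. Phi A K v g * Phi A K v g) = fact (card A)"
proof -
  let ?W = "{w. w permutes {..<K}}"
  let ?s = "\<lambda>w i. v i + int (w i)"
  have "(\<Sum>g | g permutes A. Phi A K v g * Phi A K v g)
      = (\<Sum>g | g permutes A. \<Sum>w\<in>?W. \<Sum>u\<in>?W. sign w * sign u * (psi A K (?s w) g * psi A K (?s u) g))"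
    unfolding Phi_def altsum_def sum_product by (simp add: mult_ac)
  also have "\<dots> = (\<Sum>w\<in>?W. \<Sum>g | g permutes A. \<Sum>u\<in>?W. sign w * sign u * (psi A K (?s w) g * psi A K (?s u) g))"
    by (rule sum.swap)
  also have "\<dots> = (\<Sum>w\<in>?W. \<Sum>u\<in>?W. \<Sum>g | g permutes A. sign w * sign u * (psi A K (?s w) g * psi A K (?s u) g))"
    by (intro sum.cong refl sum.swap)
  also have "\<dots> = (\<Sum>w\<in>?W. \<Sum>u\<in>?W. sign w * sign u * (fact (card A) * int (card (mats K K (?s u) (?s w)))))"
    using A tot by (intro sum.cong refl) (simp add: sum_psi_psi sum_permuted_index flip: sum_distrib_left)
  also have "\<dots> = (\<Sum>u\<in>?W. \<Sum>w\<in>?W. sign w * sign u * (fact (card A) * int (card (mats K K (?s u) (?s w)))))"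
    by (rule sum.swap)
  also have "\<dots> = (\<Sum>u\<in>?W. sign u * fact (card A) * signed_mats K K (?s u) v)"
    unfolding signed_mats_def altsum_def sum_distrib_left by (simp add: mult_ac)
  also have "\<dots> = (\<Sum>u\<in>?W. if u = id then fact (card A) else 0)"
  proof (rule sum.cong[OF refl])
    fix u assume "u \<in> ?W"
    then have u: "u permutes {..<K}" by simp
    show "sign u * fact (card A) * signed_mats K K (?s u) v = (if u = id then fact (card A) else 0)"
    proof (cases "u = id")
      case True
      have "signed_mats K K (\<lambda>j. v j + int j) v
          = signed_mats K K (\<lambda>j. v j + int j) (\<lambda>i. if i < K then v i else - int i)"
        unfolding signed_mats_def by (rule altsum_cong) (simp_all add: mats_def)
      then show ?thesis using True signed_mats_diagonal[OF v nn order_refl] by simp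
    next
      case False
      then obtain t where t: "t \<le> K" "(\<Sum>j<t. int j) < (\<Sum>j<t. int (u j))"
        using permutes_exceeds[OF u] by blast
      have "signed_mats K K (?s u) v = 0"
      proof (rule ccontr)
        assume "signed_mats K K (?s u) v \<noteq> 0"
        then have "(\<Sum>j<t. ?s u j) \<le> (\<Sum>i<t. v i + int i)"
          using signed_mats_nonzero[OF _ v order_refl] t(1) by blast
        then show False using t(2) by (simp add: sum.distrib)
      qed
      then show ?thesis using False by simp
    qed
  qed
  also have "\<dots> = fact (card A)" by (simp add: permutes_id)
  finally show ?thesis .
qed

lemma (in filling) chi_eq_Phi:
  assumes K: "\<And>x. x \<in> {1..n} \<Longrightarrow> r x < K"
    and v: "\<And>i. i < K \<Longrightarrow> v i = int (card {x \<in> {1..n}. r x = i}) - int i"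
    and dec: "strictly_decreasing K v"
    and g: "g permutes {1..n}"
  shows "chi g = of_int (Phi {1..n} K v g)"
proof -
  let ?A = "{1..n}"
  let ?W = "{w. w permutes {..<K}}"
  have count: "(\<Sum>i<t. v i + int i) = int (card {x \<in> ?A. r x < t})" if "t \<le> K" for t
  proof -
    have "{x \<in> ?A. r x < t} = (\<Union>i<t. {x \<in> ?A. r x = i})" by auto
    then have "card {x \<in> ?A. r x < t} = (\<Sum>i<t. card {x \<in> ?A. r x = i})"
      by (simp only:) (rule card_UN_disjoint, auto)
    then show ?thesis using that by (simp add: v)
  qed
  have "{x \<in> ?A. r x < K} = ?A" using K by auto
  then have tot: "(\<Sum>i<K. v i + int i) = int (card ?A)" using count[of K] by simp
  have norm: "(\<Sum>g\<in>symg n. Phi ?A K v g * Phi ?A K v g) = fact n"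
    using sum_Phi_Phi[OF _ dec _ tot] by (simp add: v)
  have cross: "(\<Sum>g\<in>symg n. chi g * of_int (Phi ?A K v g)) = fact n"
  proof -
    have "(\<Sum>g\<in>symg n. chi g * of_int (Phi ?A K v g))
        = (\<Sum>g\<in>symg n. \<Sum>w\<in>?W. of_int (sign w) * (chi g * of_int (psi ?A K (\<lambda>i. v i + int (w i)) g)))"
      unfolding Phi_def altsum_def of_int_sum sum_distrib_left by (simp add: mult_ac)
    also have "\<dots> = (\<Sum>w\<in>?W. of_int (sign w) * (\<Sum>g\<in>symg n. chi g * of_int (psi ?A K (\<lambda>i. v i + int (w i)) g)))"
      unfolding sum_distrib_left by (rule sum.swap)
    also have "\<dots> = (\<Sum>w\<in>?W. if w = id then fact n else 0)"
    proof (rule sum.cong[OF refl])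
      fix w assume "w \<in> ?W"
      then have w: "w permutes {..<K}" by simp
      show "of_int (sign w) * (\<Sum>g\<in>symg n. chi g * of_int (psi ?A K (\<lambda>i. v i + int (w i)) g))
          = (if w = id then fact n else 0)"
      proof (cases "w = id")
        case True
        then show ?thesis using sum_chi_psi_rows[OF K] by (simp add: v)
      next
        case False
        then obtain t where t: "t \<le> K" "(\<Sum>j<t. int j) < (\<Sum>j<t. int (w j))"
          using permutes_exceeds[OF w] by blast
        have "int (card {x \<in> ?A. r x < t}) < (\<Sum>i<t. v i + int (w i))"
          using t(2) count[OF t(1)] by (simp add: sum.distrib)
        then show ?thesis using False sum_chi_psi_undominated[OF t(1)] by simp
      qed
    qed
    finally show ?thesis by (simp add: permutes_id)
  qed
  let ?d = "\<lambda>g. chi g - of_int (Phi ?A K v g)"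
  have "(\<Sum>g\<in>symg n. ?d g * ?d g)
      = (\<Sum>g\<in>symg n. chi g * chi g) - 2 * (\<Sum>g\<in>symg n. chi g * of_int (Phi ?A K v g))
        + of_int (\<Sum>g\<in>symg n. Phi ?A K v g * Phi ?A K v g)"
    by (simp add: algebra_simps sum.distrib sum_subtractf sum_distrib_left)
  also have "\<dots> = 0" by (simp only: sum_chi_chi cross norm) simp
  finally have "(\<Sum>g\<in>symg n. ?d g * ?d g) = 0" .
  moreover have real: "?d g = of_real (Re (?d g))" if "g \<in> symg n" for g
    using chi_Reals[of g] that by (simp add: complex_is_Real_iff complex_eq_iff)
  ultimately have "(\<Sum>g\<in>symg n. of_real (Re (?d g) * Re (?d g)) :: complex) = 0"
    by (metis (mono_tags, lifting) of_real_mult sum.cong)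
  then have "(\<Sum>g\<in>symg n. Re (?d g) * Re (?d g)) = 0"
    by (simp only: of_real_sum[symmetric] of_real_eq_0_iff)
  then have "Re (?d g) * Re (?d g) = 0"
    using g by (subst (asm) sum_nonneg_eq_0_iff) auto
  then have "?d g = 0" using real[of g] g by simp
  then show ?thesis by simp
qed

text \<open>Renaming the colours permutes the class sizes and does not affect whether
  \<open>g\<close> preserves a colouring.\<close>

lemma symmetric_psi:
  assumes g: "\<And>x. x \<in> A \<Longrightarrow> g x \<in> A"
  shows "symmetric_fun K (\<lambda>u. psi A K u g)"
  unfolding symmetric_fun_def
proof (intro allI impI)
  fix u \<tau> assume \<tau>: "\<tau> permutes {..<K}"
  define m where "m \<rho> f = restrict (\<rho> \<circ> f) A" for \<rho> :: "nat \<Rightarrow> nat" and f :: "'a \<Rightarrow> nat"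
  have mem: "m (inv \<rho>) f \<in> colourings A K (u \<circ> \<rho>)"
    if "\<rho> permutes {..<K}" "f \<in> colourings A K u" for \<rho> f u
  proof -
    have "inv \<rho> (f x) = i \<longleftrightarrow> f x = \<rho> i" for x i
      using permutes_inverses[OF that(1)] by metis
    then have "{x \<in> A. m (inv \<rho>) f x = i} = {x \<in> A. f x = \<rho> i}" for i
      by (auto simp: m_def)
    moreover have "\<rho> i < K" "inv \<rho> i < K" if "i < K" for i
      using permutes_in_image[OF \<open>\<rho> permutes {..<K}\<close>] permutes_in_image[OF permutes_inv[OF \<open>\<rho> permutes {..<K}\<close>]] that
      by auto
    ultimately show ?thesis
      using that(2) by (auto simp: colourings_def m_def PiE_iff)
  qed
  have inverse: "m \<rho> (m (inv \<rho>) f) = f" if "\<rho> permutes {..<K}" "f \<in> extensional A" for \<rho> f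
    using that permutes_inverses[OF that(1)] by (auto simp: m_def fun_eq_iff extensional_def restrict_def)
  have ext: "f \<in> extensional A" if "f \<in> colourings A K u" for f u
    using that by (auto simp: colourings_def PiE_def)
  have mem': "m \<tau> f \<in> colourings A K u" if "f \<in> colourings A K (u \<circ> \<tau>)" for f
    using mem[OF permutes_inv[OF \<tau>] that] \<tau> by (simp add: comp_assoc)
  have "(\<Sum>f\<in>colourings A K (u \<circ> \<tau>). of_bool (fixes_col A g f))
      = (\<Sum>f\<in>colourings A K u. of_bool (fixes_col A g f) :: int)"
  proof (rule sum.reindex_bij_witness[of _ "m (inv \<tau>)" "m \<tau>"])
    fix f assume f: "f \<in> colourings A K (u \<circ> \<tau>)"
    show "m (inv \<tau>) (m \<tau> f) = f"
      using inverse[OF permutes_inv[OF \<tau>] ext[OF f]] \<tau> by simp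
    show "m \<tau> f \<in> colourings A K u" by (rule mem'[OF f])
    have "\<tau> a = \<tau> b \<longleftrightarrow> a = b" for a b using permutes_inj[OF \<tau>] by (auto dest: injD)
    then show "of_bool (fixes_col A g (m \<tau> f)) = (of_bool (fixes_col A g f) :: int)"
      using g by (simp add: fixes_col_def m_def)
  next
    fix f assume f: "f \<in> colourings A K u"
    show "m \<tau> (m (inv \<tau>) f) = f" by (rule inverse[OF \<tau> ext[OF f]])
    show "m (inv \<tau>) f \<in> colourings A K (u \<circ> \<tau>)" by (rule mem[OF \<tau> f])
  qed
  then show "psi A K (u \<circ> \<tau>) g = psi A K u g" by (simp only: psi_def)
qed

lemma psi_negative:
  assumes "i < K" "u i < 0" shows "psi A K u g = 0"
proof -
  have "colourings A K u = {}" using assms by (force simp: colourings_def)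
  then show ?thesis by (simp add: psi_def)
qed

lemma psi_cong:
  assumes "\<And>i. i < K \<Longrightarrow> u i = u' i" "\<And>x. x \<in> A \<Longrightarrow> g x = g' x"
  shows "psi A K u g = psi A K u' g'"
proof -
  have "colourings A K u = colourings A K u'" using assms(1) by (auto simp: colourings_def)
  moreover have "fixes_col A g f = fixes_col A g' f" for f :: "'a \<Rightarrow> nat" using assms(2) by (auto simp: fixes_col_def)
  ultimately show ?thesis by (simp only: psi_def)
qed

lemma Phi_cong:
  assumes "\<And>i. i < K \<Longrightarrow> v i = v' i" "\<And>x. x \<in> A \<Longrightarrow> g x = g' x"
  shows "Phi A K v g = Phi A K v' g'"
  unfolding Phi_def altsum_def
  by (intro sum.cong refl arg_cong2[of _ _ _ _ "(*)"] psi_cong assms) (simp_all add: assms)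

section \<open>Three-cycles\<close>

lemma fixes_col_three_cycle:
  assumes A: "A = insert x (insert y A')" and xy: "x \<noteq> y" "x \<notin> A'" "y \<notin> A'" and i: "i \<in> A'"
    and g: "g permutes A" "g x = x" "g y = y"
  shows "fixes_col A (g \<circ> cycle_of_list [i, x, y]) f
    \<longleftrightarrow> fixes_col A' g f \<and> f x = f y \<and> f i = f y"
proof -
  define s where "s = cycle_of_list [i, x, y]"
  have s: "s i = x" "s x = y" "s y = i"
    using xy i by (auto simp: s_def transpose_def)
  define A'' where "A'' = A' - {i}"
  have s': "s z = z" if "z \<in> A''" for z
    using that xy by (auto simp: s_def A''_def transpose_def)
  have "A = insert x (insert y (insert i A''))" using i by (auto simp: A A''_def)
  \<comment> \<open>The cycle acts first, sending \<open>i\<close> to \<open>x\<close>,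
    \<open>x\<close> to \<open>y\<close> and \<open>y\<close> to \<open>i\<close>. The condition at
    \<open>y\<close> reads \<open>f (g i) = f y\<close>; given \<open>f i = f y\<close>, this is the
    condition of \<open>g\<close> at \<open>i\<close>.\<close>
  then have "fixes_col A (g \<circ> s) f \<longleftrightarrow>
      f x = f i \<and> f y = f x \<and> f (g i) = f y \<and> (\<forall>z\<in>A''. f (g z) = f z)"
    using g(2,3) by (auto simp: fixes_col_def s s' intro: sym)
  also have "\<dots> \<longleftrightarrow> fixes_col (insert i A'') g f \<and> f x = f y \<and> f i = f y"
    by (auto simp: fixes_col_def)
  also have "insert i A'' = A'" using i by (auto simp: A''_def)
  finally show ?thesis by (simp only: s_def)
qed

text \<open>A fixed colouring gives \<open>x\<close> and \<open>y\<close> one colour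
  \<open>k\<close>, and the admissible \<open>i\<close> are the other points of that colour,
  \<open>\<alpha> k - 2\<close> in number. Forgetting \<open>x\<close> and \<open>y\<close> lowers
  the size of class \<open>k\<close> by 2.\<close>

lemma sum_psi_three_cycles:
  assumes A': "finite A'" and A: "A = insert x (insert y A')" and xy: "x \<noteq> y" "x \<notin> A'" "y \<notin> A'"
    and g: "g permutes A" "g x = x" "g y = y"
  shows "(\<Sum>i\<in>A'. psi A K \<alpha> (g \<circ> cycle_of_list [i, x, y]))
    = (\<Sum>k<K. (\<alpha> k - 2) * psi A' K (\<lambda>i. \<alpha> i - (if i = k then 2 else 0)) g)"
proof -
  let ?\<alpha> = "\<lambda>k i. \<alpha> i - (if i = k then 2 else 0)"
  let ?F = "\<lambda>f. of_bool (fixes_col A' g f) :: int"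
  let ?C = "{f \<in> colourings A K \<alpha>. f x = f y}"
  have fA: "finite A" using A' A by simp
  have gA': "g z \<in> A' \<longleftrightarrow> z \<in> A'" for z
    using permutes_in_image[OF g(1), of z] permutes_inj[OF g(1)] g(2,3) xy
    by (auto simp: A) (metis injD)+
  have count: "card {z \<in> A. f z = i} = card {z \<in> A'. f z = i} + of_bool (f x = i) + of_bool (f y = i)"
    for f :: "'a \<Rightarrow> nat" and i
  proof -
    have "{z \<in> A. f z = i} = {z \<in> A'. f z = i} \<union> ({z. z = x \<and> f x = i} \<union> {z. z = y \<and> f y = i})"
      by (auto simp: A)
    also have "card \<dots> = card {z \<in> A'. f z = i} + (card {z. z = x \<and> f x = i} + card {z. z = y \<and> f y = i})"
      using A' xy by (subst card_Un_disjoint, auto, subst card_Un_disjoint, auto)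
    finally show ?thesis by (simp add: Collect_conv_if)
  qed
  have "(\<Sum>i\<in>A'. psi A K \<alpha> (g \<circ> cycle_of_list [i, x, y]))
      = (\<Sum>i\<in>A'. \<Sum>f\<in>colourings A K \<alpha>. of_bool (fixes_col A' g f \<and> f x = f y \<and> f i = f y))"
    unfolding psi_def
    by (intro sum.cong refl) (simp only: fixes_col_three_cycle[OF A xy _ g])
  also have "\<dots> = (\<Sum>f\<in>colourings A K \<alpha>. \<Sum>i\<in>A'. of_bool (fixes_col A' g f \<and> f x = f y \<and> f i = f y))"
    by (rule sum.swap)
  also have "\<dots> = (\<Sum>f\<in>colourings A K \<alpha>. if f x = f y then ?F f * int (card {i \<in> A'. f i = f y}) else 0)"
  proof (rule sum.cong[OF refl])
    fix f
    have "A' \<inter> {i. f i = f y} = {i \<in> A'. f i = f y}" by auto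
    then show "(\<Sum>i\<in>A'. of_bool (fixes_col A' g f \<and> f x = f y \<and> f i = f y))
        = (if f x = f y then ?F f * int (card {i \<in> A'. f i = f y}) else 0)"
      using A' by (cases "fixes_col A' g f"; cases "f x = f y") (simp_all add: sum_of_bool_eq)
  qed
  also have "\<dots> = (\<Sum>f\<in>?C. ?F f * int (card {i \<in> A'. f i = f y}))"
    by (rule sum.inter_filter[symmetric]) (simp add: fA)
  also have "\<dots> = (\<Sum>(k, f')\<in>Sigma {..<K} (\<lambda>k. colourings A' K (?\<alpha> k)). (\<alpha> k - 2) * ?F f')"
  proof (rule sum.reindex_bij_witness[of _ "\<lambda>(k, f'). f'(x := k, y := k)" "\<lambda>f. (f y, restrict f A')"])
    fix f assume f: "f \<in> ?C"
    have K: "f y < K" using f by (auto simp: colourings_def A)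
    have counts: "int (card {z \<in> A'. f z = i}) = ?\<alpha> (f y) i" if "i < K" for i
      using f count[of f i] that by (auto simp: colourings_def)
    show "(case (f y, restrict f A') of (k, f') \<Rightarrow> f'(x := k, y := k)) = f"
      using f by (auto simp: fun_eq_iff colourings_def PiE_iff extensional_def restrict_def A)
    have "restrict f A' \<in> colourings A' K (?\<alpha> (f y))"
      using f counts by (auto simp: colourings_def A cong: conj_cong)
    then show "(f y, restrict f A') \<in> Sigma {..<K} (\<lambda>k. colourings A' K (?\<alpha> k))"
      using K by simp
    have "fixes_col A' g (restrict f A') = fixes_col A' g f"
      using gA' by (auto simp: fixes_col_def)
    then show "(case (f y, restrict f A') of (k, f') \<Rightarrow> (\<alpha> k - 2) * ?F f')
        = ?F f * int (card {i \<in> A'. f i = f y})"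
      using counts[OF K] by simp
  next
    fix p assume "p \<in> Sigma {..<K} (\<lambda>k. colourings A' K (?\<alpha> k))"
    then obtain k f' where p: "p = (k, f')" "k < K" "f' \<in> colourings A' K (?\<alpha> k)" by auto
    let ?f = "f'(x := k, y := k)"
    show "((case p of (k, f') \<Rightarrow> f'(x := k, y := k)) y,
        restrict (case p of (k, f') \<Rightarrow> f'(x := k, y := k)) A') = p"
      using p xy by (auto simp: fun_eq_iff colourings_def PiE_iff extensional_def restrict_def)
    have "{z \<in> A'. ?f z = i} = {z \<in> A'. f' z = i}" for i using xy by auto
    then have "int (card {z \<in> A. ?f z = i}) = \<alpha> i" if "i < K" for i
      using p that count[of ?f i] by (auto simp: colourings_def)
    moreover have "?f \<in> A \<rightarrow>\<^sub>E {..<K}"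
      using p by (auto simp: colourings_def PiE_iff extensional_def A)
    ultimately show "(case p of (k, f') \<Rightarrow> f'(x := k, y := k)) \<in> ?C"
      by (simp add: p colourings_def)
  qed
  also have "\<dots> = (\<Sum>k<K. \<Sum>f'\<in>colourings A' K (?\<alpha> k). (\<alpha> k - 2) * ?F f')"
    using A' by (intro sum.Sigma[symmetric]) auto
  finally show ?thesis
    unfolding psi_def sum_distrib_left .
qed

text \<open>In terms of the Vandermonde determinant \<open>\<Delta>\<close> in the variables \<open>x\<^sub>k\<close> this reads
  \<open>(\<Sum>k. x\<^sub>k\<^sup>-\<^sup>1 \<partial>\<Delta>/\<partial>x\<^sub>k) = - (\<Sum>i<j. x\<^sub>i\<^sup>-\<^sup>1 x\<^sub>j\<^sup>-\<^sup>1) \<Delta>\<close>. On both sides all terms with two equal exponents cancel,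
  which leaves those with exponents \<open>0, -1, 2, 3, \<dots>\<close>.\<close>

lemma vandermonde_identity:
  fixes N :: "(nat \<Rightarrow> int) \<Rightarrow> int"
  shows "(\<Sum>w | w permutes {..<K}. sign w *
      (\<Sum>k<K. int (w k) * N (\<lambda>i. int (w i) - (if i = k then 2 else 0))))
    = - (\<Sum>w | w permutes {..<K}. sign w *
      (\<Sum>P | P \<subseteq> {..<K} \<and> card P = 2. N (\<lambda>i. int (w i) - of_bool (i \<in> P))))"
    (is "?L = - ?R")
proof -
  let ?W = "{w. w permutes {..<K}}"
  let ?P = "{P. P \<subseteq> {..<K} \<and> card P = 2}"
  define S where "S c = (\<Sum>w\<in>?W. sign w * N (\<lambda>i. c (w i)))" for c
  let ?two = "\<lambda>a i. int i - (if i = a then 2 else 0)"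
  let ?one = "\<lambda>P i. int i - of_bool (i \<in> P)"
  have swap: "S (c \<circ> transpose a b) = - S c" if "a < K" "b < K" "a \<noteq> b" for c a b
  proof -
    have t: "transpose a b permutes {..<K}" using that by (intro permutes_swap_id) auto
    have perm: "permutation p" if "p permutes {..<K}" for p
      using that permutes_imp_permutation by blast
    have "S (c \<circ> transpose a b) = (\<Sum>w\<in>?W. sign (transpose a b \<circ> w)
        * N (\<lambda>i. (c \<circ> transpose a b) ((transpose a b \<circ> w) i)))"
      unfolding S_def by (rule setum_permutations_compose_left[OF t])
    also have "\<dots> = - S c"
      unfolding S_def sum_negf[symmetric] using that t perm
      by (intro sum.cong refl) (simp add: sign_compose sign_swap_id)
    finally show ?thesis .
  qed
  have coll: "S c = 0" if "a < K" "b < K" "a \<noteq> b" "c a = c b" for c a b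
  proof -
    have "c \<circ> transpose a b = c" using that by (auto simp: fun_eq_iff transpose_def)
    then show ?thesis using swap[OF that(1-3), of c] by simp
  qed
  \<comment> \<open>The lowered position \<open>k\<close> is replaced by the lowered exponent
    \<open>a = w k\<close>, so that the shift no longer depends on \<open>w\<close>.\<close>
  have "?L = (\<Sum>w\<in>?W. \<Sum>a<K. int a * (sign w * N (\<lambda>i. ?two a (w i))))"
  proof (intro sum.cong refl)
    fix w assume "w \<in> ?W"
    then have w: "w permutes {..<K}" by simp
    have "(\<Sum>k<K. int (w k) * N (\<lambda>i. int (w i) - (if i = k then 2 else 0)))
        = (\<Sum>k<K. int (w k) * N (\<lambda>i. ?two (w k) (w i)))"
      using injD[OF permutes_inj[OF w]]
      by (intro sum.cong refl arg_cong2[of _ _ _ _ "(*)"] arg_cong[of _ _ N]) (auto simp: fun_eq_iff)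
    also have "\<dots> = (\<Sum>a<K. int a * N (\<lambda>i. ?two a (w i)))"
      by (rule sum.reindex_bij_betw[OF permutes_imp_bij[OF w]])
    finally show "sign w * (\<Sum>k<K. int (w k) * N (\<lambda>i. int (w i) - (if i = k then 2 else 0)))
        = (\<Sum>a<K. int a * (sign w * N (\<lambda>i. ?two a (w i))))"
      by (simp add: sum_distrib_left mult.left_commute)
  qed
  also have "\<dots> = (\<Sum>a<K. int a * S (?two a))"
    unfolding S_def sum_distrib_left by (rule sum.swap)
  \<comment> \<open>The factor \<open>int a\<close> removes \<open>a = 0\<close>. For
    \<open>a \<ge> 2\<close> the lowered exponent equals the untouched exponent
    \<open>a - 2\<close>.\<close>
  also have "\<dots> = (\<Sum>a<K. if a = 1 then S (?two 1) else 0)"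
  proof (rule sum.cong[OF refl])
    fix a assume "a \<in> {..<K}"
    moreover have "S (?two a) = 0" if "2 \<le> a" "a < K"
      using coll[of a "a - 2" "?two a"] that by (auto simp: of_nat_diff)
    ultimately show "int a * S (?two a) = (if a = 1 then S (?two 1) else 0)"
      by (cases "a = 0 \<or> a = 1") auto
  qed
  finally have L: "?L = (if 1 < K then S (?two 1) else 0)" by simp
  have "?R = (\<Sum>w\<in>?W. \<Sum>P\<in>?P. sign w * N (\<lambda>i. ?one P (w i)))"
  proof (intro sum.cong refl)
    fix w assume "w \<in> ?W"
    then have w: "w permutes {..<K}" by simp
    have inj: "inj w" by (rule permutes_inj[OF w])
    have "bij_betw ((`) w) ?P ?P"
    proof (rule bij_betw_byWitness[of _ "(`) (inv w)"])
      show "(`) w ` ?P \<subseteq> ?P"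
        using permutes_in_image[OF w] by (auto simp: card_image inj_on_subset[OF inj])
      show "(`) (inv w) ` ?P \<subseteq> ?P"
        using permutes_in_image[OF permutes_inv[OF w]]
        by (auto simp: card_image inj_on_subset[OF permutes_inj[OF permutes_inv[OF w]]])
    qed (use w in \<open>auto simp: image_image permutes_inverses\<close>)
    then have "(\<Sum>P\<in>?P. N (\<lambda>i. ?one (w ` P) (w i))) = (\<Sum>P\<in>?P. N (\<lambda>i. ?one P (w i)))"
      by (rule sum.reindex_bij_betw)
    then show "sign w * (\<Sum>P\<in>?P. N (\<lambda>i. int (w i) - of_bool (i \<in> P)))
        = (\<Sum>P\<in>?P. sign w * N (\<lambda>i. ?one P (w i)))"
      by (simp add: inj_image_mem_iff[OF inj] flip: sum_distrib_left)
  qed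
  also have "\<dots> = (\<Sum>P\<in>?P. S (?one P))"
    unfolding S_def by (rule sum.swap)
  \<comment> \<open>Let \<open>P = {a, b}\<close> with \<open>a < b\<close> differ from
    \<open>{0, 1}\<close>. Either \<open>b - 1\<close> is outside \<open>P\<close> and equals the
    lowered \<open>b\<close>, or \<open>a = b - 1\<close> is positive and \<open>a - 1\<close>
    equals the lowered \<open>a\<close>.\<close>
  also have "\<dots> = (\<Sum>P\<in>?P. if P = {0, 1} then S (?one {0, 1}) else 0)"
  proof (rule sum.cong[OF refl])
    fix P assume P: "P \<in> ?P"
    show "S (?one P) = (if P = {0, 1} then S (?one {0, 1}) else 0)"
    proof (cases "P = {0, 1}")
      case False
      obtain a b where ab: "P = {a, b}" "a < b"
        using P by (auto simp: card_2_iff) (metis insert_commute linorder_neqE_nat)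
      have "b < K" using P ab by auto
      show ?thesis
      proof (cases "b = Suc a")
        case True
        then have "a \<noteq> 0" using False ab by auto
        then show ?thesis
          using False coll[of a "a - 1" "?one P"] ab \<open>b < K\<close> by (auto simp: of_nat_diff)
      next
        case False
        then show ?thesis
          using \<open>P \<noteq> {0, 1}\<close> coll[of b "b - 1" "?one P"] ab \<open>b < K\<close> by (auto simp: of_nat_diff)
      qed
    qed simp
  qed
  also have "\<dots> = (if {0, 1} \<in> ?P then S (?one {0, 1}) else 0)"
    by (rule sum.delta) (rule finite_subset[of _ "Pow {..<K}"], auto)
  also have "\<dots> = (if 1 < K then - S (?two 1) else 0)"
  proof (cases "1 < K")
    case True
    \<comment> \<open>The exponents 0 and 1 become -1 and 0 here, but 0 and -1 in
      \<open>?two 1\<close>; this one swap is the sign in the identity.\<close>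
    have "?one {0, 1} = ?two 1 \<circ> transpose 0 1" by (auto simp: fun_eq_iff transpose_def)
    then show ?thesis using True swap[of 0 1 "?two 1"] by auto
  qed auto
  finally show ?thesis using L by simp
qed

text \<open>With \<open>\<alpha> = v + w\<close> the weight \<open>\<alpha> k - 2\<close> splits
  into \<open>v k - 2\<close>, constant in \<open>w\<close>, and \<open>w k\<close>. The Vandermonde
  identity absorbs the latter, with \<open>N u\<close> the value of \<open>psi\<close> at
  \<open>v + u\<close>.\<close>

lemma sum_Phi_three_cycles:
  assumes A': "finite A'" and A: "A = insert x (insert y A')" and xy: "x \<noteq> y" "x \<notin> A'" "y \<notin> A'"
    and g: "g permutes A" "g x = x" "g y = y"
  shows "(\<Sum>i\<in>A'. Phi A K v (g \<circ> cycle_of_list [i, x, y]))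
    = (\<Sum>k<K. (v k - 2) * Phi A' K (\<lambda>i. v i - (if i = k then 2 else 0)) g)
      - (\<Sum>P | P \<subseteq> {..<K} \<and> card P = 2. Phi A' K (\<lambda>i. v i - of_bool (i \<in> P)) g)"
proof -
  let ?W = "{w. w permutes {..<K}}"
  let ?N = "\<lambda>u. psi A' K (\<lambda>i. v i + u i) g"
  let ?two = "\<lambda>w k i. int (w i) - (if i = k then 2 else 0)"
  have "(\<Sum>i\<in>A'. Phi A K v (g \<circ> cycle_of_list [i, x, y]))
      = (\<Sum>w\<in>?W. \<Sum>i\<in>A'. sign w * psi A K (\<lambda>j. v j + int (w j)) (g \<circ> cycle_of_list [i, x, y]))"
    unfolding Phi_def altsum_def by (rule sum.swap)
  also have "\<dots> = (\<Sum>w\<in>?W. sign w * (\<Sum>k<K. (v k + int (w k) - 2) * ?N (?two w k)))"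
    by (simp add: sum_psi_three_cycles[OF A' A xy g] add_diff_eq flip: sum_distrib_left
        del: cycle_of_list.simps)
  also have "\<dots> = (\<Sum>w\<in>?W. \<Sum>k<K. (v k - 2) * (sign w * ?N (?two w k)))
      + (\<Sum>w\<in>?W. sign w * (\<Sum>k<K. int (w k) * ?N (?two w k)))"
    by (simp add: sum_distrib_left algebra_simps flip: sum.distrib)
  also have "(\<Sum>w\<in>?W. \<Sum>k<K. (v k - 2) * (sign w * ?N (?two w k)))
      = (\<Sum>k<K. (v k - 2) * Phi A' K (\<lambda>i. v i - (if i = k then 2 else 0)) g)"
    unfolding Phi_def altsum_def sum_distrib_left
    by (subst sum.swap) (simp add: algebra_simps)
  also have "(\<Sum>w\<in>?W. sign w * (\<Sum>k<K. int (w k) * ?N (?two w k)))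
      = - (\<Sum>w\<in>?W. sign w * (\<Sum>P | P \<subseteq> {..<K} \<and> card P = 2. ?N (\<lambda>i. int (w i) - of_bool (i \<in> P))))"
    by (rule vandermonde_identity)
  also have "(\<Sum>w\<in>?W. sign w * (\<Sum>P | P \<subseteq> {..<K} \<and> card P = 2. ?N (\<lambda>i. int (w i) - of_bool (i \<in> P))))
      = (\<Sum>P | P \<subseteq> {..<K} \<and> card P = 2. Phi A' K (\<lambda>i. v i - of_bool (i \<in> P)) g)"
    unfolding Phi_def altsum_def sum_distrib_left
    by (subst sum.swap) (simp add: algebra_simps)
  finally show ?thesis by (simp only: diff_conv_add_uminus)
qed

section \<open>Removing two cells from a Ferrers diagram\<close>

text \<open>Padding with zeros lets partitions of different lengths share one number of rows
  \<open>K\<close>.\<close>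

definition part :: "nat list \<Rightarrow> nat \<Rightarrow> nat" where
  "part lam i = (if i < length lam then lam ! i else 0)"

lemma mem_ferrers: "(a, b) \<in> ferrers lam \<longleftrightarrow> 1 \<le> a \<and> 1 \<le> b \<and> b \<le> part lam (a - 1)"
  by (auto simp: ferrers_def part_def)

lemma part_antimono:
  assumes "partition_of n lam" "i \<le> j"
  shows "part lam j \<le> part lam i"
  using assms sorted_wrt_nth_less[of "(\<ge>)" lam i j]
  by (cases "i = j") (auto simp: partition_of_def part_def)

lemma part_pos: "partition_of n lam \<Longrightarrow> i < length lam \<Longrightarrow> 0 < part lam i"
  by (auto simp: partition_of_def part_def) (metis gr0I nth_mem)

lemma partition_of_eqI:
  assumes "partition_of n lam" "partition_of m mu" "\<And>i. part lam i = part mu i"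
  shows "lam = mu"
proof (rule nth_equalityI)
  have "i < length lam \<longleftrightarrow> i < length mu" for i
    using part_pos[OF assms(1), of i] part_pos[OF assms(2), of i] assms(3)[of i]
    by (auto simp: part_def split: if_splits)
  then show len: "length lam = length mu" by (meson linorder_neqE_nat order_less_irrefl)
  show "lam ! i = mu ! i" if "i < length lam" for i
    using assms(3)[of i] that len by (simp add: part_def)
qed

lemma part_eq_of_ferrers:
  assumes "ferrers lam = ferrers mu"
  shows "part lam i = part mu i"
proof -
  have "{b. (Suc i, b) \<in> ferrers lam} = {1..part lam i}" for lam
    by (auto simp: mem_ferrers)
  then have "{1..part lam i} = {1..part mu i}" using assms by metis
  then show ?thesis by (metis card_atLeastAtMost diff_Suc_1 One_nat_def)
qed

lemma sum_list_eq_sum_part: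
  assumes "length lam \<le> K"
  shows "sum_list lam = (\<Sum>i<K. part lam i)"
proof -
  have "sum_list lam = (\<Sum>i<length lam. part lam i)"
    by (simp add: sum_list_sum_nth part_def atLeast0LessThan)
  also have "\<dots> = (\<Sum>i<K. part lam i)"
    by (rule sum.mono_neutral_left) (use assms in \<open>auto simp: part_def\<close>)
  finally show ?thesis .
qed

lemma ferrers_snoc:
  "ferrers (lam @ [m]) = ferrers lam \<union> (\<lambda>j. (Suc (length lam), j)) ` {1..m}"
  by (auto simp: ferrers_def nth_append less_Suc_eq_le le_Suc_eq One_nat_def Suc_le_eq split: if_splits)

section \<open>The canonical tableau as a filling\<close>

lemma bij_betw_tableau: "bij_betw (tableau lam) (ferrers lam) {1..sum_list lam}"
proof (induction lam rule: rev_induct)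
  case Nil
  have "ferrers [] = {}" by (auto simp: ferrers_def)
  then show ?case by (simp add: bij_betw_def)
next
  case (snoc m lam)
  let ?R = "(\<lambda>j. (Suc (length lam), j)) ` {1..m}"
  have "tableau (lam @ [m]) x = tableau lam x" if "x \<in> ferrers lam" for x
    using that by (auto simp: tableau_def ferrers_def)
  then have 1: "bij_betw (tableau (lam @ [m])) (ferrers lam) {1..sum_list lam}"
    using snoc bij_betw_cong[of "ferrers lam" "tableau (lam @ [m])" "tableau lam"] by blast
  have 2: "bij_betw (tableau (lam @ [m])) ?R {sum_list lam + 1..sum_list lam + m}"
  proof (rule bij_betw_imageI)
    show "inj_on (tableau (lam @ [m])) ?R" by (auto simp: inj_on_def tableau_def)
    have "tableau (lam @ [m]) ` ?R = (+) (sum_list lam) ` {1..m}"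
      unfolding image_image by (intro image_cong refl) (simp add: tableau_def)
    then show "tableau (lam @ [m]) ` ?R = {sum_list lam + 1..sum_list lam + m}"
      by (simp add: add.commute)
  qed
  have "{1..sum_list lam} \<union> {sum_list lam + 1..sum_list lam + m} = {1..sum_list (lam @ [m])}"
    by auto
  then show ?case
    using bij_betw_combine[OF 1 2] by (simp add: ferrers_snoc)
qed

lemma preserves_level_sets_iff:
  assumes p: "p permutes A"
  shows "(\<forall>i. p ` {a \<in> A. \<rho> a = i} = {a \<in> A. \<rho> a = i}) \<longleftrightarrow> (\<forall>a\<in>A. \<rho> (p a) = \<rho> a)"
proof
  assume "\<forall>i. p ` {a \<in> A. \<rho> a = i} = {a \<in> A. \<rho> a = i}"
  then show "\<forall>a\<in>A. \<rho> (p a) = \<rho> a" by blast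
next
  assume *: "\<forall>a\<in>A. \<rho> (p a) = \<rho> a"
  show "\<forall>i. p ` {a \<in> A. \<rho> a = i} = {a \<in> A. \<rho> a = i}"
  proof (intro allI equalityI subsetI)
    fix i a assume a: "a \<in> {a \<in> A. \<rho> a = i}"
    then obtain a' where "a' \<in> A" "a = p a'" using permutes_image[OF p] by blast
    then show "a \<in> p ` {a \<in> A. \<rho> a = i}" using a * by auto
  qed (use * permutes_in_image[OF p] in auto)
qed

text \<open>Rows are shifted to start at 0, as the colours and \<open>column_top\<close> require;
  columns serve as labels and keep their numbers.\<close>

definition row_of :: "nat list \<Rightarrow> nat \<Rightarrow> nat" where
  "row_of lam a = fst (inv_into (ferrers lam) (tableau lam) a) - 1"

definition col_of :: "nat list \<Rightarrow> nat \<Rightarrow> nat" where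
  "col_of lam a = snd (inv_into (ferrers lam) (tableau lam) a)"

lemma
  assumes "(i, j) \<in> ferrers lam"
  shows row_of_tableau: "Suc (row_of lam (tableau lam (i, j))) = i"
    and col_of_tableau: "col_of lam (tableau lam (i, j)) = j"
  using assms bij_betw_inv_into_left[OF bij_betw_tableau assms]
  by (auto simp: row_of_def col_of_def mem_ferrers)

lemma tableau_cell:
  assumes "a \<in> {1..sum_list lam}"
  obtains i j where "(i, j) \<in> ferrers lam" "a = tableau lam (i, j)"
  using assms bij_betw_imp_surj_on[OF bij_betw_tableau, of lam] by fastforce

lemma tableau_mem: "x \<in> ferrers lam \<Longrightarrow> tableau lam x \<in> {1..sum_list lam}"
  using bij_betw_tableau[of lam] by (rule bij_betwE[rule_format])

lemma
  assumes "a \<in> {1..sum_list lam}"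
  shows cell_in_ferrers: "(Suc (row_of lam a), col_of lam a) \<in> ferrers lam"
    and tableau_row_col: "tableau lam (Suc (row_of lam a), col_of lam a) = a"
proof -
  obtain i j where c: "(i, j) \<in> ferrers lam" "a = tableau lam (i, j)"
    using assms by (rule tableau_cell)
  have "Suc (row_of lam a) = i" "col_of lam a = j"
    unfolding c(2) by (rule row_of_tableau[OF c(1)], rule col_of_tableau[OF c(1)])
  then show "(Suc (row_of lam a), col_of lam a) \<in> ferrers lam"
    "tableau lam (Suc (row_of lam a), col_of lam a) = a"
    using c by simp_all
qed

lemma filling_tableau:
  assumes "partition_of n lam"
  shows "filling n (row_of lam) (col_of lam)"
proof
  have n: "{1..n} = {1..sum_list lam}" using assms by (simp add: partition_of_def)
  show "x = y" if "x \<in> {1..n}" "y \<in> {1..n}" "row_of lam x = row_of lam y" "col_of lam x = col_of lam y" for x y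
  proof -
    have "x = tableau lam (Suc (row_of lam x), col_of lam x)"
      using that(1) unfolding n by (rule tableau_row_col[symmetric])
    also have "\<dots> = tableau lam (Suc (row_of lam y), col_of lam y)"
      by (simp only: that(3,4))
    also have "\<dots> = y"
      using that(2) unfolding n by (rule tableau_row_col)
    finally show ?thesis .
  qed
  show "\<exists>y\<in>{1..n}. row_of lam y = k \<and> col_of lam y = col_of lam x"
    if x: "x \<in> {1..n}" and k: "k \<le> row_of lam x" for x k
  proof -
    define j where "j = col_of lam x"
    have "(Suc (row_of lam x), j) \<in> ferrers lam"
      using cell_in_ferrers[of x lam] x unfolding n j_def by blast
    then have c: "(Suc k, j) \<in> ferrers lam"
      using k part_antimono[OF assms, of k "row_of lam x"] by (simp add: mem_ferrers)
    have "Suc (row_of lam (tableau lam (Suc k, j))) = Suc k" by (rule row_of_tableau[OF c])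
    moreover have "col_of lam (tableau lam (Suc k, j)) = j" by (rule col_of_tableau[OF c])
    moreover have "tableau lam (Suc k, j) \<in> {1..n}" unfolding n by (rule tableau_mem[OF c])
    ultimately show ?thesis
      unfolding j_def by (intro bexI[of _ "tableau lam (Suc k, col_of lam x)"] conjI) simp_all
  qed
qed

lemma card_row_of:
  assumes "sum_list lam = n"
  shows "card {x \<in> {1..n}. row_of lam x = i} = part lam i"
proof -
  have A: "row_of lam (tableau lam (Suc i, j)) = i" "col_of lam (tableau lam (Suc i, j)) = j"
    "tableau lam (Suc i, j) \<in> {1..n}" if "j \<in> {1..part lam i}" for j
  proof -
    have c: "(Suc i, j) \<in> ferrers lam" using that by (simp add: mem_ferrers)
    from row_of_tableau[OF c] col_of_tableau[OF c] tableau_mem[OF c]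
    show "row_of lam (tableau lam (Suc i, j)) = i" "col_of lam (tableau lam (Suc i, j)) = j"
      "tableau lam (Suc i, j) \<in> {1..n}"
      unfolding assms by blast+
  qed
  have B: "col_of lam x \<in> {1..part lam i}" "tableau lam (Suc i, col_of lam x) = x"
    if "x \<in> {x \<in> {1..n}. row_of lam x = i}" for x
  proof -
    have x: "x \<in> {1..sum_list lam}" and r: "row_of lam x = i" using that assms by blast+
    show "col_of lam x \<in> {1..part lam i}"
      using cell_in_ferrers[OF x] unfolding r by (simp add: mem_ferrers)
    show "tableau lam (Suc i, col_of lam x) = x"
      using tableau_row_col[OF x] unfolding r .
  qed
  have "bij_betw (col_of lam) {x \<in> {1..n}. row_of lam x = i} {1..part lam i}"
  proof (rule bij_betw_byWitness[of _ "\<lambda>j. tableau lam (Suc i, j)"])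
    show "(\<lambda>j. tableau lam (Suc i, j)) ` {1..part lam i} \<subseteq> {x \<in> {1..n}. row_of lam x = i}"
      using A by blast
  qed (use A B in blast)+
  then show ?thesis by (simp add: bij_betw_same_card)
qed

lemma tableau_level_set:
  assumes "\<And>i j. (i, j) \<in> ferrers lam \<Longrightarrow> \<rho> (tableau lam (i, j)) = \<rho>' (i, j)"
  shows "tableau lam ` {x \<in> ferrers lam. \<rho>' x = k} = {a \<in> {1..sum_list lam}. \<rho> a = k}"
proof -
  have "\<rho> (tableau lam x) = \<rho>' x" if "x \<in> ferrers lam" for x
    using assms[of "fst x" "snd x"] that by simp
  then have "tableau lam ` {x \<in> ferrers lam. \<rho>' x = k} = {a \<in> tableau lam ` ferrers lam. \<rho> a = k}"
    by auto
  also have "tableau lam ` ferrers lam = {1..sum_list lam}"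
    by (rule bij_betw_imp_surj_on[OF bij_betw_tableau])
  finally show ?thesis .
qed

text \<open>\<open>K\<close> may exceed the length: removing cells can empty rows, while the
  alternating sum keeps the number of rows of the original partition.\<close>

lemma character_eq_Phi:
  assumes lam: "partition_of n lam" and K: "length lam \<le> K" and g: "g permutes {1..n}"
  shows "character lam g = of_int (Phi {1..n} K (\<lambda>i. int (part lam i) - int i) g)"
proof -
  have n: "sum_list lam = n" using lam by (simp add: partition_of_def)
  interpret filling n "row_of lam" "col_of lam" by (rule filling_tableau[OF lam])
  have rows: "tableau lam ` {x \<in> ferrers lam. fst x = k} = {a \<in> {1..n}. Suc (row_of lam a) = k}" for k
    using tableau_level_set[of lam "\<lambda>a. Suc (row_of lam a)" fst] row_of_tableau n by simp
  have cols: "tableau lam ` {x \<in> ferrers lam. snd x = k} = {a \<in> {1..n}. col_of lam a = k}" for k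
    using tableau_level_set[of lam "col_of lam" snd] col_of_tableau n by simp
  have R: "row_group lam = R"
    unfolding row_group_def R_def n rows
    using preserves_level_sets_iff[of _ "{1..n}" "\<lambda>a. Suc (row_of lam a)"]
    by (intro Collect_cong) (simp cong: conj_cong)
  have C: "column_group lam = C"
    unfolding column_group_def C_def n cols
    using preserves_level_sets_iff[of _ "{1..n}" "col_of lam"]
    by (intro Collect_cong) (simp cong: conj_cong)
  have "(\<Sum>p\<in>R. galg_basis p) = a"
  proof
    fix x
    show "(\<Sum>p\<in>R. galg_basis p) x = a x"
      using finite_R by (simp add: sum_fun_apply galg_basis_def a_def)
  qed
  moreover have "(\<Sum>q\<in>C. galg_scale (of_int (sign q)) (galg_basis q)) = b"
  proof
    fix x
    have "(\<Sum>q\<in>C. galg_scale (of_int (sign q)) (galg_basis q)) x = (\<Sum>q\<in>C. if q = x then of_int (sign x) else 0)"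
      unfolding sum_fun_apply galg_scale_def galg_basis_def by (intro sum.cong refl) auto
    then show "(\<Sum>q\<in>C. galg_scale (of_int (sign q)) (galg_basis q)) x = b x"
      using finite_C by (simp add: b_def)
  qed
  ultimately have "young_symmetrizer lam = e"
    by (simp add: young_symmetrizer_def R C n e_def)
  then have "character lam g = chi g"
    by (simp add: character_def specht_module_def chi_def n)
  also have "\<dots> = of_int (Phi {1..n} K (\<lambda>i. int (part lam i) - int i) g)"
  proof (rule chi_eq_Phi[OF _ _ _ g])
    fix x assume "x \<in> {1..n}"
    then have "(Suc (row_of lam x), col_of lam x) \<in> ferrers lam"
      unfolding n[symmetric] by (rule cell_in_ferrers)
    then show "row_of lam x < K"
      using K by (auto simp: ferrers_def)
  next
    show "strictly_decreasing K (\<lambda>i. int (part lam i) - int i)"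
      unfolding strictly_decreasing_def
    proof (intro allI impI)
      fix i
      show "int (part lam (Suc i)) - int (Suc i) < int (part lam i) - int i"
        using part_antimono[OF lam, of i "Suc i"] by simp
    qed
  qed (simp only: card_row_of[OF n])
  finally show ?thesis .
qed

text \<open>Undoes the padding: for weakly decreasing \<open>m\<close> the positive entries form an
  initial segment, so their number is the length.\<close>

definition partition_list :: "nat \<Rightarrow> (nat \<Rightarrow> nat) \<Rightarrow> nat list" where
  "partition_list K m = map m [0..<card {i. i < K \<and> 0 < m i}]"

lemma
  assumes dec: "\<And>i. Suc i < K \<Longrightarrow> m (Suc i) \<le> m i"
  shows part_partition_list: "i < K \<Longrightarrow> part (partition_list K m) i = m i"
    and length_partition_list: "length (partition_list K m) \<le> K"
    and partition_of_partition_list: "partition_of (\<Sum>i<K. m i) (partition_list K m)"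
proof -
  define L where "L = card {i. i < K \<and> 0 < m i}"
  have anti: "m j \<le> m i" if "i \<le> j" "j < K" for i j
    using that
  proof (induction j rule: dec_induct)
    case (step j)
    then show ?case using dec[of j] by simp
  qed simp
  have "\<exists>l\<le>K. {i. i < K \<and> 0 < m i} = {..<l}"
  proof (cases "\<exists>i<K. m i = 0")
    case True
    define l where "l = (LEAST i. i < K \<and> m i = 0)"
    have l: "l < K" "m l = 0" using LeastI_ex[OF True] unfolding l_def by auto
    have below: "0 < m i" if "i < l" for i
      using not_less_Least[of i "\<lambda>i. i < K \<and> m i = 0"] that l(1) unfolding l_def by auto
    have "{i. i < K \<and> 0 < m i} = {..<l}"
    proof (intro equalityI subsetI)
      fix i assume i: "i \<in> {i. i < K \<and> 0 < m i}"
      then show "i \<in> {..<l}" using anti[of l i] l by (cases "l \<le> i") simp_all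
    qed (use below l in auto)
    then show ?thesis using l(1) by (intro exI[of _ l]) auto
  qed (auto intro: exI[of _ K])
  then obtain l where l: "l \<le> K" "{i. i < K \<and> 0 < m i} = {..<l}" by blast
  then have "L = l" by (simp add: L_def)
  have L: "L \<le> K" "\<And>i. i < K \<Longrightarrow> 0 < m i \<longleftrightarrow> i < L"
    using l(1) eqset_imp_iff[OF l(2)] unfolding \<open>L = l\<close> by auto
  show part: "part (partition_list K m) i = m i" if "i < K" for i
    using L(2)[OF that] by (auto simp: part_def partition_list_def simp flip: L_def)
  show len: "length (partition_list K m) \<le> K"
    using L(1) by (simp add: partition_list_def flip: L_def)
  have "sum_list (partition_list K m) = (\<Sum>i<K. m i)"
    unfolding sum_list_eq_sum_part[OF len] by (intro sum.cong refl) (simp add: part)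
  moreover have "sorted_wrt (\<ge>) (partition_list K m)"
    using anti L(1) by (auto simp: sorted_wrt_iff_nth_less partition_list_def simp flip: L_def)
  moreover have "m i \<noteq> 0" if "i < L" for i
    using L that by simp
  then have "0 \<notin> set (partition_list K m)"
    by (simp add: partition_list_def image_iff flip: L_def)
  ultimately show "partition_of (\<Sum>i<K. m i) (partition_list K m)"
    by (simp add: partition_of_def)
qed

lemma sum_eq_2_cases:
  fixes d :: "nat \<Rightarrow> nat"
  assumes "(\<Sum>i<K. d i) = 2"
  obtains i j where "i \<le> j" "j < K" "\<And>k. k < K \<Longrightarrow> d k = of_bool (k = i) + of_bool (k = j)"
proof -
  have "\<exists>i<K. 0 < d i"
    using assms by (metis gr0I lessThan_iff sum.neutral zero_neq_numeral)
  then obtain i where i: "i < K" "0 < d i" by blast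
  define d' where "d' k = d k - of_bool (k = i)" for k
  have d: "d k = d' k + of_bool (k = i)" for k using i(2) by (auto simp: d'_def)
  have s1: "(\<Sum>k<K. d' k) = 1"
    using assms i(1) by (simp add: d sum.distrib)
  then have "\<exists>j<K. 0 < d' j"
    by (metis gr0I lessThan_iff sum.neutral zero_neq_one)
  then obtain j where j: "j < K" "0 < d' j" by blast
  have "(\<Sum>k<K. d' k) = d' j + (\<Sum>k\<in>{..<K} - {j}. d' k)"
    using j(1) by (intro sum.remove) auto
  then have j1: "d' j = 1" and rest: "(\<Sum>k\<in>{..<K} - {j}. d' k) = 0"
    using s1 j(2) by linarith+
  have "d' k = of_bool (k = j)" if "k < K" for k
    using j1 rest that by (cases "k = j") auto
  then have *: "d k = of_bool (k = i) + of_bool (k = j)" if "k < K" for k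
    using d that by simp
  show thesis
  proof (cases "i \<le> j")
    case True
    then show ?thesis using that[of i j] j(1) * by blast
  next
    case False
    then show ?thesis using that[of j i] i(1) * by (simp add: add.commute)
  qed
qed

lemma card_col_diff:
  assumes "finite I"
  shows "card (SIGMA i:I. {l i<..u i}) = (\<Sum>i\<in>I. u i - l i :: nat)"
  using assms by (subst card_SigmaI) auto

lemma part_bound: "l < b \<Longrightarrow> b \<le> part lam k \<Longrightarrow> k < length lam"
  by (auto simp: part_def split: if_splits)

section \<open>Removable pairs indexed by the rows that lose a cell\<close>

locale removal =
  fixes n :: nat and lam :: "nat list"
  assumes lam: "partition_of n lam"
begin

abbreviation K where "K \<equiv> length lam"

text \<open>\<open>q = (i, j)\<close> with \<open>i \<le> j\<close> names the rows, counted from 0,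
  that lose a cell; \<open>i = j\<close> takes two cells from one row.\<close>

definition mult :: "nat \<times> nat \<Rightarrow> nat \<Rightarrow> nat" where
  "mult q k = of_bool (k = fst q) + of_bool (k = snd q)"

definition reduced :: "nat \<times> nat \<Rightarrow> nat \<Rightarrow> nat" where
  "reduced q k = part lam k - mult q k"

text \<open>The bound on \<open>mult\<close> keeps the truncated subtraction in
  \<open>reduced\<close> exact.\<close>

definition good :: "(nat \<times> nat) set" where
  "good = {q. fst q \<le> snd q \<and> snd q < K \<and> (\<forall>k. mult q k \<le> part lam k)
    \<and> (\<forall>k. Suc k < K \<longrightarrow> reduced q (Suc k) \<le> reduced q k)}"

definition cells :: "nat \<times> nat \<Rightarrow> (nat \<times> nat) set" where
  "cells q = {(a, b). 1 \<le> a \<and> reduced q (a - 1) < b \<and> b \<le> part lam (a - 1)}"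

lemma n_eq: "n = (\<Sum>k<K. part lam k)"
  using lam sum_list_eq_sum_part[of lam K] by (simp add: partition_of_def)

lemma sum_mult: "q \<in> good \<Longrightarrow> (\<Sum>k<K. mult q k) = 2"
  by (simp add: mult_def good_def sum.distrib)

lemma good_mult_le: "q \<in> good \<Longrightarrow> mult q k \<le> part lam k"
  by (simp add: good_def)

lemma sum_reduced:
  assumes "q \<in> good" shows "(\<Sum>k<K. reduced q k) = n - 2"
proof -
  have "(\<Sum>k<K. reduced q k) = (\<Sum>k<K. part lam k) - (\<Sum>k<K. mult q k)"
    unfolding reduced_def by (rule sum_subtractf_nat) (use assms in \<open>auto simp: good_def\<close>)
  then show ?thesis using sum_mult[OF assms] n_eq by simp
qed

definition red_list :: "nat \<times> nat \<Rightarrow> nat list" where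
  "red_list q = partition_list K (reduced q)"

lemma
  assumes "q \<in> good"
  shows part_red_list: "part (red_list q) k = reduced q k"
    and length_red_list: "length (red_list q) \<le> K"
    and partition_red_list: "partition_of (n - 2) (red_list q)"
proof -
  have dec: "\<And>i. Suc i < K \<Longrightarrow> reduced q (Suc i) \<le> reduced q i" using assms by (simp add: good_def)
  show len: "length (red_list q) \<le> K"
    unfolding red_list_def by (rule length_partition_list[of K "reduced q", OF dec])
  show "part (red_list q) k = reduced q k"
  proof (cases "k < K")
    case True
    then show ?thesis unfolding red_list_def by (intro part_partition_list[of K "reduced q"] dec)
  next
    case False
    then show ?thesis using len by (simp add: part_def reduced_def)
  qed
  show "partition_of (n - 2) (red_list q)"
    unfolding red_list_def sum_reduced[OF assms, symmetric] by (rule partition_of_partition_list[of K "reduced q", OF dec])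
qed

lemma cells_eq: "q \<in> good \<Longrightarrow> cells q = ferrers lam - ferrers (red_list q)"
  by (auto simp: cells_def mem_ferrers part_red_list)

lemma ferrers_red_list: "q \<in> good \<Longrightarrow> ferrers (red_list q) = ferrers lam - cells q"
  by (auto simp: cells_def mem_ferrers part_red_list reduced_def)

lemma card_cells:
  assumes q: "q \<in> good" shows "card (cells q) = 2"
proof -
  have "bij_betw (\<lambda>(k, b). (Suc k, b)) (SIGMA k:{..<K}. {reduced q k<..part lam k}) (cells q)"
    by (rule bij_betw_byWitness[of _ "\<lambda>(a, b). (a - 1, b)"])
      (auto simp: cells_def dest: part_bound)
  then have "card (cells q) = (\<Sum>k<K. part lam k - reduced q k)"
    by (simp add: bij_betw_same_card[symmetric] card_col_diff)
  also have "\<dots> = (\<Sum>k<K. mult q k)"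
    by (intro sum.cong refl) (use q in \<open>simp add: good_def reduced_def\<close>)
  finally show ?thesis using sum_mult[OF q] by simp
qed

lemma sum_list_lam: "sum_list lam = n"
  using lam by (simp add: partition_of_def)

lemma remove_cells_eq:
  assumes q: "q \<in> good" shows "remove_cells lam (cells q) = red_list q"
  unfolding remove_cells_def card_cells[OF q] sum_list_lam
proof (rule the_equality)
  show "partition_of (n - 2) (red_list q) \<and> ferrers (red_list q) = ferrers lam - cells q"
    using q partition_red_list ferrers_red_list by blast
  fix mu assume "partition_of (n - 2) mu \<and> ferrers mu = ferrers lam - cells q"
  then show "mu = red_list q"
    using partition_of_eqI[OF _ partition_red_list[OF q]] part_eq_of_ferrers ferrers_red_list[OF q] by metis
qed

lemma cells_inj: "inj_on cells good"
proof (rule inj_onI)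
  fix p q assume p: "p \<in> good" and q: "q \<in> good" and eq: "cells p = cells q"
  have "reduced p k = reduced q k" for k
    using part_eq_of_ferrers[of "red_list p" "red_list q" k] ferrers_red_list[OF p] ferrers_red_list[OF q]
      eq part_red_list[OF p] part_red_list[OF q] by simp
  moreover have "mult p k \<le> part lam k" "mult q k \<le> part lam k" for k
    using p q by (auto simp: good_def)
  ultimately have m: "mult p k = mult q k" for k
    unfolding reduced_def by (metis diff_diff_cancel)
  have "fst p \<le> snd p" "fst q \<le> snd q" using p q by (auto simp: good_def)
  then show "p = q"
    using m[of "fst p"] m[of "snd p"] m[of "fst q"] m[of "snd q"]
    by (auto simp: mult_def prod_eq_iff of_bool_def split: if_splits)
qed

text \<open>If a diagram remains, the removed cells form the ends of rows, so they are known from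
  the differences of row lengths; these sum to 2 and hence name two rows or one row twice.\<close>

lemma removable_pairs_eq: "removable_pairs lam = cells ` good"
proof (intro equalityI subsetI)
  fix D assume "D \<in> cells ` good"
  then obtain q where q: "q \<in> good" and D: "D = cells q" by blast
  show "D \<in> removable_pairs lam"
    unfolding removable_pairs_def sum_list_lam D
    using card_cells[OF q] cells_eq[OF q] partition_red_list[OF q] ferrers_red_list[OF q] by blast
next
  fix D assume "D \<in> removable_pairs lam"
  then obtain mu where D: "D \<subseteq> ferrers lam" "card D = 2" and mu: "partition_of (n - 2) mu"
    "ferrers mu = ferrers lam - D"
    unfolding removable_pairs_def sum_list_lam by blast
  have le: "part mu k \<le> part lam k" for k
  proof (cases "part mu k = 0")
    case False
    then have "(Suc k, part mu k) \<in> ferrers mu" by (simp add: mem_ferrers)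
    then have "(Suc k, part mu k) \<in> ferrers lam" using mu(2) by blast
    then show ?thesis by (simp add: mem_ferrers)
  qed simp
  have D_eq: "D = {(a, b). 1 \<le> a \<and> part mu (a - 1) < b \<and> b \<le> part lam (a - 1)}"
  proof -
    have "D = ferrers lam - ferrers mu" using D(1) mu(2) by blast
    then show ?thesis by (auto simp: mem_ferrers)
  qed
  have "bij_betw (\<lambda>(k, b). (Suc k, b)) (SIGMA k:{..<K}. {part mu k<..part lam k}) D"
    unfolding D_eq
    by (rule bij_betw_byWitness[of _ "\<lambda>(a, b). (a - 1, b)"]) (auto dest: part_bound)
  then have "card D = (\<Sum>k<K. part lam k - part mu k)"
    by (simp add: bij_betw_same_card[symmetric] card_col_diff)
  then have "(\<Sum>k<K. part lam k - part mu k) = 2" using D(2) by simp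
  then obtain i j where ij: "i \<le> j" "j < K"
    "\<And>k. k < K \<Longrightarrow> part lam k - part mu k = of_bool (k = i) + of_bool (k = j)"
    by (rule sum_eq_2_cases) blast
  have m: "part lam k - part mu k = mult (i, j) k" for k
  proof (cases "k < K")
    case True
    then show ?thesis using ij by (simp add: mult_def)
  next
    case False
    then show ?thesis using ij by (auto simp: mult_def part_def)
  qed
  have red: "reduced (i, j) k = part mu k" for k
    using le[of k] by (simp add: reduced_def flip: m)
  have "(i, j) \<in> good"
    using ij part_antimono[OF mu(1)] by (auto simp: good_def red simp flip: m)
  moreover have "D = cells (i, j)"
    unfolding D_eq cells_def red ..
  ultimately show "D \<in> cells ` good" by blast
qed

lemma character_removed:
  assumes q: "q \<in> good" and g: "g permutes {1..n - 2}"
  shows "character (remove_cells lam (cells q)) g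
    = of_int (Phi {1..n - 2} K (\<lambda>k. int (part lam k) - int k - int (mult q k)) g)"
proof -
  have "character (red_list q) g = of_int (Phi {1..n - 2} K (\<lambda>i. int (part (red_list q) i) - int i) g)"
    by (rule character_eq_Phi[OF partition_red_list[OF q] length_red_list[OF q] g])
  moreover have "int (part (red_list q) k) = int (part lam k) - int (mult q k)" for k
    using q by (simp add: part_red_list reduced_def good_def of_nat_diff)
  ultimately show ?thesis
    by (simp add: remove_cells_eq[OF q] algebra_simps)
qed

definition v :: "nat \<Rightarrow> int" where "v k = int (part lam k) - int k"

section \<open>Contents of the removable pairs\<close>

lemma cells_diagonal:
  assumes "(k, k) \<in> good"
  shows "cells (k, k) = {(Suc k, part lam k - 1), (Suc k, part lam k)}" "2 \<le> part lam k"
proof -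
  show 2: "2 \<le> part lam k" using good_mult_le[OF assms, of k] by (simp add: mult_def)
  have "reduced (k, k) i = (if i = k then part lam k - 2 else part lam i)" for i
    by (simp add: reduced_def mult_def)
  then show "cells (k, k) = {(Suc k, part lam k - 1), (Suc k, part lam k)}"
    using 2 by (auto simp: cells_def split: if_splits)
qed

text \<open>The left cell is in row \<open>k + 1\<close> and column \<open>part lam k - 1\<close>;
  each of the two shifts by 1 lowers the content. The result is the coefficient in
  \<open>sum_Phi_three_cycles\<close>.\<close>

lemma pair_content_diagonal:
  assumes k: "(k, k) \<in> good"
  shows "pair_content (cells (k, k)) = v k - 2"
proof -
  define m where "m = part lam k - 1"
  have m: "part lam k = Suc m" using cells_diagonal(2)[OF k] by (simp add: m_def)
  have c: "cells (k, k) = {(Suc k, m), (Suc k, Suc m)}"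
    unfolding cells_diagonal(1)[OF k] m by simp
  have iff: "horizontal_domino x (cells (k, k)) \<longleftrightarrow> x = (Suc k, m)" for x
  proof (cases x)
    case (Pair a b)
    show ?thesis
      unfolding Pair horizontal_domino_def c doubleton_eq_iff by auto
  qed
  then have "pair_content (cells (k, k)) = content (Suc k, m)"
    unfolding pair_content_def iff by simp
  then show ?thesis by (simp add: content_def v_def m)
qed

lemma cells_off_diagonal:
  assumes "(i, j) \<in> good" "i < j"
  shows "cells (i, j) = {(Suc i, part lam i), (Suc j, part lam j)}"
proof -
  have "1 \<le> part lam i" "1 \<le> part lam j"
    using good_mult_le[OF assms(1), of i] good_mult_le[OF assms(1), of j] by (simp_all add: mult_def)
  moreover have "reduced (i, j) k = (if k = i then part lam i - 1 else if k = j then part lam j - 1 else part lam k)" for k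
    using assms(2) by (simp add: reduced_def mult_def)
  ultimately show ?thesis
    using assms(2) by (auto simp: cells_def split: if_splits)
qed

text \<open>Cells in different rows form no horizontal domino. In a vertical one the upper cell is
  in row \<open>i + 1\<close> and has content \<open>v i - 1\<close>.\<close>

lemma pair_content_off_diagonal:
  assumes ij: "(i, j) \<in> good" "i < j"
  shows "pair_content (cells (i, j)) = (if j = Suc i \<and> part lam i = part lam j then 1 - v i else - 1)"
proof -
  note c = cells_off_diagonal[OF ij]
  have hd: "\<not> horizontal_domino x (cells (i, j))" for x
  proof (cases x)
    case (Pair a b)
    show ?thesis
      unfolding Pair horizontal_domino_def c doubleton_eq_iff using ij(2) by auto
  qed
  have vd: "vertical_domino x (cells (i, j)) \<longleftrightarrow>
      (j = Suc i \<and> part lam i = part lam j) \<and> x = (Suc i, part lam i)" for x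
  proof (cases x)
    case (Pair a b)
    show ?thesis
      unfolding Pair vertical_domino_def c doubleton_eq_iff using ij(2) by auto
  qed
  show ?thesis
  proof (cases "j = Suc i \<and> part lam i = part lam j")
    case True
    then have vd': "vertical_domino x (cells (i, j)) \<longleftrightarrow> x = (Suc i, part lam i)" for x
      using vd by blast
    have "pair_content (cells (i, j)) = - content (Suc i, part lam i)"
      unfolding pair_content_def vd' using hd by simp
    then show ?thesis using True by (simp add: content_def v_def)
  next
    case False
    then have "\<not> vertical_domino x (cells (i, j))" for x using vd by blast
    then show ?thesis using False hd by (simp only: pair_content_def simp_thms if_False if_cancel)
  qed
qed

section \<open>Terms that vanish or have to be reordered\<close>

definition Phi_reduced :: "nat set \<Rightarrow> (nat \<Rightarrow> nat) \<Rightarrow> nat \<times> nat \<Rightarrow> int" where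
  "Phi_reduced A g q = Phi A K (\<lambda>k. v k - int (mult q k)) g"

definition vertical :: "nat \<Rightarrow> nat \<Rightarrow> bool" where
  "vertical i j \<longleftrightarrow> j = Suc i \<and> part lam i = part lam j"

context
  fixes A :: "nat set" and g :: "nat \<Rightarrow> nat"
  assumes g: "\<And>x. x \<in> A \<Longrightarrow> g x \<in> A"
begin

abbreviation G :: "nat \<times> nat \<Rightarrow> int" where "G \<equiv> Phi_reduced A g"

lemma G_eq_entries:
  assumes "a < K" "b < K" "a \<noteq> b" "v a - int (mult q a) = v b - int (mult q b)"
  shows "G q = 0"
  unfolding Phi_reduced_def Phi_def by (rule altsum_eq_entries[OF symmetric_psi[OF g] assms])

text \<open>Failure means two consecutive equal parts of which only the upper one loses a cell; the
  shifted \<open>v\<close> then has equal entries there.\<close>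

lemma G_off_diagonal_zero:
  assumes "i < j" "j < K" "(i, j) \<notin> good"
  shows "G (i, j) = 0"
proof -
  have "mult (i, j) k \<le> part lam k" for k
    using part_pos[OF lam, of k] assms(1,2) by (auto simp: mult_def Suc_le_eq)
  then obtain k where k: "Suc k < K" "reduced (i, j) k < reduced (i, j) (Suc k)"
    using assms by (auto simp: good_def not_le)
  moreover have "part lam (Suc k) \<le> part lam k" by (rule part_antimono[OF lam]) simp
  moreover have "0 < part lam k" using k by (intro part_pos[OF lam]) simp
  ultimately have "v k - int (mult (i, j) k) = v (Suc k) - int (mult (i, j) (Suc k))"
    using assms(1) by (auto simp: reduced_def mult_def v_def of_bool_def split: if_splits)
  then show ?thesis using k by (intro G_eq_entries[of k "Suc k"]) auto
qed

text \<open>Taking two cells from row \<open>k\<close> fails in three ways. In a last row of length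
  1 the entry drops to \<open>- K\<close>. If the next row is shorter by one, the entries at
  \<open>k\<close> and \<open>Suc k\<close> coincide. If it is equally long, these two entries are
  exchanged relative to taking one cell from each row.\<close>

lemma G_diagonal:
  assumes k: "k < K" "(k, k) \<notin> good"
  shows "G (k, k) = (if Suc k < K \<and> vertical k (Suc k) then - G (k, Suc k) else 0)"
proof (cases "Suc k < K")
  case False
  have "part lam k < 2"
  proof (rule ccontr)
    assume "\<not> part lam k < 2"
    then have "mult (k, k) i \<le> part lam i" for i by (simp add: mult_def)
    moreover have "reduced (k, k) (Suc i) \<le> reduced (k, k) i" if "Suc i < K" for i
    proof -
      have "i \<noteq> k" using that False by blast
      then have "reduced (k, k) i = part lam i" by (simp add: reduced_def mult_def)
      then show ?thesis
        using part_antimono[OF lam, of i "Suc i"] unfolding reduced_def[of _ "Suc i"] by simp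
    qed
    ultimately have "(k, k) \<in> good"
      using k by (simp add: good_def)
    then show False using k(2) by simp
  qed
  then have "v k - int (mult (k, k) k) \<le> - int K"
    using k False by (simp add: v_def mult_def)
  then have "G (k, k) = 0"
    unfolding Phi_reduced_def Phi_def using k(1) psi_negative by (intro altsum_negative_entry[of k]) auto
  then show ?thesis using False by simp
next
  case True
  have le: "part lam (Suc k) \<le> part lam k" by (rule part_antimono[OF lam]) simp
  have pos: "0 < part lam (Suc k)" using True by (rule part_pos[OF lam])
  have lt: "part lam k < part lam (Suc k) + 2"
  proof (rule ccontr)
    assume *: "\<not> part lam k < part lam (Suc k) + 2"
    have "reduced (k, k) (Suc i) \<le> reduced (k, k) i" if "Suc i < K" for i
      using * part_antimono[OF lam, of i "Suc i"] by (auto simp: reduced_def mult_def)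
    then have "(k, k) \<in> good"
      using k * by (auto simp: good_def mult_def)
    then show False using k(2) by simp
  qed
  show ?thesis
  proof (cases "part lam k = part lam (Suc k)")
    case True
    have "(\<lambda>a. v a - int (mult (k, k) a)) \<circ> transpose k (Suc k) = (\<lambda>a. v a - int (mult (k, Suc k) a))"
      using True by (auto simp: fun_eq_iff transpose_def mult_def v_def)
    then have "G (k, Suc k) = - G (k, k)"
      using altsum_transpose[OF symmetric_psi[OF g], where K = K and i = k and j = "Suc k"
          and v = "\<lambda>a. v a - int (mult (k, k) a)"]
        \<open>Suc k < K\<close> by (simp add: Phi_reduced_def Phi_def)
    then show ?thesis using True \<open>Suc k < K\<close> by (simp add: vertical_def)
  next
    case False
    then have "v k - int (mult (k, k) k) = v (Suc k) - int (mult (k, k) (Suc k))"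
      using lt le by (simp add: mult_def v_def)
    then have "G (k, k) = 0" using True by (intro G_eq_entries[of k "Suc k"]) auto
    then show ?thesis using False by (simp add: vertical_def)
  qed
qed

lemma sum_good:
  "(\<Sum>q\<in>good. pair_content (cells q) * G q)
    = (\<Sum>k<K. (v k - 2) * G (k, k)) - (\<Sum>j<K. \<Sum>i<j. G (i, j))"
proof -
  have fin: "finite good"
    by (rule finite_subset[of _ "{..<K} \<times> {..<K}"]) (auto simp: good_def)
  let ?f = "\<lambda>q. pair_content (cells q) * G q"
  have "sum ?f good = sum ?f (good \<inter> {q. fst q = snd q}) + sum ?f (good - {q. fst q = snd q})"
    by (rule sum.Int_Diff[OF fin])
  also have "sum ?f (good \<inter> {q. fst q = snd q}) = (\<Sum>k | k < K \<and> (k, k) \<in> good. (v k - 2) * G (k, k))"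
    by (rule sum.reindex_bij_witness[of _ "\<lambda>k. (k, k)" fst])
      (auto simp: pair_content_diagonal, auto simp: good_def)
  also have "\<dots> = (\<Sum>k<K. if (k, k) \<in> good then (v k - 2) * G (k, k) else 0)"
    by (simp add: sum.inter_filter[symmetric])
  also have "sum ?f (good - {q. fst q = snd q})
      = (\<Sum>(j, i)\<in>Sigma {..<K} (\<lambda>j. {..<j}). if (i, j) \<in> good then ?f (i, j) else 0)"
  proof -
    have "sum ?f (good - {q. fst q = snd q})
        = (\<Sum>(j, i)\<in>{p \<in> Sigma {..<K} (\<lambda>j. {..<j}). (snd p, fst p) \<in> good}. ?f (i, j))"
      by (rule sum.reindex_bij_witness[of _ "\<lambda>(j, i). (i, j)" "\<lambda>(i, j). (j, i)"])
        (auto simp: good_def)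
    then show ?thesis
      by (simp add: sum.inter_filter case_prod_unfold)
  qed
  also have "\<dots> = (\<Sum>j<K. \<Sum>i<j. if (i, j) \<in> good then ?f (i, j) else 0)"
    by (rule sum.Sigma[symmetric]) auto
  \<comment> \<open>For a vertical pair, \<open>1 - v i = - 1 - (v i - 2)\<close>: the
    \<open>- 1\<close> of every off-diagonal pair, and what the reordered \<open>G (i, i)\<close>
    contributes.\<close>
  also have "\<dots> = (\<Sum>j<K. \<Sum>i<j. - G (i, j) - (if vertical i j then (v i - 2) * G (i, j) else 0))"
  proof (intro sum.cong refl)
    fix j i assume "j \<in> {..<K}" "i \<in> {..<j}"
    then show "(if (i, j) \<in> good then ?f (i, j) else 0)
        = - G (i, j) - (if vertical i j then (v i - 2) * G (i, j) else 0)"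
      by (auto simp: pair_content_off_diagonal G_off_diagonal_zero vertical_def algebra_simps)
  qed
  also have "\<dots> = - (\<Sum>j<K. \<Sum>i<j. G (i, j))
      - (\<Sum>j<K. \<Sum>i<j. if vertical i j then (v i - 2) * G (i, j) else 0)"
    by (simp add: sum_subtractf sum_negf)
  also have "(\<Sum>j<K. \<Sum>i<j. if vertical i j then (v i - 2) * G (i, j) else 0)
      = (\<Sum>k<K. if Suc k < K \<and> vertical k (Suc k) then (v k - 2) * G (k, Suc k) else 0)"
  proof -
    have "(\<Sum>j<K. \<Sum>i<j. if vertical i j then (v i - 2) * G (i, j) else 0)
        = (\<Sum>(j, i)\<in>Sigma {..<K} (\<lambda>j. {..<j}). if vertical i j then (v i - 2) * G (i, j) else 0)"
      by (rule sum.Sigma) auto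
    also have "\<dots> = (\<Sum>(j, i)\<in>{p \<in> Sigma {..<K} (\<lambda>j. {..<j}). vertical (snd p) (fst p)}. (v i - 2) * G (i, j))"
      by (simp add: sum.inter_filter case_prod_unfold)
    also have "\<dots> = (\<Sum>k\<in>{k \<in> {..<K}. Suc k < K \<and> vertical k (Suc k)}. (v k - 2) * G (k, Suc k))"
      by (rule sum.reindex_bij_witness[of _ "\<lambda>k. (Suc k, k)" snd]) (auto simp: vertical_def)
    finally show ?thesis unfolding sum.inter_filter[OF finite_lessThan] .
  qed
  finally have "sum ?f good = (\<Sum>k<K. (if (k, k) \<in> good then (v k - 2) * G (k, k) else 0)
      - (if Suc k < K \<and> vertical k (Suc k) then (v k - 2) * G (k, Suc k) else 0))
      - (\<Sum>j<K. \<Sum>i<j. G (i, j))"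
    by (simp add: sum_subtractf)
  also have "(\<Sum>k<K. (if (k, k) \<in> good then (v k - 2) * G (k, k) else 0)
      - (if Suc k < K \<and> vertical k (Suc k) then (v k - 2) * G (k, Suc k) else 0))
      = (\<Sum>k<K. (v k - 2) * G (k, k))"
  proof (intro sum.cong refl)
    fix k assume k: "k \<in> {..<K}"
    \<comment> \<open>The two cases exclude each other: a row followed by an equally long one cannot
      lose two cells on its own.\<close>
    have "\<not> (Suc k < K \<and> vertical k (Suc k))" if "(k, k) \<in> good"
    proof
      assume *: "Suc k < K \<and> vertical k (Suc k)"
      then have "reduced (k, k) (Suc k) \<le> reduced (k, k) k" using that by (simp add: good_def)
      moreover have "2 \<le> part lam k" by (rule cells_diagonal(2)[OF that])
      ultimately show False using * by (simp add: reduced_def mult_def vertical_def)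
    qed
    then show "(if (k, k) \<in> good then (v k - 2) * G (k, k) else 0)
      - (if Suc k < K \<and> vertical k (Suc k) then (v k - 2) * G (k, Suc k) else 0) = (v k - 2) * G (k, k)"
      using G_diagonal[of k] k by auto
  qed
  finally show ?thesis .
qed

lemma sum_pairs:
  "(\<Sum>P | P \<subseteq> {..<K} \<and> card P = 2. Phi A K (\<lambda>i. v i - of_bool (i \<in> P)) g) = (\<Sum>j<K. \<Sum>i<j. G (i, j))"
proof -
  have "(\<Sum>P | P \<subseteq> {..<K} \<and> card P = 2. Phi A K (\<lambda>i. v i - of_bool (i \<in> P)) g)
      = (\<Sum>(j, i)\<in>Sigma {..<K} (\<lambda>j. {..<j}). G (i, j))"
  proof (rule sum.reindex_bij_witness[of _ "\<lambda>(j, i). {i, j}" "\<lambda>P. (Max P, Min P)"])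
    fix P assume P: "P \<in> {P. P \<subseteq> {..<K} \<and> card P = 2}"
    then obtain i j where ij: "P = {i, j}" "i < j"
      by (auto simp: card_2_iff) (metis insert_commute linorder_neqE_nat)
    then have m: "Max P = j" "Min P = i" by auto
    show "(case (Max P, Min P) of (j, i) \<Rightarrow> {i, j}) = P" using m ij by simp
    show "(Max P, Min P) \<in> Sigma {..<K} (\<lambda>j. {..<j})" using m ij P by auto
    have "(\<lambda>k. v k - int (mult (i, j) k)) = (\<lambda>k. v k - of_bool (k \<in> P))"
      using ij by (auto simp: fun_eq_iff mult_def)
    then show "(case (Max P, Min P) of (j, i) \<Rightarrow> G (i, j)) = Phi A K (\<lambda>i. v i - of_bool (i \<in> P)) g"
      using m by (simp add: Phi_reduced_def)
  qed auto
  also have "\<dots> = (\<Sum>j<K. \<Sum>i<j. G (i, j))"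
    by (rule sum.Sigma[symmetric]) auto
  finally show ?thesis .
qed

end

end

theorem theorem2:
  fixes n :: nat and \<sigma> :: "nat \<Rightarrow> nat" and lam :: "nat list"
  assumes "n \<ge> 3"
    and "\<sigma> permutes {1..n}"
    and "\<sigma> n = n"
    and "\<sigma> (n - 1) = n - 1"
    and "partition_of n lam"
  shows "character_lin lam (T_elem n \<sigma>)
           = (\<Sum>i=1..n - 2. character lam (\<sigma> \<circ> cycle_of_list [i, n - 1, n]))
       \<and> (\<Sum>i=1..n - 2. character lam (\<sigma> \<circ> cycle_of_list [i, n - 1, n]))
           = (\<Sum>D\<in>removable_pairs lam. of_int (pair_content D) *
                character (remove_cells lam D) (perm_restrict \<sigma> {1..n - 2}))"
proof
  note \<sigma> = assms(2)
  let ?K = "length lam"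
  let ?A = "{1..n - 2}"
  let ?s = "\<lambda>i. \<sigma> \<circ> cycle_of_list [i, n - 1, n]"
  let ?\<tau> = "perm_restrict \<sigma> ?A"
  have sum: "sum_list lam = n" using assms(5) by (simp add: partition_of_def)
  have A: "{1..n} = insert (n - 1) (insert n ?A)" using assms(1) by auto
  have xy: "n - 1 \<noteq> n" "n - 1 \<notin> ?A" "n \<notin> ?A" using assms(1) by auto
  have s: "?s i permutes {1..n}" if "i \<in> ?A" for i
  proof -
    have "cycle_of_list [i, n - 1, n] permutes {1..n}"
      using assms(1) that by (intro permutes_subset[OF cycle_permutes]) auto
    then show ?thesis using \<sigma> by (rule permutes_compose)
  qed
  show "character_lin lam (T_elem n \<sigma>) = (\<Sum>i=1..n - 2. character lam (?s i))"
  proof -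
    have "character_lin lam (T_elem n \<sigma>)
        = (\<Sum>p\<in>symg n. \<Sum>i\<in>?A. galg_basis (?s i) p * character lam p)"
      unfolding character_lin_def T_elem_def sum sum_fun_apply sum_distrib_right ..
    also have "\<dots> = (\<Sum>i\<in>?A. \<Sum>p\<in>symg n. galg_basis (?s i) p * character lam p)"
      by (rule sum.swap)
    also have "\<dots> = (\<Sum>i\<in>?A. character lam (?s i))"
    proof (rule sum.cong[OF refl])
      fix i assume i: "i \<in> ?A"
      have "(\<Sum>p\<in>symg n. galg_basis (?s i) p * character lam p)
          = (\<Sum>p\<in>symg n. if p = ?s i then character lam (?s i) else 0)"
        by (intro sum.cong refl) (simp only: galg_basis_def mult_1 mult_zero_left if_distrib split: if_split, blast)
      also have "\<dots> = character lam (?s i)"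
        using s[OF i] by (simp del: cycle_of_list.simps)
      finally show "(\<Sum>p\<in>symg n. galg_basis (?s i) p * character lam p) = character lam (?s i)" .
    qed
    finally show ?thesis .
  qed
  interpret removal n lam by unfold_locales (rule assms(5))
  have maps: "\<sigma> x \<in> ?A" if x: "x \<in> ?A" for x
  proof -
    have "\<sigma> x \<in> {1..n}" using permutes_in_image[OF \<sigma>, of x] x assms(1) by auto
    moreover have "\<sigma> x \<noteq> n" "\<sigma> x \<noteq> n - 1"
      using injD[OF permutes_inj[OF \<sigma>], of x n] injD[OF permutes_inj[OF \<sigma>], of x "n - 1"]
        assms(3,4) x xy by auto
    ultimately show ?thesis by auto
  qed
  have \<tau>_eq: "?\<tau> x = \<sigma> x" if "x \<in> ?A" for x using that by (simp add: perm_restrict_simps)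
  have \<tau>: "?\<tau> permutes ?A"
  proof (rule bij_imp_permutes)
    have "inj_on \<sigma> ?A" by (rule inj_on_subset[OF permutes_inj[OF \<sigma>]]) simp
    moreover have "\<sigma> ` ?A \<subseteq> ?A" using maps by blast
    ultimately have "bij_betw \<sigma> ?A ?A"
      by (intro bij_betw_imageI endo_inj_surj) simp_all
    then show "bij_betw ?\<tau> ?A ?A" using \<tau>_eq bij_betw_cong[of ?A ?\<tau> \<sigma>] by blast
  qed (simp add: perm_restrict_simps)
  have "(\<Sum>i\<in>?A. character lam (?s i)) = of_int (\<Sum>i\<in>?A. Phi {1..n} ?K v (?s i))"
    unfolding of_int_sum
  proof (rule sum.cong[OF refl])
    fix i assume "i \<in> ?A"
    then show "character lam (?s i) = of_int (Phi {1..n} ?K v (?s i))"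
      using character_eq_Phi[OF assms(5) order_refl s] by (simp only: v_def[abs_def])
  qed
  also have "(\<Sum>i\<in>?A. Phi {1..n} ?K v (?s i))
      = (\<Sum>k<?K. (v k - 2) * Phi ?A ?K (\<lambda>i. v i - (if i = k then 2 else 0)) \<sigma>)
        - (\<Sum>P | P \<subseteq> {..<?K} \<and> card P = 2. Phi ?A ?K (\<lambda>i. v i - of_bool (i \<in> P)) \<sigma>)"
    by (rule sum_Phi_three_cycles[OF _ A xy \<sigma> assms(4,3)]) simp
  also have "\<dots> = (\<Sum>k<?K. (v k - 2) * Phi_reduced ?A \<sigma> (k, k)) - (\<Sum>j<?K. \<Sum>i<j. Phi_reduced ?A \<sigma> (i, j))"
  proof -
    have "Phi ?A ?K (\<lambda>i. v i - (if i = k then 2 else 0)) \<sigma> = Phi_reduced ?A \<sigma> (k, k)" for k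
      unfolding Phi_reduced_def by (rule Phi_cong) (simp_all add: mult_def)
    then show ?thesis by (simp only: sum_pairs[of ?A \<sigma>, OF maps])
  qed
  also have "\<dots> = (\<Sum>q\<in>good. pair_content (cells q) * Phi_reduced ?A \<sigma> q)"
    by (rule sum_good[of ?A \<sigma>, OF maps, symmetric])
  also have "of_int \<dots> = (\<Sum>q\<in>good. of_int (pair_content (cells q)) * character (remove_cells lam (cells q)) ?\<tau>)"
    unfolding of_int_sum of_int_mult
  proof (rule sum.cong[OF refl])
    fix q assume q: "q \<in> good"
    \<comment> \<open>\<open>Phi\<close> over \<open>?A\<close> reads the permutation only on
      \<open>?A\<close>, so \<open>\<sigma>\<close> may be replaced by its restriction, which unlike
      \<open>\<sigma>\<close> is certified as a permutation of \<open>?A\<close>.\<close>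
    have "Phi_reduced ?A \<sigma> q = Phi ?A ?K (\<lambda>k. v k - int (mult q k)) ?\<tau>"
      unfolding Phi_reduced_def by (rule Phi_cong) (simp_all only: \<tau>_eq)
    then show "of_int (pair_content (cells q)) * of_int (Phi_reduced ?A \<sigma> q)
        = of_int (pair_content (cells q)) * character (remove_cells lam (cells q)) ?\<tau>"
      by (simp only: character_removed[OF q \<tau>] v_def)
  qed
  also have "\<dots> = (\<Sum>D\<in>removable_pairs lam. of_int (pair_content D) * character (remove_cells lam D) ?\<tau>)"
    unfolding removable_pairs_eq by (simp only: sum.reindex[OF cells_inj] comp_def)
  finally show "(\<Sum>i=1..n - 2. character lam (?s i))
      = (\<Sum>D\<in>removable_pairs lam. of_int (pair_content D) * character (remove_cells lam D) ?\<tau>)" .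
qed

end
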